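(* Let $\mathcal{A}\in Sp(2d,\mathbb{R})$ be totally Wigner-decomposable, i.e. $\mathcal{A}=\mathcal{A}_{FT2}\mathcal{D}_E$ for some $E\in GL(2d,\mathbb{R})$, and write in $d\times d$ blocks $$E=\begin{pmatrix}A&B\\C&D\end{pmatrix},\qquad E^{-1}=\begin{pmatrix}A'&B'\\C'&D'\end{pmatrix}.$$ Then, for $a\in\mathcal{S}'(\mathbb{R}^{2d})$ and $\varphi_1,\varphi_2\in\mathcal{S}(\mathbb{R}^d)$, the Schwartz kernel $k$ of $A_{a,\mathcal{A}}^{\varphi_1,\varphi_2}$ is given by $$k(x,y)=\int_{\mathbb{R}^d}\big(T_{(t,0)}\mathcal{F}_2^{-1}a\big)(E^{-1}(x,y))\;\varphi_2\big(At+B(C'x+D'y)\big)\;\overline{\varphi_1\big(Ct+D(C'x+D'y)\big)}\,dt,$$ where the integral is understood in the weak sense.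
   Context: Brackets $\langle f,g\rangle$ extend the $L^2$ inner product $\int f\overline{g}$ (conjugate-linear in the second entry) to $\mathcal{S}'\times\mathcal{S}$. $T_xf(t)=f(t-x)$, $M_\xi f(t)=e^{2\pi i\xi\cdot t}f(t)$; $T_{(t,0)}$ is translation on $\mathbb{R}^{2d}$ by $(t,0)$, $t\in\mathbb{R}^d$. The Fourier transform is $\hat f(\xi)=\int f(x)e^{-2\pi i\xi\cdot x}dx$, and $\mathcal{F}_2$ is the partial Fourier transform on $\mathcal{S}'(\mathbb{R}^{2d})$ in the second $d$ variables: $\mathcal{F}_2(f\otimes g)=f\otimes\hat g$. Metaplectic operators: $Sp(2d,\mathbb{R})$ is the group of real $4d\times4d$ matrices $\mathcal{A}$ with $\mathcal{A}^TJ\mathcal{A}=J$, $J=\begin{pmatrix}0&I_{2d}\\-I_{2d}&0\end{pmatrix}$. For $x,\xi\in\mathbb{R}^{2d}$, $\tau\in\mathbb{R}$ let $\rho(x,\xi;\tau)=e^{2\pi i\tau}e^{-\pi i\xi\cdot x}M_\xi T_x$ on $L^2(\mathbb{R}^{2d})$. $\hat{\mathcal{A}}$ denotes a metaplectic operator with projection $\mathcal{A}$: a unitary operator on $L^2(\mathbb{R}^{2d})$ with $\hat{\mathcal{A}}\rho(w;\tau)\hat{\mathcal{A}}^{-1}=\rho(\mathcal{A}w;\tau)$ for all $w\in\mathbb{R}^{4d}$, $\tau\in\mathbb{R}$. It is unique up to a unimodular constant (immaterial here), restricts to an automorphism of $\mathcal{S}(\mathbb{R}^{2d})$ and extends to one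 of $\mathcal{S}'(\mathbb{R}^{2d})$. The matrices are (with $d\times d$ blocks for the first) $$\mathcal{A}_{FT2}=\begin{pmatrix}I&0&0&0\\0&0&0&I\\0&0&I&0\\0&-I&0&0\end{pmatrix},\qquad \mathcal{D}_E=\begin{pmatrix}E^{-1}&0\\0&E^T\end{pmatrix}\ (E\in GL(2d,\mathbb{R})),$$ with associated metaplectic operators $\mathcal{F}_2$ and $F\mapsto|\det E|^{1/2}F(E\,\cdot)$ respectively (up to unimodular constants). $W_{\mathcal{A}}(f,g)=\hat{\mathcal{A}}(f\otimes\overline{g})$, $(f\otimes\overline g)(x,y)=f(x)\overline{g(y)}$. For $\sigma\in\mathcal{S}'(\mathbb{R}^{2d})$, $\operatorname{Op}_{\mathcal{A}}(\sigma):\mathcal{S}(\mathbb{R}^d)\to\mathcal{S}'(\mathbb{R}^d)$ is defined by $\langle\operatorname{Op}_{\mathcal{A}}(\sigma)f,g\rangle=\langle\sigma,W_{\mathcal{A}}(g,f)\rangle$. The $\mathcal{A}$-localization operator is $A_{a,\mathcal{A}}^{\varphi_1,\varphi_2}=\operatorname{Op}_{\mathcal{A}}(a*W_{\mathcal{A}}(\varphi_2,\varphi_1))$. Its Schwartz kernel is the $k\in\mathcal{S}'(\mathbb{R}^{2d})$ with $\langle A_{a,\mathcal{A}}^{\varphi_1,\varphi_2}f,g\rangle=\langle k,g\otimes\overline{f}\rangle$ for all $f,g\in\mathcal{S}(\mathbb{R}^d)$. Meaning of the weak integral: with $H=\mathcal{F}_2^{-1}a\in\mathcal{S}'(\mathbb{R}^{2d})$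 and $\Phi=\varphi_2\otimes\overline{\varphi_1}$, let $G(u,v)=\int_{\mathbb{R}^d}H(u-t,v)\,\Phi(E(t,v))\,dt$ be the tempered distribution $\langle G,\psi\rangle=\Big\langle H,\ (u,v)\mapsto\int_{\mathbb{R}^d}\overline{\Phi(E(t,v))}\,\psi(u+t,v)\,dt\Big\rangle$, $\psi\in\mathcal{S}(\mathbb{R}^{2d})$; the right-hand side of the claim is $G(E^{-1}(x,y))$, the composition of $G$ with the invertible linear map $E^{-1}$. *)

theory Defs
  imports "HOL-Analysis.Analysis"
begin

section \<open>Block vectors and block matrices\<close>

text \<open>The space of dimension \<open>2d\<close> is \<open>real ^ ('n + 'n)\<close>, that of dimension \<open>4d\<close> is
  \<open>real ^ (('n + 'n) + ('n + 'n))\<close>, where \<open>d = CARD('n)\<close>.\<close>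

definition vjoin :: "real ^ 'm \<Rightarrow> real ^ 'n \<Rightarrow> real ^ ('m + 'n)" where
  "vjoin x y = (\<chi> i. case i of Inl j \<Rightarrow> x $ j | Inr j \<Rightarrow> y $ j)"

definition vfst :: "real ^ ('m::finite + 'n::finite) \<Rightarrow> real ^ 'm" where
  "vfst z = (\<chi> j. z $ Inl j)"

definition vsnd :: "real ^ ('m::finite + 'n::finite) \<Rightarrow> real ^ 'n" where
  "vsnd z = (\<chi> j. z $ Inr j)"

definition block ::
  "real ^ 'm ^ 'm \<Rightarrow> real ^ 'n ^ 'm \<Rightarrow> real ^ 'm ^ 'n \<Rightarrow> real ^ 'n ^ 'n \<Rightarrow> real ^ ('m + 'n) ^ ('m + 'n)"
  where
  "block A B C D = (\<chi> i j.
     case i of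
       Inl p \<Rightarrow> (case j of Inl q \<Rightarrow> A $ p $ q | Inr q \<Rightarrow> B $ p $ q)
     | Inr p \<Rightarrow> (case j of Inl q \<Rightarrow> C $ p $ q | Inr q \<Rightarrow> D $ p $ q))"

definition sympl_J :: "real ^ ('m::finite + 'm) ^ ('m + 'm)" where
  "sympl_J = block 0 (mat 1) (- mat 1) 0"

definition Sp :: "(real ^ ('m::finite + 'm) ^ ('m + 'm)) set" where
  "Sp = {M. transpose M ** sympl_J ** M = sympl_J}"

definition A_FT2 :: "real ^ (('n::finite + 'n) + ('n + 'n)) ^ (('n + 'n) + ('n + 'n))" where
  "A_FT2 = block
     (block (mat 1) 0
            0       0)        (block 0 0
                                     0 (mat 1))
     (block 0 0
            0 (- mat 1))      (block (mat 1) 0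
                                     0       0)"

definition D_mat :: "real ^ 'm ^ 'm \<Rightarrow> real ^ ('m::finite + 'm) ^ ('m + 'm)" where
  "D_mat E = block (matrix_inv E) 0 0 (transpose E)"


section \<open>Schwartz functions and tempered distributions\<close>

definition dir_deriv :: "'a::euclidean_space \<Rightarrow> ('a \<Rightarrow> complex) \<Rightarrow> 'a \<Rightarrow> complex" where
  "dir_deriv v f = (\<lambda>x. frechet_derivative f (at x) v)"

text \<open>A multi-index is encoded as a list of basis vectors: \<open>foldr dir_deriv vs f\<close> is the iterated
  partial derivative of \<open>f\<close>, of order \<open>length vs\<close>.\<close>

definition schwartz :: "('a::euclidean_space \<Rightarrow> complex) set" where
  "schwartz = {f. \<forall>vs. set vs \<subseteq> Basis \<longrightarrow>
      (\<forall>x. foldr dir_deriv vs f differentiable (at x)) \<and>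
      (\<forall>N::nat. bounded (range (\<lambda>x. (1 + norm x) ^ N * norm (foldr dir_deriv vs f x))))}"

definition schwartz_norm :: "nat \<Rightarrow> ('a::euclidean_space \<Rightarrow> complex) \<Rightarrow> real" where
  "schwartz_norm N f =
     (SUP (vs, x) \<in> {vs. set vs \<subseteq> Basis \<and> length vs \<le> N} \<times> UNIV.
        (1 + norm x) ^ N * norm (foldr dir_deriv vs f x))"

text \<open>A tempered distribution \<open>u\<close> is represented by the continuous \<^emph>\<open>conjugate-linear\<close> functional
  \<open>\<psi> \<mapsto> \<langle>u, \<psi>\<rangle>\<close> on the Schwartz space, where the bracket extends the \<open>L\<^sup>2\<close> inner product
  \<open>\<integral> f \<cdot> cnj g\<close>; thus \<open>u \<psi>\<close> is to be read as \<open>\<langle>u, \<psi>\<rangle>\<close>.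
  Values of \<open>u\<close> at functions that are not Schwartz are irrelevant, so equality in \<open>S'\<close> is
  \<open>dist_eq\<close>.\<close>

definition tempered :: "(('a::euclidean_space \<Rightarrow> complex) \<Rightarrow> complex) set" where
  "tempered = {u.
      (\<forall>f\<in>schwartz. \<forall>g\<in>schwartz. u (\<lambda>x. f x + g x) = u f + u g) \<and>
      (\<forall>c. \<forall>f\<in>schwartz. u (\<lambda>x. c * f x) = cnj c * u f) \<and>
      (\<exists>N C. \<forall>f\<in>schwartz. norm (u f) \<le> C * schwartz_norm N f)}"

definition dist_eq ::
  "(('a::euclidean_space \<Rightarrow> complex) \<Rightarrow> complex) \<Rightarrow> (('a \<Rightarrow> complex) \<Rightarrow> complex) \<Rightarrow> bool"
  where
  "dist_eq u v \<longleftrightarrow> (\<forall>\<psi>\<in>schwartz. u \<psi> = v \<psi>)"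

text \<open>Convolution \<open>u * \<phi>\<close>: for a function \<open>u\<close>,
  \<open>\<integral>\<integral> u x \<cdot> \<phi> (y - x) \<cdot> cnj (\<psi> y) dx dy = \<langle>u, x \<mapsto> \<integral> \<psi> y \<cdot> cnj (\<phi> (y - x)) dy\<rangle>\<close>.\<close>

definition dist_conv ::
  "(('a::euclidean_space \<Rightarrow> complex) \<Rightarrow> complex) \<Rightarrow> ('a \<Rightarrow> complex) \<Rightarrow> ('a \<Rightarrow> complex) \<Rightarrow> complex"
  where
  "dist_conv u \<phi> = (\<lambda>\<psi>. u (\<lambda>x. LINT y|lborel. \<psi> y * cnj (\<phi> (y - x))))"

text \<open>Composition \<open>u \<circ> L\<close> with the invertible linear map given by the matrix \<open>L\<close>, by change of
  variables.\<close>

definition dist_comp ::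
  "real ^ 'm ^ 'm \<Rightarrow> ((real ^ 'm \<Rightarrow> complex) \<Rightarrow> complex) \<Rightarrow> (real ^ 'm::finite \<Rightarrow> complex) \<Rightarrow> complex"
  where
  "dist_comp L u = (\<lambda>\<psi>. u (\<lambda>z. of_real (1 / \<bar>det L\<bar>) * \<psi> (matrix_inv L *v z)))"

definition partial_fourier2 ::
  "(real ^ ('m::finite + 'n::finite) \<Rightarrow> complex) \<Rightarrow> real ^ ('m + 'n) \<Rightarrow> complex"
  where
  "partial_fourier2 \<psi> = (\<lambda>z. LINT y|lborel. \<psi> (vjoin (vfst z) y) * cis (- 2 * pi * (vsnd z \<bullet> y)))"

text \<open>The inverse partial Fourier transform on tempered distributions: as the partial Fourier
  transform is unitary, \<open>\<langle>F\<^sub>2\<^sup>-\<^sup>1 u, \<psi>\<rangle> = \<langle>u, F\<^sub>2 \<psi>\<rangle>\<close>.\<close>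

definition dist_inv_partial_fourier2 ::
  "((real ^ ('m::finite + 'n::finite) \<Rightarrow> complex) \<Rightarrow> complex)
     \<Rightarrow> (real ^ ('m + 'n) \<Rightarrow> complex) \<Rightarrow> complex"
  where
  "dist_inv_partial_fourier2 u = (\<lambda>\<psi>. u (partial_fourier2 \<psi>))"


section \<open>Metaplectic operators\<close>

definition translation :: "'a::euclidean_space \<Rightarrow> ('a \<Rightarrow> complex) \<Rightarrow> 'a \<Rightarrow> complex" where
  "translation x f = (\<lambda>t. f (t - x))"

definition modulation :: "'a::euclidean_space \<Rightarrow> ('a \<Rightarrow> complex) \<Rightarrow> 'a \<Rightarrow> complex" where
  "modulation \<xi> f = (\<lambda>t. cis (2 * pi * (\<xi> \<bullet> t)) * f t)"

definition rho ::
  "real ^ ('m::finite + 'm) \<Rightarrow> real \<Rightarrow> (real ^ 'm \<Rightarrow> complex) \<Rightarrow> real ^ 'm \<Rightarrow> complex"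
  where
  "rho w \<tau> f = (\<lambda>t. cis (2 * pi * \<tau>) * cis (- pi * (vsnd w \<bullet> vfst w)) *
                    modulation (vsnd w) (translation (vfst w) f) t)"

text \<open>Elements of \<open>L\<^sup>2\<close> are represented by Borel measurable functions, and operators on \<open>L\<^sup>2\<close>
  by maps on representatives that respect almost everywhere equality.\<close>

definition L2 :: "('a::euclidean_space \<Rightarrow> complex) set" where
  "L2 = {f \<in> borel_measurable lborel. integrable lborel (\<lambda>x. (norm (f x))\<^sup>2)}"

definition L2_inner :: "('a::euclidean_space \<Rightarrow> complex) \<Rightarrow> ('a \<Rightarrow> complex) \<Rightarrow> complex" where
  "L2_inner f g = (LINT x|lborel. f x * cnj (g x))"

definition unitary_L2 ::
  "(('a::euclidean_space \<Rightarrow> complex) \<Rightarrow> 'a \<Rightarrow> complex) \<Rightarrow> bool"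
  where
  "unitary_L2 U \<longleftrightarrow>
     (\<forall>f\<in>L2. U f \<in> L2) \<and>
     (\<forall>f\<in>L2. \<forall>g\<in>L2. (AE x in lborel. f x = g x) \<longrightarrow> (AE x in lborel. U f x = U g x)) \<and>
     (\<forall>f\<in>L2. \<forall>g\<in>L2. AE x in lborel. U (\<lambda>y. f y + g y) x = U f x + U g x) \<and>
     (\<forall>c. \<forall>f\<in>L2. AE x in lborel. U (\<lambda>y. c * f y) x = c * U f x) \<and>
     (\<forall>f\<in>L2. \<forall>g\<in>L2. L2_inner (U f) (U g) = L2_inner f g) \<and>
     (\<forall>g\<in>L2. \<exists>f\<in>L2. AE x in lborel. U f x = g x)"

text \<open>\<open>U\<close> is a metaplectic operator with projection \<open>M\<close>; the condition
  \<open>U \<rho>(w;\<tau>) U\<^sup>-\<^sup>1 = \<rho>(M w;\<tau>)\<close> is written as \<open>U \<rho>(w;\<tau>) = \<rho>(M w;\<tau>) U\<close>.\<close>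

definition metaplectic ::
  "((real ^ 'm \<Rightarrow> complex) \<Rightarrow> real ^ 'm \<Rightarrow> complex) \<Rightarrow> real ^ ('m::finite + 'm) ^ ('m + 'm) \<Rightarrow> bool"
  where
  "metaplectic U M \<longleftrightarrow> M \<in> Sp \<and> unitary_L2 U \<and>
     (\<forall>w \<tau>. \<forall>f\<in>L2. AE x in lborel. U (rho w \<tau> f) x = rho (M *v w) \<tau> (U f) x)"


section \<open>Metaplectic Wigner distributions, quantization and localization operators\<close>

definition tensor ::
  "(real ^ 'm \<Rightarrow> complex) \<Rightarrow> (real ^ 'n \<Rightarrow> complex) \<Rightarrow> real ^ ('m + 'n) \<Rightarrow> complex" where
  "tensor f g = (\<lambda>z. f (vfst z) * g (vsnd z))"

text \<open>A metaplectic operator maps a Schwartz function to (the class of) a Schwartz function; as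
  operators act on representatives here, the Schwartz representative has to be selected. It is
  unique, since continuous functions that agree almost everywhere are equal.\<close>

definition schwartz_rep :: "('a::euclidean_space \<Rightarrow> complex) \<Rightarrow> 'a \<Rightarrow> complex" where
  "schwartz_rep F = (THE h. h \<in> schwartz \<and> (AE x in lborel. h x = F x))"

definition wigner ::
  "((real ^ ('n::finite + 'n) \<Rightarrow> complex) \<Rightarrow> real ^ ('n + 'n) \<Rightarrow> complex)
     \<Rightarrow> (real ^ 'n \<Rightarrow> complex) \<Rightarrow> (real ^ 'n \<Rightarrow> complex) \<Rightarrow> real ^ ('n + 'n) \<Rightarrow> complex"
  where
  "wigner U f g = schwartz_rep (U (tensor f (\<lambda>y. cnj (g y))))"

text \<open>For Schwartz \<open>f\<close>, the functional \<open>Op U \<sigma> f\<close> is a tempered distribution.\<close>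

definition Op ::
  "((real ^ ('n::finite + 'n) \<Rightarrow> complex) \<Rightarrow> real ^ ('n + 'n) \<Rightarrow> complex)
     \<Rightarrow> ((real ^ ('n + 'n) \<Rightarrow> complex) \<Rightarrow> complex)
     \<Rightarrow> (real ^ 'n \<Rightarrow> complex) \<Rightarrow> (real ^ 'n \<Rightarrow> complex) \<Rightarrow> complex"
  where
  "Op U \<sigma> f = (\<lambda>g. \<sigma> (wigner U g f))"

definition loc_op ::
  "((real ^ ('n::finite + 'n) \<Rightarrow> complex) \<Rightarrow> real ^ ('n + 'n) \<Rightarrow> complex)
     \<Rightarrow> ((real ^ ('n + 'n) \<Rightarrow> complex) \<Rightarrow> complex)
     \<Rightarrow> (real ^ 'n \<Rightarrow> complex) \<Rightarrow> (real ^ 'n \<Rightarrow> complex)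
     \<Rightarrow> (real ^ 'n \<Rightarrow> complex) \<Rightarrow> (real ^ 'n \<Rightarrow> complex) \<Rightarrow> complex"
  where
  "loc_op U a \<phi>1 \<phi>2 = Op U (dist_conv a (wigner U \<phi>2 \<phi>1))"

definition is_schwartz_kernel ::
  "((real ^ ('n::finite + 'n) \<Rightarrow> complex) \<Rightarrow> complex)
     \<Rightarrow> ((real ^ 'n \<Rightarrow> complex) \<Rightarrow> (real ^ 'n \<Rightarrow> complex) \<Rightarrow> complex) \<Rightarrow> bool"
  where
  "is_schwartz_kernel k T \<longleftrightarrow> k \<in> tempered \<and>
     (\<forall>f\<in>schwartz. \<forall>g\<in>schwartz. T f g = k (tensor g (\<lambda>y. cnj (f y))))"

text \<open>The distribution \<open>(u, v) \<mapsto> \<integral> H(u - t, v) \<cdot> \<Psi> t v dt\<close>, that is,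
  \<open>\<integral> T\<^bsub>(t,0)\<^esub>H \<cdot> \<Psi> t v dt\<close>, in the weak sense.\<close>

definition weak_integral ::
  "((real ^ ('m::finite + 'n::finite) \<Rightarrow> complex) \<Rightarrow> complex)
     \<Rightarrow> (real ^ 'm \<Rightarrow> real ^ 'n \<Rightarrow> complex)
     \<Rightarrow> (real ^ ('m + 'n) \<Rightarrow> complex) \<Rightarrow> complex"
  where
  "weak_integral H \<Psi> = (\<lambda>\<psi>. H (\<lambda>z. LINT t|lborel.
       cnj (\<Psi> t (vsnd z)) * \<psi> (vjoin (vfst z + t) (vsnd z))))"

end

theory Submission
  imports Defs "HOL-Probability.Characteristic_Functions" "HOL-Probability.Sinc_Integral"
begin

text \<open>Let \<open>V F = F\<^sub>2 (F \<circ> E)\<close>. It intertwines the operators \<open>rho\<close> in the same way as \<open>U\<close>, so for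
  Schwartz \<open>F\<close> and \<open>G\<close> the pairs \<open>(U F, U G)\<close> and \<open>(V F, V G)\<close> have proportional matrix coefficients
  \<open>\<langle>\<cdot>, rho w \<cdot>\<rangle>\<close>. These are Fourier transforms of \<open>t \<mapsto> F t \<cdot> cnj (G (t - x))\<close>; injectivity of the Fourier
  transform on \<open>L\<^sup>1\<close> shows that \<open>U F \<otimes> cnj (U G)\<close> and \<open>V F \<otimes> cnj (V G)\<close> are proportional, whence \<open>U = c V\<close> with
  \<open>\<bar>c\<bar>\<^sup>2 = \<bar>det E\<bar>\<close>.

  The convolution in the localization operator tests \<open>a\<close> against the correlation of two functions
  \<open>c V \<psi>\<close> and \<open>c V \<Phi>\<close>. By Parseval's identity in the second variable this correlation is \<open>F\<^sub>2\<close> of the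
  correlation of \<open>\<psi> \<circ> E\<close> and \<open>\<Phi> \<circ> E\<close> in the first variable, which is what the weak integral tests
  \<open>F\<^sub>2\<^sup>-\<^sup>1 a\<close> against. The resulting functional is tempered because \<open>F\<^sub>2\<close> and correlations are continuous
  on the Schwartz space, and a kernel is unique because every Schwartz function is a limit of finite
  combinations of translated Gaussians, which are tensor products.\<close>

section \<open>Schwartz functions\<close>

text \<open>The relation between \<open>U\<close> and \<open>rho\<close> determines \<open>U\<close>
  only up to a scalar and only almost everywhere, and nothing in it says that \<open>U\<close> maps
  Schwartz functions to Schwartz functions. Schur's lemma would give the scalar from the
  irreducibility of \<open>rho\<close>; comparing matrix coefficients is a direct substitute, and it
  also delivers the Schwartz representative that \<open>wigner\<close> has to select. The scalar is
  not unimodular in general because \<open>V\<close> lacks the normalizing factor, the square root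
  of \<open>\<bar>det E\<bar>\<close>. It enters the localization operator twice, once conjugated,
  so that only its squared modulus survives, and this is exactly the Jacobian that
  \<open>dist_comp\<close> contributes on the side of the formula.\<close>

lemma dir_deriv_eq:
  assumes "\<And>x. (f has_derivative F x) (at x)"
  shows "dir_deriv v f = (\<lambda>x. F x v)"
  unfolding dir_deriv_def using frechet_derivative_at[OF assms] by (metis)

lemma foldr_dir_deriv_snoc:
  "foldr dir_deriv vs (dir_deriv b f) = foldr dir_deriv (vs @ [b]) f"
  by simp

text \<open>Iterated derivatives never leave a class closed under \<open>dir_deriv\<close>, so
  differentiability and decay are checked once for the members of \<open>X\<close>, with no
  induction over lists of basis vectors in the applications.\<close>

lemma schwartz_coinduct:
  assumes "f \<in> X"
    and diff: "\<And>g x. g \<in> X \<Longrightarrow> g differentiable (at x)"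
    and bound: "\<And>g N. g \<in> X \<Longrightarrow> \<exists>C. \<forall>x. (1 + norm x) ^ N * norm (g x) \<le> C"
    and deriv: "\<And>g b. g \<in> X \<Longrightarrow> b \<in> Basis \<Longrightarrow> dir_deriv b g \<in> X"
  shows "f \<in> schwartz"
proof -
  have X: "foldr dir_deriv vs f \<in> X" if "set vs \<subseteq> Basis" for vs
    using that by (induction vs) (use \<open>f \<in> X\<close> deriv in auto)
  show ?thesis
    unfolding schwartz_def
  proof (intro CollectI allI impI conjI)
    fix vs :: "'a list" and N :: nat and x :: 'a
    assume vs: "set vs \<subseteq> Basis"
    show "foldr dir_deriv vs f differentiable at x"
      using X[OF vs] diff by blast
    obtain C where "(1 + norm x) ^ N * norm (foldr dir_deriv vs f x) \<le> C" for x
      using bound[OF X[OF vs], of N] by blast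
    then show "bounded (range (\<lambda>x. (1 + norm x) ^ N * norm (foldr dir_deriv vs f x)))"
      by (intro boundedI[of _ C]) (auto simp: abs_mult)
  qed
qed

lemma schwartz_differentiable: "f \<in> schwartz \<Longrightarrow> f differentiable (at x)"
  unfolding schwartz_def by (force dest: spec[of _ "[]"])

lemma schwartz_bounded:
  assumes "f \<in> schwartz" "set vs \<subseteq> Basis"
  obtains C where "\<And>x. (1 + norm x) ^ N * norm (foldr dir_deriv vs f x) \<le> C"
proof -
  have "bounded (range (\<lambda>x. (1 + norm x) ^ N * norm (foldr dir_deriv vs f x)))"
    using assms unfolding schwartz_def by blast
  then obtain C where "\<And>x. norm ((1 + norm x) ^ N * norm (foldr dir_deriv vs f x)) \<le> C"
    unfolding bounded_iff by blast
  then show thesis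
    by (intro that[of C]) (smt (verit) real_norm_def)
qed

lemma schwartz_dir_deriv: "f \<in> schwartz \<Longrightarrow> b \<in> Basis \<Longrightarrow> dir_deriv b f \<in> schwartz"
  unfolding schwartz_def by (auto simp: foldr_dir_deriv_snoc simp del: foldr_append)

lemma schwartz_foldr_dir_deriv:
  "f \<in> schwartz \<Longrightarrow> set vs \<subseteq> Basis \<Longrightarrow> foldr dir_deriv vs f \<in> schwartz"
  by (induction vs) (auto intro: schwartz_dir_deriv)

text \<open>Bounds on total derivatives are later obtained through this expansion, since the partial
  derivatives are Schwartz functions with seminorm bounds of their own.\<close>

lemma schwartz_has_derivative:
  assumes "f \<in> schwartz"
  shows "(f has_derivative (\<lambda>v. \<Sum>b\<in>Basis. (v \<bullet> b) *\<^sub>R dir_deriv b f x)) (at x)"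
proof -
  have D: "(f has_derivative frechet_derivative f (at x)) (at x)"
    using schwartz_differentiable[OF assms] frechet_derivative_works by blast
  then have lin: "linear (frechet_derivative f (at x))"
    by (rule has_derivative_linear)
  have "frechet_derivative f (at x) v = (\<Sum>b\<in>Basis. (v \<bullet> b) *\<^sub>R dir_deriv b f x)" for v
    by (subst (1) euclidean_representation[symmetric])
      (simp add: linear_sum[OF lin] linear_scale[OF lin] dir_deriv_def)
  then have "frechet_derivative f (at x) = (\<lambda>v. \<Sum>b\<in>Basis. (v \<bullet> b) *\<^sub>R dir_deriv b f x)"
    by (rule ext)
  with D show ?thesis by simp
qed

lemma schwartz_continuous_on: "f \<in> schwartz \<Longrightarrow> continuous_on A f"
  by (meson continuous_at_imp_continuous_on differentiable_imp_continuous_within schwartz_differentiable)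

lemma schwartz_measurable: "f \<in> schwartz \<Longrightarrow> f \<in> borel_measurable borel"
  by (intro borel_measurable_continuous_onI schwartz_continuous_on)

lemma dir_deriv_add:
  "f \<in> schwartz \<Longrightarrow> g \<in> schwartz \<Longrightarrow>
    dir_deriv b (\<lambda>x. f x + g x) = (\<lambda>x. dir_deriv b f x + dir_deriv b g x)"
  by (subst dir_deriv_eq[OF has_derivative_add[OF frechet_derivative_works[THEN iffD1] frechet_derivative_works[THEN iffD1]]])
    (auto simp: schwartz_differentiable dir_deriv_def)

lemma dir_deriv_cmult:
  "f \<in> schwartz \<Longrightarrow> dir_deriv b (\<lambda>x. c * f x) = (\<lambda>x. c * dir_deriv b f x)"
  by (subst dir_deriv_eq[OF has_derivative_mult_right[OF frechet_derivative_works[THEN iffD1]]])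
    (auto simp: schwartz_differentiable dir_deriv_def)

lemma schwartz_bound:
  assumes "f \<in> schwartz"
  obtains C where "0 \<le> C" "\<And>x. (1 + norm x) ^ N * norm (f x) \<le> C"
  using schwartz_bounded[OF assms, of "[]" N]
  by (metis (no_types, lifting) empty_subsetI foldr.simps(1) id_apply list.set(1) mult_nonneg_nonneg
      norm_ge_zero order_trans zero_le_power add_nonneg_nonneg zero_le_one)

lemma schwartz_cmult:
  assumes "f \<in> schwartz" shows "(\<lambda>x. c * f x) \<in> schwartz"
proof (rule schwartz_coinduct[where X = "(\<lambda>f x. c * f x) ` schwartz"])
  fix g :: "'a \<Rightarrow> complex" and N assume "g \<in> (\<lambda>f x. c * f x) ` schwartz"
  then obtain f where f: "f \<in> schwartz" "g = (\<lambda>x. c * f x)" by blast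
  then obtain C where C: "\<And>x. (1 + norm x) ^ N * norm (f x) \<le> C"
    using schwartz_bound by blast
  have "(1 + norm x) ^ N * norm (g x) \<le> norm c * C" for x
    using mult_left_mono[OF C[of x], of "norm c"] by (simp add: f norm_mult mult_ac)
  then show "\<exists>C. \<forall>x. (1 + norm x) ^ N * norm (g x) \<le> C" by blast
qed (use assms in \<open>auto simp: schwartz_differentiable dir_deriv_cmult schwartz_dir_deriv
        intro!: differentiable_cmult_left_iff[THEN iffD2]\<close>)

lemma weighted_norm_add_le:
  "(1 + norm x) ^ N * norm (a + b) \<le> (1 + norm x) ^ N * norm a + (1 + norm x) ^ N * norm b"
  unfolding distrib_left[symmetric] by (intro mult_left_mono norm_triangle_ineq) auto

lemma schwartz_add:
  assumes "f \<in> schwartz" "g \<in> schwartz" shows "(\<lambda>x. f x + g x) \<in> schwartz"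
proof (rule schwartz_coinduct[where X = "{\<lambda>x. f x + g x |f g. f \<in> schwartz \<and> g \<in> schwartz}"])
  fix h :: "'a \<Rightarrow> complex" and N assume "h \<in> {\<lambda>x. f x + g x |f g. f \<in> schwartz \<and> g \<in> schwartz}"
  then obtain f g where h: "f \<in> schwartz" "g \<in> schwartz" "h = (\<lambda>x. f x + g x)" by blast
  obtain C D where C: "\<And>x. (1 + norm x) ^ N * norm (f x) \<le> C"
      and D: "\<And>x. (1 + norm x) ^ N * norm (g x) \<le> D"
    using schwartz_bound h by metis
  have "(1 + norm x) ^ N * norm (h x) \<le> C + D" for x
    unfolding h by (rule order_trans[OF weighted_norm_add_le add_mono[OF C D]])
  then show "\<exists>C. \<forall>x. (1 + norm x) ^ N * norm (h x) \<le> C" by blast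
next
  fix h :: "'a \<Rightarrow> complex" and b :: 'a
  assume "h \<in> {\<lambda>x. f x + g x |f g. f \<in> schwartz \<and> g \<in> schwartz}" "b \<in> Basis"
  then show "dir_deriv b h \<in> {\<lambda>x. f x + g x |f g. f \<in> schwartz \<and> g \<in> schwartz}"
    by (auto simp: dir_deriv_add) (metis schwartz_dir_deriv)
qed (use assms in \<open>auto simp: schwartz_differentiable\<close>)

lemma schwartz_zero [simp]: "(\<lambda>x. 0) \<in> schwartz"
  by (rule schwartz_coinduct[where X = "{\<lambda>x. 0}"]) (auto simp: dir_deriv_def frechet_derivative_const)

lemma schwartz_sum:
  "(\<And>i. i \<in> I \<Longrightarrow> f i \<in> schwartz) \<Longrightarrow> (\<lambda>x. \<Sum>i\<in>I. f i x) \<in> schwartz"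
  by (induction I rule: infinite_finite_induct) (auto intro: schwartz_add)

lemma foldr_dir_deriv_add:
  assumes "f \<in> schwartz" "g \<in> schwartz" "set vs \<subseteq> Basis"
  shows "foldr dir_deriv vs (\<lambda>x. f x + g x) = (\<lambda>x. foldr dir_deriv vs f x + foldr dir_deriv vs g x)"
  using assms by (induction vs) (auto simp: dir_deriv_add schwartz_foldr_dir_deriv)

lemma foldr_dir_deriv_cmult:
  assumes "f \<in> schwartz" "set vs \<subseteq> Basis"
  shows "foldr dir_deriv vs (\<lambda>x. c * f x) = (\<lambda>x. c * foldr dir_deriv vs f x)"
  using assms by (induction vs) (auto simp: dir_deriv_cmult schwartz_foldr_dir_deriv)

lemma foldr_dir_deriv_sum:
  fixes f :: "'i \<Rightarrow> 'a::euclidean_space \<Rightarrow> complex"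
  assumes "\<And>i. i \<in> I \<Longrightarrow> f i \<in> schwartz" "set vs \<subseteq> Basis"
  shows "foldr dir_deriv vs (\<lambda>x. \<Sum>i\<in>I. f i x) = (\<lambda>x. \<Sum>i\<in>I. foldr dir_deriv vs (f i) x)"
proof -
  have "foldr dir_deriv vs (\<lambda>x::'a. 0) = (\<lambda>x. 0)"
    using foldr_dir_deriv_cmult[of "\<lambda>x. 0" vs 0] assms(2) by simp
  with assms(1) show ?thesis
    by (induction I rule: infinite_finite_induct)
      (auto simp: foldr_dir_deriv_add schwartz_sum assms(2))
qed

text \<open>On the reals \<open>SUP\<close> is informative only for sets bounded above. Only
  finitely many lists have length at most \<open>N\<close>, so their individual bounds can be
  summed; cutting them off at 0 lets each one be estimated by the sum.\<close>

lemma bdd_above_schwartz_norm: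
  assumes "f \<in> schwartz"
  shows "bdd_above ((\<lambda>(vs, x). (1 + norm x) ^ N * norm (foldr dir_deriv vs f x)) `
           ({vs. set vs \<subseteq> Basis \<and> length vs \<le> N} \<times> UNIV))"
proof -
  have "\<exists>C. \<forall>x. (1 + norm x) ^ N * norm (foldr dir_deriv vs f x) \<le> C" if "set vs \<subseteq> Basis" for vs
    using schwartz_bounded[OF assms that] by blast
  then obtain C where C: "\<And>vs x. set vs \<subseteq> Basis \<Longrightarrow>
      (1 + norm x) ^ N * norm (foldr dir_deriv vs f x) \<le> C vs"
    by metis
  let ?F = "{vs::'a list. set vs \<subseteq> Basis \<and> length vs \<le> N}"
  have F: "finite ?F"
    by (rule finite_lists_length_le) simp
  have "(1 + norm x) ^ N * norm (foldr dir_deriv vs f x) \<le> (\<Sum>vs\<in>?F. max 0 (C vs))"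
    if "vs \<in> ?F" for vs x
  proof -
    have "(1 + norm x) ^ N * norm (foldr dir_deriv vs f x) \<le> max 0 (C vs)"
      using C[of vs x] that by simp
    also have "\<dots> \<le> (\<Sum>vs\<in>?F. max 0 (C vs))"
      using F that by (intro member_le_sum) auto
    finally show ?thesis .
  qed
  then show ?thesis
    by (intro bdd_aboveI2[where M = "\<Sum>vs\<in>?F. max 0 (C vs)"]) auto
qed

lemma schwartz_norm_upper:
  assumes "f \<in> schwartz" "set vs \<subseteq> Basis" "length vs \<le> N"
  shows "(1 + norm x) ^ N * norm (foldr dir_deriv vs f x) \<le> schwartz_norm N f"
  unfolding schwartz_norm_def
  using cSUP_upper[OF _ bdd_above_schwartz_norm[OF assms(1), of N], of "(vs, x)"] assms(2,3) by auto

lemma schwartz_norm_least: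
  assumes "\<And>vs x. set vs \<subseteq> Basis \<Longrightarrow> length vs \<le> N \<Longrightarrow>
      (1 + norm x) ^ N * norm (foldr dir_deriv vs f x) \<le> K"
  shows "schwartz_norm N f \<le> K"
  unfolding schwartz_norm_def
proof (rule cSUP_least)
  have "([], 0) \<in> {vs::'a list. set vs \<subseteq> Basis \<and> length vs \<le> N} \<times> (UNIV::'a set)"
    by simp
  then show "{vs::'a list. set vs \<subseteq> Basis \<and> length vs \<le> N} \<times> (UNIV::'a set) \<noteq> {}"
    by blast
qed (use assms in auto)

lemma schwartz_norm_bound:
  assumes "f \<in> schwartz"
  shows "(1 + norm x) ^ N * norm (f x) \<le> schwartz_norm N f"
  using schwartz_norm_upper[OF assms, of "[]" N x] by simp

lemma schwartz_norm_nonneg: "f \<in> schwartz \<Longrightarrow> 0 \<le> schwartz_norm N f"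
  by (rule order_trans[OF _ schwartz_norm_bound[of f 0]]) auto

lemma schwartz_norm_mono:
  assumes "f \<in> schwartz" "N \<le> M"
  shows "schwartz_norm N f \<le> schwartz_norm M f"
proof (rule schwartz_norm_least)
  fix vs :: "'a list" and x :: 'a
  assume vs: "set vs \<subseteq> Basis" "length vs \<le> N"
  have "(1 + norm x) ^ N * norm (foldr dir_deriv vs f x) \<le> (1 + norm x) ^ M * norm (foldr dir_deriv vs f x)"
    using \<open>N \<le> M\<close> by (intro mult_right_mono power_increasing) auto
  also have "\<dots> \<le> schwartz_norm M f"
    using assms vs by (intro schwartz_norm_upper) auto
  finally show "(1 + norm x) ^ N * norm (foldr dir_deriv vs f x) \<le> schwartz_norm M f" .
qed

lemma schwartz_norm_add:
  assumes "f \<in> schwartz" "g \<in> schwartz"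
  shows "schwartz_norm N (\<lambda>x. f x + g x) \<le> schwartz_norm N f + schwartz_norm N g"
proof (rule schwartz_norm_least)
  fix vs :: "'a list" and x :: 'a
  assume vs: "set vs \<subseteq> Basis" "length vs \<le> N"
  show "(1 + norm x) ^ N * norm (foldr dir_deriv vs (\<lambda>x. f x + g x) x) \<le> schwartz_norm N f + schwartz_norm N g"
    unfolding foldr_dir_deriv_add[OF assms vs(1)]
    by (rule order_trans[OF weighted_norm_add_le add_mono[OF schwartz_norm_upper[OF assms(1) vs] schwartz_norm_upper[OF assms(2) vs]]])
qed

lemma schwartz_norm_cmult:
  assumes "f \<in> schwartz"
  shows "schwartz_norm N (\<lambda>x. c * f x) \<le> norm c * schwartz_norm N f"
proof (rule schwartz_norm_least)
  fix vs :: "'a list" and x :: 'a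
  assume vs: "set vs \<subseteq> Basis" "length vs \<le> N"
  show "(1 + norm x) ^ N * norm (foldr dir_deriv vs (\<lambda>x. c * f x) x) \<le> norm c * schwartz_norm N f"
    using mult_left_mono[OF schwartz_norm_upper[OF assms vs, of x], of "norm c"]
    unfolding foldr_dir_deriv_cmult[OF assms vs(1)] by (simp add: norm_mult mult_ac)
qed

section \<open>Operators bounded by Schwartz seminorms\<close>

text \<open>For linear operators this is continuity in the Frechet topology: the seminorms increase
  with their index, so a single one on the right replaces a finite maximum. Linearity is asked for
  separately, in \<open>tempered_compose\<close>.\<close>

definition schwartz_continuous ::
  "(('a::euclidean_space \<Rightarrow> complex) \<Rightarrow> 'b::euclidean_space \<Rightarrow> complex) \<Rightarrow> bool" where
  "schwartz_continuous T \<longleftrightarrow> (\<forall>f\<in>schwartz. T f \<in> schwartz) \<and>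
     (\<forall>N. \<exists>M C. \<forall>f\<in>schwartz. schwartz_norm N (T f) \<le> C * schwartz_norm M f)"

lemma schwartz_continuousD: "schwartz_continuous T \<Longrightarrow> f \<in> schwartz \<Longrightarrow> T f \<in> schwartz"
  by (simp add: schwartz_continuous_def)

lemma schwartz_continuous_norm:
  assumes "schwartz_continuous T"
  obtains M C where "0 \<le> C" "\<And>f. f \<in> schwartz \<Longrightarrow> schwartz_norm N (T f) \<le> C * schwartz_norm M f"
proof -
  obtain M C where MC: "\<And>f. f \<in> schwartz \<Longrightarrow> schwartz_norm N (T f) \<le> C * schwartz_norm M f"
    using assms unfolding schwartz_continuous_def by metis
  show thesis
  proof (rule that[of "\<bar>C\<bar>" M])
    fix f :: "'a \<Rightarrow> complex" assume f: "f \<in> schwartz"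
    have "C * schwartz_norm M f \<le> \<bar>C\<bar> * schwartz_norm M f"
      using schwartz_norm_nonneg[OF f] by (intro mult_right_mono) auto
    with MC[OF f] show "schwartz_norm N (T f) \<le> \<bar>C\<bar> * schwartz_norm M f" by simp
  qed simp
qed

lemma schwartz_continuous_compose:
  assumes "schwartz_continuous S" "schwartz_continuous T"
  shows "schwartz_continuous (\<lambda>f. S (T f))"
  unfolding schwartz_continuous_def
proof (intro conjI allI ballI)
  fix N
  obtain M C where MC: "0 \<le> C" "\<And>f. f \<in> schwartz \<Longrightarrow> schwartz_norm N (S f) \<le> C * schwartz_norm M f"
    using schwartz_continuous_norm[OF assms(1)] by metis
  obtain K D where KD: "\<And>f. f \<in> schwartz \<Longrightarrow> schwartz_norm M (T f) \<le> D * schwartz_norm K f"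
    using schwartz_continuous_norm[OF assms(2)] by metis
  have "schwartz_norm N (S (T f)) \<le> (C * D) * schwartz_norm K f" if "f \<in> schwartz" for f
    using MC(2)[OF schwartz_continuousD[OF assms(2) that]] mult_left_mono[OF KD[OF that] MC(1)]
    by (simp add: mult_ac)
  then show "\<exists>M C. \<forall>f\<in>schwartz. schwartz_norm N (S (T f)) \<le> C * schwartz_norm M f"
    by blast
qed (use assms in \<open>auto dest: schwartz_continuousD\<close>)

lemma schwartz_continuous_add:
  assumes "schwartz_continuous S" "schwartz_continuous T"
  shows "schwartz_continuous (\<lambda>f x. S f x + T f x)"
  unfolding schwartz_continuous_def
proof (intro conjI allI ballI)
  fix N
  obtain M C where MC: "0 \<le> C" "\<And>f. f \<in> schwartz \<Longrightarrow> schwartz_norm N (S f) \<le> C * schwartz_norm M f"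
    using schwartz_continuous_norm[OF assms(1)] by metis
  obtain K D where KD: "0 \<le> D" "\<And>f. f \<in> schwartz \<Longrightarrow> schwartz_norm N (T f) \<le> D * schwartz_norm K f"
    using schwartz_continuous_norm[OF assms(2)] by metis
  have "schwartz_norm N (\<lambda>x. S f x + T f x) \<le> (C + D) * schwartz_norm (max M K) f"
    if f: "f \<in> schwartz" for f
  proof -
    have "schwartz_norm N (\<lambda>x. S f x + T f x) \<le> schwartz_norm N (S f) + schwartz_norm N (T f)"
      using f by (intro schwartz_norm_add schwartz_continuousD[OF assms(1)] schwartz_continuousD[OF assms(2)])
    also have "\<dots> \<le> C * schwartz_norm M f + D * schwartz_norm K f"
      using MC(2)[OF f] KD(2)[OF f] by linarith
    also have "\<dots> \<le> C * schwartz_norm (max M K) f + D * schwartz_norm (max M K) f"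
      by (intro add_mono mult_left_mono schwartz_norm_mono f MC(1) KD(1)) auto
    finally show ?thesis by (simp add: algebra_simps)
  qed
  then show "\<exists>M C. \<forall>f\<in>schwartz. schwartz_norm N (\<lambda>x. S f x + T f x) \<le> C * schwartz_norm M f"
    by blast
qed (simp add: schwartz_add schwartz_continuousD[OF assms(1)] schwartz_continuousD[OF assms(2)])

lemma schwartz_continuous_cmult:
  assumes "schwartz_continuous T"
  shows "schwartz_continuous (\<lambda>f x. c * T f x)"
  unfolding schwartz_continuous_def
proof (intro conjI allI ballI)
  fix N
  obtain M C where MC: "0 \<le> C" "\<And>f. f \<in> schwartz \<Longrightarrow> schwartz_norm N (T f) \<le> C * schwartz_norm M f"
    using schwartz_continuous_norm[OF assms] by metis
  have "schwartz_norm N (\<lambda>x. c * T f x) \<le> (norm c * C) * schwartz_norm M f" if "f \<in> schwartz" for f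
    using schwartz_norm_cmult[OF schwartz_continuousD[OF assms that], of N c]
      mult_left_mono[OF MC(2)[OF that], of "norm c"]
    by (simp add: mult_ac)
  then show "\<exists>M C. \<forall>f\<in>schwartz. schwartz_norm N (\<lambda>x. c * T f x) \<le> C * schwartz_norm M f"
    by blast
qed (simp add: schwartz_cmult schwartz_continuousD[OF assms])

lemma schwartz_continuous_id: "schwartz_continuous (\<lambda>f. f)"
  unfolding schwartz_continuous_def by (metis mult_1 order_refl)

lemma schwartz_continuous_zero: "schwartz_continuous (\<lambda>f x. 0)"
proof -
  have "schwartz_norm N (\<lambda>x::'b. 0) \<le> 0 * schwartz_norm 0 f" for N and f :: "'a \<Rightarrow> complex"
    using schwartz_norm_cmult[OF schwartz_zero, of N 0] by simp
  then show ?thesis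
    unfolding schwartz_continuous_def by (auto intro!: exI[of _ "0::nat"] exI[of _ "0::real"])
qed

lemma schwartz_continuous_sum:
  "(\<And>i. i \<in> I \<Longrightarrow> schwartz_continuous (T i)) \<Longrightarrow> schwartz_continuous (\<lambda>f x. \<Sum>i\<in>I. T i f x)"
  by (induction I rule: infinite_finite_induct)
    (auto intro: schwartz_continuous_zero schwartz_continuous_add)

lemma schwartz_continuous_dir_deriv:
  assumes "b \<in> Basis"
  shows "schwartz_continuous (dir_deriv b)"
  unfolding schwartz_continuous_def
proof (intro conjI allI ballI)
  fix N
  have "schwartz_norm N (dir_deriv b f) \<le> 1 * schwartz_norm (Suc N) f" if f: "f \<in> schwartz" for f
  proof (rule schwartz_norm_least)
    fix vs :: "'a list" and x :: 'a
    assume vs: "set vs \<subseteq> Basis" "length vs \<le> N"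
    have "(1 + norm x) ^ N * norm (foldr dir_deriv vs (dir_deriv b f) x)
        \<le> (1 + norm x) ^ Suc N * norm (foldr dir_deriv vs (dir_deriv b f) x)"
      by (intro mult_right_mono power_increasing) auto
    also have "\<dots> \<le> schwartz_norm (Suc N) f"
      using vs assms unfolding foldr_dir_deriv_snoc by (intro schwartz_norm_upper f) auto
    finally show "(1 + norm x) ^ N * norm (foldr dir_deriv vs (dir_deriv b f) x)
        \<le> 1 * schwartz_norm (Suc N) f" by simp
  qed
  then show "\<exists>M C. \<forall>f\<in>schwartz. schwartz_norm N (dir_deriv b f) \<le> C * schwartz_norm M f"
    by blast
qed (use assms in \<open>auto intro: schwartz_dir_deriv\<close>)

text \<open>Estimates with different indices are merged by passing to the larger index. The
  constants may be negative, hence the absolute values.\<close>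

lemma sum_schwartz_norm_bound:
  assumes "finite I"
    and "\<And>i. i \<in> I \<Longrightarrow> \<exists>M C. \<forall>f\<in>schwartz. \<forall>x. q i f x \<le> C * schwartz_norm M f"
  shows "\<exists>M C. \<forall>f\<in>schwartz. \<forall>x. (\<Sum>i\<in>I. q i f x) \<le> C * schwartz_norm M f"
  using assms
proof (induction I)
  case empty
  then show ?case by (intro exI[of _ 0]) auto
next
  case (insert i I)
  obtain M C where MC: "\<And>f x. f \<in> schwartz \<Longrightarrow> (\<Sum>i\<in>I. q i f x) \<le> C * schwartz_norm M f"
    using insert by (metis insertCI)
  obtain K D where KD: "\<And>f x. f \<in> schwartz \<Longrightarrow> q i f x \<le> D * schwartz_norm K f"
    using insert.prems[of i] by blast
  have "(\<Sum>i\<in>insert i I. q i f x) \<le> (\<bar>C\<bar> + \<bar>D\<bar>) * schwartz_norm (max M K) f" if f: "f \<in> schwartz" for f x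
  proof -
    have "C * schwartz_norm M f \<le> \<bar>C\<bar> * schwartz_norm (max M K) f"
      by (intro mult_mono schwartz_norm_mono schwartz_norm_nonneg f) auto
    moreover have "D * schwartz_norm K f \<le> \<bar>D\<bar> * schwartz_norm (max M K) f"
      by (intro mult_mono schwartz_norm_mono schwartz_norm_nonneg f) auto
    ultimately show ?thesis
      using MC[OF f, of x] KD[OF f, of x] insert.hyps by (simp add: algebra_simps)
  qed
  then show ?case by blast
qed

text \<open>The summand \<open>R\<close> is needed for multiplication by a coordinate, which does not commute with
  differentiation.\<close>

lemma schwartz_continuousI:
  fixes P :: "('a::euclidean_space \<Rightarrow> complex) \<Rightarrow> 'b::euclidean_space \<Rightarrow> complex"
  assumes diff: "\<And>f x. f \<in> schwartz \<Longrightarrow> P f differentiable (at x)"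
    and deriv: "\<And>b. b \<in> Basis \<Longrightarrow> \<exists>D R. schwartz_continuous D \<and> schwartz_continuous R \<and>
                  (\<forall>f\<in>schwartz. dir_deriv b (P f) = (\<lambda>x. P (D f) x + R f x))"
    and bound: "\<And>N. \<exists>M C. \<forall>f\<in>schwartz. \<forall>x. (1 + norm x) ^ N * norm (P f x) \<le> C * schwartz_norm M f"
  shows "schwartz_continuous P"
proof -
  have dd: "dir_deriv b (\<lambda>x. P f x + g x) = (\<lambda>x. dir_deriv b (P f) x + dir_deriv b g x)"
    if "f \<in> schwartz" "g \<in> schwartz" for f g b
    using that by (subst dir_deriv_eq[OF has_derivative_add[OF frechet_derivative_works[THEN iffD1] frechet_derivative_works[THEN iffD1]]])
      (auto simp: schwartz_differentiable diff dir_deriv_def)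
  \<comment> \<open>The functions \<open>P f\<close> alone need not be closed under differentiation
    because of \<open>R\<close>; an arbitrary Schwartz summand \<open>g\<close> absorbs that
    term.\<close>
  define X where "X = {\<lambda>x. P f x + g x |f g. f \<in> schwartz \<and> g \<in> schwartz}"
  have in_X: "h \<in> schwartz" if "h \<in> X" for h
  proof (rule schwartz_coinduct[of _ X])
    fix h N assume "h \<in> X"
    then obtain f g where h: "f \<in> schwartz" "g \<in> schwartz" "h = (\<lambda>x. P f x + g x)"
      unfolding X_def by blast
    obtain C where C: "\<And>x. (1 + norm x) ^ N * norm (P f x) \<le> C"
      using bound[of N] h(1) by blast
    obtain D where D: "\<And>x. (1 + norm x) ^ N * norm (g x) \<le> D"
      using schwartz_bound h by metis
    have "(1 + norm x) ^ N * norm (h x) \<le> C + D" for x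
      unfolding h by (rule order_trans[OF weighted_norm_add_le add_mono[OF C D]])
    then show "\<exists>C. \<forall>x. (1 + norm x) ^ N * norm (h x) \<le> C" by blast
  next
    fix h and b :: 'b assume "h \<in> X" and b: "b \<in> Basis"
    then obtain f g where h: "f \<in> schwartz" "g \<in> schwartz" "h = (\<lambda>x. P f x + g x)"
      unfolding X_def by blast
    obtain D R where DR: "schwartz_continuous D" "schwartz_continuous R"
        "\<And>f. f \<in> schwartz \<Longrightarrow> dir_deriv b (P f) = (\<lambda>x. P (D f) x + R f x)"
      using deriv[OF b] by blast
    have "dir_deriv b h = (\<lambda>x. P (D f) x + (R f x + dir_deriv b g x))"
      by (simp add: h(3) dd[OF h(1,2)] DR(3)[OF h(1)] add.assoc)
    moreover have "D f \<in> schwartz" "(\<lambda>x. R f x + dir_deriv b g x) \<in> schwartz"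
      using h b by (auto intro: schwartz_add schwartz_dir_deriv schwartz_continuousD[OF DR(1)]
          schwartz_continuousD[OF DR(2)])
    ultimately show "dir_deriv b h \<in> X"
      unfolding X_def mem_Collect_eq by (intro exI conjI)
  qed (use that in \<open>auto simp: X_def schwartz_differentiable diff\<close>)
  have P: "P f \<in> schwartz" if "f \<in> schwartz" for f
    using in_X[of "\<lambda>x. P f x + 0"] that unfolding X_def by force
  \<comment> \<open>The form \<open>P (D f) + R f\<close> is stable under a further derivative: the
    operators \<open>D\<close> compose, and every other term is collected in
    \<open>R\<close>.\<close>
  have vs: "\<exists>D R. schwartz_continuous D \<and> schwartz_continuous R \<and>
      (\<forall>f\<in>schwartz. foldr dir_deriv vs (P f) = (\<lambda>x. P (D f) x + R f x))" if "set vs \<subseteq> Basis" for vs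
    using that
  proof (induction vs)
    case Nil
    show ?case
      by (intro exI[of _ "\<lambda>f. f"] exI[of _ "\<lambda>f x. 0"])
        (auto intro: schwartz_continuous_id schwartz_continuous_zero)
  next
    case (Cons b vs)
    obtain D R where DR: "schwartz_continuous D" "schwartz_continuous R"
        "\<And>f. f \<in> schwartz \<Longrightarrow> foldr dir_deriv vs (P f) = (\<lambda>x. P (D f) x + R f x)"
      using Cons by auto
    obtain D' R' where DR': "schwartz_continuous D'" "schwartz_continuous R'"
        "\<And>f. f \<in> schwartz \<Longrightarrow> dir_deriv b (P f) = (\<lambda>x. P (D' f) x + R' f x)"
      using deriv[of b] Cons.prems by auto
    have "foldr dir_deriv (b # vs) (P f) = (\<lambda>x. P (D' (D f)) x + (R' (D f) x + dir_deriv b (R f) x))"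
      if "f \<in> schwartz" for f
      using that by (simp add: DR(3) DR'(3) dd add.assoc schwartz_continuousD[OF DR(1)] schwartz_continuousD[OF DR(2)])
    moreover have "schwartz_continuous (\<lambda>f. D' (D f))"
      by (rule schwartz_continuous_compose[OF DR'(1) DR(1)])
    moreover have "schwartz_continuous (\<lambda>f x. R' (D f) x + dir_deriv b (R f) x)"
      using Cons.prems
      by (intro schwartz_continuous_add schwartz_continuous_compose[OF DR'(2) DR(1)]
          schwartz_continuous_compose[OF _ DR(2)] schwartz_continuous_dir_deriv) auto
    ultimately show ?case by blast
  qed
  show ?thesis
    unfolding schwartz_continuous_def
  proof (intro conjI allI ballI P)
    fix N
    define F where "F = {vs::'b list. set vs \<subseteq> Basis \<and> length vs \<le> N}"
    have F: "finite F"
      unfolding F_def by (rule finite_lists_length_le) simp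
    have "\<exists>M C. \<forall>f\<in>schwartz. \<forall>x. (1 + norm x) ^ N * norm (foldr dir_deriv vs (P f) x) \<le> C * schwartz_norm M f"
      if "vs \<in> F" for vs
    proof -
      obtain D R where DR: "schwartz_continuous D" "schwartz_continuous R"
          "\<And>f. f \<in> schwartz \<Longrightarrow> foldr dir_deriv vs (P f) = (\<lambda>x. P (D f) x + R f x)"
        using vs[of vs] \<open>vs \<in> F\<close> by (auto simp: F_def)
      obtain M C where MC: "\<And>f x. f \<in> schwartz \<Longrightarrow> (1 + norm x) ^ N * norm (P f x) \<le> C * schwartz_norm M f"
        using bound[of N] by blast
      obtain M1 C1 where MC1: "0 \<le> C1" "\<And>f. f \<in> schwartz \<Longrightarrow> schwartz_norm M (D f) \<le> C1 * schwartz_norm M1 f"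
        using schwartz_continuous_norm[OF DR(1)] by metis
      obtain M2 C2 where MC2: "0 \<le> C2" "\<And>f. f \<in> schwartz \<Longrightarrow> schwartz_norm N (R f) \<le> C2 * schwartz_norm M2 f"
        using schwartz_continuous_norm[OF DR(2)] by metis
      have "(1 + norm x) ^ N * norm (foldr dir_deriv vs (P f) x)
          \<le> (\<bar>C\<bar> * C1 + C2) * schwartz_norm (max M1 M2) f" if f: "f \<in> schwartz" for f x
      proof -
        have Df: "D f \<in> schwartz" and Rf: "R f \<in> schwartz"
          using f by (auto intro: schwartz_continuousD[OF DR(1)] schwartz_continuousD[OF DR(2)])
        have "(1 + norm x) ^ N * norm (foldr dir_deriv vs (P f) x) \<le> C * schwartz_norm M (D f) + schwartz_norm N (R f)"
          unfolding DR(3)[OF f]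
          by (rule order_trans[OF weighted_norm_add_le add_mono[OF MC[OF Df] schwartz_norm_bound[OF Rf]]])
        also have "\<dots> \<le> \<bar>C\<bar> * schwartz_norm M (D f) + schwartz_norm N (R f)"
          using schwartz_norm_nonneg[OF Df, of M] by (intro add_mono mult_right_mono) auto
        also have "\<dots> \<le> \<bar>C\<bar> * (C1 * schwartz_norm M1 f) + C2 * schwartz_norm M2 f"
          using mult_left_mono[OF MC1(2)[OF f], of "\<bar>C\<bar>"] MC2(2)[OF f] by linarith
        also have "\<dots> \<le> \<bar>C\<bar> * (C1 * schwartz_norm (max M1 M2) f) + C2 * schwartz_norm (max M1 M2) f"
          by (intro add_mono mult_left_mono schwartz_norm_mono f MC1(1) MC2(1)) auto
        finally show ?thesis by (simp add: algebra_simps)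
      qed
      then show ?thesis by blast
    qed
    then have "\<exists>M C. \<forall>f\<in>schwartz. \<forall>x. (\<Sum>vs\<in>F. (1 + norm x) ^ N * norm (foldr dir_deriv vs (P f) x)) \<le> C * schwartz_norm M f"
      by (intro sum_schwartz_norm_bound F)
    then obtain M C where MC: "\<And>f x. f \<in> schwartz \<Longrightarrow>
        (\<Sum>vs\<in>F. (1 + norm x) ^ N * norm (foldr dir_deriv vs (P f) x)) \<le> C * schwartz_norm M f"
      by blast
    have "schwartz_norm N (P f) \<le> C * schwartz_norm M f" if f: "f \<in> schwartz" for f
    proof (rule schwartz_norm_least)
      fix vs :: "'b list" and x :: 'b
      assume "set vs \<subseteq> Basis" "length vs \<le> N"
      then have "(1 + norm x) ^ N * norm (foldr dir_deriv vs (P f) x) \<le> (\<Sum>vs\<in>F. (1 + norm x) ^ N * norm (foldr dir_deriv vs (P f) x))"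
        using F by (intro member_le_sum) (auto simp: F_def)
      then show "(1 + norm x) ^ N * norm (foldr dir_deriv vs (P f) x) \<le> C * schwartz_norm M f"
        using MC[OF f] by (rule order_trans)
    qed
    then show "\<exists>M C. \<forall>f\<in>schwartz. schwartz_norm N (P f) \<le> C * schwartz_norm M f"
      by blast
  qed
qed

section \<open>Integration\<close>

text \<open>Lebesgue measure is the image of a finite product of one-dimensional Lebesgue measures
  under the sum of \<open>x b *\<^sub>R b\<close>, where products of functions of one variable
  integrate factor by factor. Both the decay function and the Gaussian are treated this way.\<close>

lemma
  fixes f :: "'a::euclidean_space \<Rightarrow> real \<Rightarrow> complex"
  assumes f: "\<And>b. b \<in> Basis \<Longrightarrow> integrable lborel (f b)"
  shows integrable_lborel_prod_Basis: "integrable lborel (\<lambda>x::'a. \<Prod>b\<in>Basis. f b (x \<bullet> b))"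
    and integral_lborel_prod_Basis:
      "(LINT x|lborel. (\<Prod>b\<in>Basis. f b (x \<bullet> b))) = (\<Prod>b\<in>Basis. LINT t|lborel. f b t)"
proof -
  interpret product_sigma_finite "\<lambda>_::'a. lborel :: real measure" ..
  let ?T = "\<lambda>x. \<Sum>b\<in>(Basis::'a set). x b *\<^sub>R b"
  let ?P = "\<Pi>\<^sub>M b\<in>(Basis::'a set). lborel :: real measure"
  have T: "?T \<in> ?P \<rightarrow>\<^sub>M borel" by measurable
  have L: "(lborel :: 'a measure) = distr ?P borel ?T" by (rule lborel_eq)
  have [measurable]: "f b \<in> borel_measurable borel" if "b \<in> Basis" for b
    using f[OF that] by auto
  have m: "(\<lambda>x::'a. \<Prod>b\<in>Basis. f b (x \<bullet> b)) \<in> borel_measurable borel"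
    by measurable
  have eq: "(\<Prod>b\<in>Basis. f b (?T x \<bullet> b)) = (\<Prod>b\<in>Basis. f b (x b))" for x
    by (intro prod.cong) (auto simp: inner_sum_left inner_Basis if_distrib[where f = "\<lambda>t. x _ * t"] cong: if_cong)
  show "integrable lborel (\<lambda>x::'a. \<Prod>b\<in>Basis. f b (x \<bullet> b))"
    unfolding L integrable_distr_eq[OF T m] eq
    by (rule product_integrable_prod) (auto intro: f)
  show "(LINT x|lborel. (\<Prod>b\<in>Basis. f b (x \<bullet> b))) = (\<Prod>b\<in>Basis. LINT t|lborel. f b t)"
    unfolding L integral_distr[OF T m] eq
    by (rule product_integral_prod) (auto intro: f)
qed

text \<open>Each of the \<open>DIM('a)\<close> factors \<open>1 + (x \<bullet> b)\<^sup>2\<close> is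
  at most \<open>(1 + norm x)\<^sup>2\<close>, so the exponent \<open>2 * DIM('a)\<close> puts the
  function below a product of integrable functions of one variable. The same exponent recurs in the
  decay bounds below.\<close>

lemma integrable_decay: "integrable lborel (\<lambda>x::'a::euclidean_space. 1 / (1 + norm x) ^ (2 * DIM('a)))"
proof -
  have "integrable lborel (\<lambda>x::real. inverse (1 + x\<^sup>2))"
    using integrable_inverse_1_plus_square by (simp add: set_integrable_def einterval_def)
  then have "integrable lborel (\<lambda>x::real. complex_of_real (inverse (1 + x\<^sup>2)))"
    by (rule integrable_of_real)
  then have "integrable lborel (\<lambda>x::'a. \<Prod>b\<in>Basis. complex_of_real (inverse (1 + (x \<bullet> b)\<^sup>2)))"
    by (intro integrable_lborel_prod_Basis)
  then show ?thesis
  proof (rule Bochner_Integration.integrable_bound, goal_cases)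
    case 2
    have "norm (1 / (1 + norm x) ^ (2 * DIM('a))) \<le> norm (\<Prod>b\<in>Basis. complex_of_real (inverse (1 + (x \<bullet> b)\<^sup>2)))"
      for x :: 'a
    proof -
      have le: "1 + (x \<bullet> b)\<^sup>2 \<le> (1 + norm x)\<^sup>2" if "b \<in> Basis" for b
      proof -
        have "(x \<bullet> b)\<^sup>2 \<le> (norm x)\<^sup>2"
          using Basis_le_norm[OF that, of x] abs_le_square_iff[of "x \<bullet> b" "norm x"] by simp
        then show ?thesis using norm_ge_zero[of x] unfolding power2_sum by (simp del: norm_ge_zero)
      qed
      have "1 / (1 + norm x) ^ (2 * DIM('a)) = (\<Prod>b\<in>(Basis::'a set). inverse ((1 + norm x)\<^sup>2))"
        by (simp add: power_mult inverse_eq_divide power_one_over)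
      also have "\<dots> \<le> (\<Prod>b\<in>Basis. inverse (1 + (x \<bullet> b)\<^sup>2))"
        by (intro prod_mono conjI le_imp_inverse_le le)
           (auto simp: add_pos_nonneg)
      also have "\<dots> = norm (\<Prod>b\<in>Basis. complex_of_real (inverse (1 + (x \<bullet> b)\<^sup>2)))"
        unfolding prod_norm[symmetric] norm_of_real
        by (intro prod.cong) (auto simp: abs_of_nonneg)
      finally show ?thesis by simp
    qed
    then show ?case by simp
  qed simp
qed

lemma integrable_decayI:
  fixes f :: "'a::euclidean_space \<Rightarrow> 'b::{banach, second_countable_topology}"
  assumes "f \<in> borel_measurable borel" and "\<And>x. (1 + norm x) ^ (2 * DIM('a)) * norm (f x) \<le> C"
  shows "integrable lborel f"
proof (rule Bochner_Integration.integrable_bound)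
  show "integrable lborel (\<lambda>x::'a. C * (1 / (1 + norm x) ^ (2 * DIM('a))))"
    by (intro integrable_mult_right integrable_decay)
  have "norm (f x) \<le> norm (C * (1 / (1 + norm x) ^ (2 * DIM('a))))" for x
  proof -
    have p: "(1 + norm x) ^ (2 * DIM('a)) > 0"
      by (simp add: add_pos_nonneg)
    have "norm (f x) \<le> C / (1 + norm x) ^ (2 * DIM('a))"
      using assms(2)[of x] p by (simp add: field_simps)
    also have "\<dots> \<le> \<bar>C * (1 / (1 + norm x) ^ (2 * DIM('a)))\<bar>"
      using abs_ge_self by (simp only: mult.right_neutral times_divide_eq_right)
    finally show ?thesis by simp
  qed
  then show "AE x in lborel. norm (f x) \<le> norm (C * (1 / (1 + norm x) ^ (2 * DIM('a))))"
    by simp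
qed (use assms(1) in simp)

lemma schwartz_integrable_weighted:
  assumes "f \<in> schwartz"
  shows "integrable lborel (\<lambda>x::'a::euclidean_space. (1 + norm x) ^ N * norm (f x))"
proof -
  obtain C where C: "\<And>x. (1 + norm x) ^ (2 * DIM('a) + N) * norm (f x) \<le> C"
    using schwartz_bound[OF assms] by metis
  have [measurable]: "f \<in> borel_measurable borel"
    by (rule schwartz_measurable[OF assms])
  show ?thesis
    by (rule integrable_decayI[of _ C]) (use C in \<open>auto simp: abs_mult power_add mult.assoc\<close>)
qed

lemma schwartz_integrable:
  assumes "f \<in> schwartz" shows "integrable lborel f"
  using schwartz_integrable_weighted[OF assms, of 0] schwartz_measurable[OF assms]
  by (simp add: integrable_norm_iff)

lemma
  fixes f :: "'a::euclidean_space \<Rightarrow> 'b::{banach, second_countable_topology}"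
  assumes [measurable]: "f \<in> borel_measurable borel" and c: "c \<noteq> 0"
  shows integrable_lborel_affine: "integrable lborel (\<lambda>x. f (t + c *\<^sub>R x)) \<longleftrightarrow> integrable lborel f"
    and integral_lborel_affine: "(LINT x|lborel. f (t + c *\<^sub>R x)) = (1 / \<bar>c\<bar> ^ DIM('a)) *\<^sub>R (LINT x|lborel. f x)"
proof -
  show "integrable lborel (\<lambda>x. f (t + c *\<^sub>R x)) \<longleftrightarrow> integrable lborel f"
  proof -
    have "integrable lborel (\<lambda>x. \<bar>c\<bar> ^ DIM('a) *\<^sub>R f (t + c *\<^sub>R x)) \<longleftrightarrow> integrable lborel (\<lambda>x. f (t + c *\<^sub>R x))"
      using integrable_scaleR_right[of "1 / \<bar>c\<bar> ^ DIM('a)" lborel "\<lambda>x. \<bar>c\<bar> ^ DIM('a) *\<^sub>R f (t + c *\<^sub>R x)"] c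
      by auto
    then show ?thesis
      using c by (subst (2) lborel_affine[OF c, of t]) (simp add: integrable_density integrable_distr_eq)
  qed
  have "(LINT x|lborel. f x) = \<bar>c\<bar> ^ DIM('a) *\<^sub>R (LINT x|lborel. f (t + c *\<^sub>R x))"
    using c by (subst lborel_affine[OF c, of t]) (simp add: integral_density integral_distr)
  then show "(LINT x|lborel. f (t + c *\<^sub>R x)) = (1 / \<bar>c\<bar> ^ DIM('a)) *\<^sub>R (LINT x|lborel. f x)"
    using c by simp
qed

section \<open>Differentiation under the integral sign\<close>

text \<open>The normalized remainder \<open>q h y\<close> tends to 0 for each \<open>y\<close>, and
  the mean value inequality on the ball bounds it by \<open>2 * g y\<close>, one \<open>g y\<close>
  for the increment and one for the linear part. Dominated convergence does the rest.\<close>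

lemma has_derivative_integral_dominated:
  fixes K :: "'a::euclidean_space \<Rightarrow> 'b::euclidean_space \<Rightarrow> complex"
  assumes r: "0 < r"
    and der: "\<And>u y. u \<in> ball x r \<Longrightarrow> ((\<lambda>u. K u y) has_derivative K' u y) (at u)"
    and bound: "\<And>u y v. u \<in> ball x r \<Longrightarrow> norm (K' u y v) \<le> g y * norm v"
    and g: "integrable lborel g"
    and K: "\<And>u. integrable lborel (K u)"
    and meas: "\<And>v. (\<lambda>y. K' x y v) \<in> borel_measurable borel"
  shows "((\<lambda>u. LINT y|lborel. K u y) has_derivative (\<lambda>v. LINT y|lborel. K' x y v)) (at x)"
proof -
  have x: "x \<in> ball x r" using r by simp
  have int': "integrable lborel (\<lambda>y. K' x y v)" for v
  proof (rule Bochner_Integration.integrable_bound)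
    show "integrable lborel (\<lambda>y. g y * norm v)" using g by simp
    show "AE y in lborel. norm (K' x y v) \<le> norm (g y * norm v)"
      unfolding real_norm_def by (intro AE_I2 order_trans[OF bound[OF x] abs_ge_self])
  qed (use meas in simp)
  have lin: "linear (K' x y)" for y
    using der[OF x] by (rule has_derivative_linear)
  have bl: "bounded_linear (\<lambda>v. LINT y|lborel. K' x y v)"
  proof (rule bounded_linear_intro)
    fix u v c
    show "(LINT y|lborel. K' x y (u + v)) = (LINT y|lborel. K' x y u) + (LINT y|lborel. K' x y v)"
      by (simp add: linear_add[OF lin] int')
    show "(LINT y|lborel. K' x y (c *\<^sub>R v)) = c *\<^sub>R (LINT y|lborel. K' x y v)"
      by (simp add: linear_scale[OF lin])
    have "norm (LINT y|lborel. K' x y v) \<le> (LINT y|lborel. norm (K' x y v))"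
      by (rule integral_norm_bound)
    also have "\<dots> \<le> (LINT y|lborel. g y * norm v)"
      by (intro integral_mono integrable_norm int' integrable_mult_left g bound[OF x])
    finally show "norm (LINT y|lborel. K' x y v) \<le> norm v * (LINT y|lborel. g y)"
      by (simp add: mult.commute)
  qed
  define q where "q h y = (K (x + h) y - K x y - K' x y h) /\<^sub>R norm h" for h y
  have q0: "((\<lambda>h. q h y) \<longlongrightarrow> 0) (at 0)" for y
    using der[OF x, of y] unfolding has_derivative_at q_def
    by (subst tendsto_norm_zero_iff[symmetric]) (simp add: divide_inverse mult.commute)
  have qb: "norm (q h y) \<le> 2 * g y" if "norm h < r" for h y
  proof (cases "h = 0")
    case True
    have "norm (K' x y h) \<le> 0" using bound[OF x, of y h] True by simp
    \<comment> \<open>Follows from the bound at a unit vector.\<close>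
    moreover have "0 \<le> g y"
      using bound[OF x, of y "SOME b. b \<in> Basis"] norm_ge_zero some_in_eq[of "Basis :: 'a set"]
      by (smt (verit) mult_nonneg_nonneg mult_neg_pos nonempty_Basis norm_some_Basis)
    ultimately show ?thesis by (simp add: q_def True)
  next
    case False
    have "norm (K (x + h) y - K x y) \<le> g y * norm (x + h - x)"
    proof (rule differentiable_bound[of "ball x r" "\<lambda>u. K u y" "\<lambda>u. K' u y"])
      fix u assume u: "u \<in> ball x r"
      show "((\<lambda>u. K u y) has_derivative K' u y) (at u within ball x r)"
        using der[OF u] by (rule has_derivative_at_withinI)
      show "onorm (K' u y) \<le> g y"
        by (rule onorm_bound) (use bound[OF u, of y] order_trans[OF norm_ge_zero bound[OF u, of y "SOME b. b \<in> Basis"]] in \<open>auto simp: norm_some_Basis\<close>)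
    qed (use that r in \<open>auto simp: dist_norm\<close>)
    moreover have "norm (K (x + h) y - K x y - K' x y h) \<le> norm (K (x + h) y - K x y) + norm (K' x y h)"
      by (rule norm_triangle_ineq4)
    ultimately have "norm (K (x + h) y - K x y - K' x y h) \<le> 2 * g y * norm h"
      using bound[OF x, of y h] by simp
    then show ?thesis
      using False unfolding q_def norm_scaleR by (simp add: field_simps)
  qed
  have "((\<lambda>h. LINT y|lborel. q h y) \<longlongrightarrow> (LINT y|(lborel :: 'b measure). (0::complex))) (at 0)"
    unfolding tendsto_at_iff_sequentially comp_def
  proof (intro allI impI)
    fix X :: "nat \<Rightarrow> 'a" assume X: "\<forall>i. X i \<in> UNIV - {0}" "X \<longlonglongrightarrow> 0"
    \<comment> \<open>The bound on \<open>q\<close> holds only for increments shorter than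
      \<open>r\<close>, so the first terms of the sequence are dropped by an index shift.\<close>
    have ev: "\<forall>\<^sub>F n in sequentially. norm (X n) < r"
      using tendstoD[OF X(2) r] by simp
    then obtain k where k: "\<And>n. n \<ge> k \<Longrightarrow> norm (X n) < r"
      unfolding eventually_sequentially by blast
    have "(\<lambda>n. LINT y|lborel. q (X (n + k)) y) \<longlonglongrightarrow> (LINT y|(lborel :: 'b measure). (0::complex))"
    proof (rule integral_dominated_convergence[where w = "\<lambda>y. 2 * g y"])
      have "filterlim (\<lambda>n. X (n + k)) (at 0) sequentially"
        using X LIMSEQ_ignore_initial_segment[OF X(2), of k] by (simp add: filterlim_at)
      from filterlim_compose[OF q0 this]
      show "AE y in lborel. (\<lambda>n. q (X (n + k)) y) \<longlonglongrightarrow> 0" by simp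
      show "AE y in lborel. norm (q (X (n + k)) y) \<le> 2 * g y" for n
        using qb[OF k[of "n + k"]] by simp
      show "(\<lambda>y. q (X (n + k)) y) \<in> borel_measurable lborel" for n
        unfolding q_def using K meas by (auto intro!: borel_measurable_scaleR borel_measurable_diff)
    qed (use g in auto)
    then show "(\<lambda>n. LINT y|lborel. q (X n) y) \<longlonglongrightarrow> (LINT y|(lborel :: 'b measure). (0::complex))"
      by (rule LIMSEQ_offset)
  qed
  moreover have "(LINT y|lborel. q h y) =
      ((LINT y|lborel. K (x + h) y) - (LINT y|lborel. K x y) - (LINT y|lborel. K' x y h)) /\<^sub>R norm h" for h
    unfolding q_def by (simp add: K int')
  ultimately have "((\<lambda>h. ((LINT y|lborel. K (x + h) y) - (LINT y|lborel. K x y) - (LINT y|lborel. K' x y h)) /\<^sub>R norm h)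
      \<longlongrightarrow> 0) (at 0)"
    by simp
  then show ?thesis
    unfolding has_derivative_at using bl
    by (subst (asm) tendsto_norm_zero_iff[symmetric]) (simp add: divide_inverse mult.commute)
qed

text \<open>Differentiate the constant \<open>t \<mapsto> \<integral> h (y + t b) dy\<close> at \<open>0\<close>.\<close>

lemma integral_derivative_zero:
  fixes h :: "'a::euclidean_space \<Rightarrow> complex"
  assumes der: "\<And>y. (h has_derivative h' y) (at y)"
    and h: "integrable lborel h"
    and meas: "(\<lambda>y. h' y b) \<in> borel_measurable borel"
    and bound: "\<And>y. (1 + norm y) ^ (2 * DIM('a)) * norm (h' y b) \<le> C"
  shows "(LINT y|lborel. h' y b) = 0"
proof -
  let ?n = "2 * DIM('a)"
  have hm[measurable]: "h \<in> borel_measurable borel"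
    using der by (intro borel_measurable_continuous_onI)
      (meson continuous_at_imp_continuous_on has_derivative_continuous)
  have int: "(LINT y|lborel. h (y + t *\<^sub>R b)) = (LINT y|lborel. h y)" for t
    using integral_lborel_affine[of h 1 "t *\<^sub>R b"] by (simp add: add.commute)
  \<comment> \<open>For \<open>\<bar>t\<bar> < 1\<close> the point \<open>y + t *\<^sub>R b\<close>
    is at most \<open>norm b\<close> away from \<open>y\<close>; the factor
    \<open>(1 + norm b) ^ ?n\<close> transfers the decay from there to \<open>y\<close>, uniformly
    in \<open>t\<close>.\<close>
  define g where "g y = C * (1 + norm b) ^ ?n * (1 / (1 + norm y) ^ ?n)" for y :: 'a
  have g: "integrable lborel g"
    unfolding g_def by (intro integrable_mult_right integrable_decay)
  have "((\<lambda>t. LINT y|lborel. h (y + t *\<^sub>R b)) has_derivative (\<lambda>v. LINT y|lborel. v *\<^sub>R h' (y + 0 *\<^sub>R b) b)) (at (0::real))"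
  proof (rule has_derivative_integral_dominated[where r = 1 and K' = "\<lambda>t y v. v *\<^sub>R h' (y + t *\<^sub>R b) b" and g = g])
    show "((\<lambda>t. h (y + t *\<^sub>R b)) has_derivative (\<lambda>v. v *\<^sub>R h' (y + t *\<^sub>R b) b)) (at t)" for t y
    proof -
      have "((\<lambda>t. h (y + t *\<^sub>R b)) has_derivative (\<lambda>v. h' (y + t *\<^sub>R b) (v *\<^sub>R b))) (at t)"
        by (rule has_derivative_compose[of "\<lambda>t. y + t *\<^sub>R b" "\<lambda>v. v *\<^sub>R b" t UNIV h, OF _ der])
          (auto intro!: derivative_eq_intros)
      then show ?thesis
        by (simp add: linear_scale[OF has_derivative_linear[OF der]])
    qed
    show "norm (v *\<^sub>R h' (y + t *\<^sub>R b) b) \<le> g y * norm v" if "t \<in> ball 0 1" for t y v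
    proof -
      have "1 + norm y \<le> (1 + norm (y + t *\<^sub>R b)) * (1 + norm b)"
      proof -
        have "norm y \<le> norm (y + t *\<^sub>R b) + norm (t *\<^sub>R b)"
          by (metis add_diff_cancel_right' norm_triangle_ineq4)
        moreover have "norm (t *\<^sub>R b) \<le> norm b"
          using that by (simp add: mult_left_le_one_le)
        moreover have "0 \<le> norm (y + t *\<^sub>R b) * norm b" by simp
        ultimately show ?thesis unfolding ring_distribs by linarith
      qed
      then have "(1 + norm y) ^ ?n \<le> ((1 + norm (y + t *\<^sub>R b)) * (1 + norm b)) ^ ?n"
        by (intro power_mono) auto
      then have "(1 + norm y) ^ ?n * norm (h' (y + t *\<^sub>R b) b)
          \<le> ((1 + norm (y + t *\<^sub>R b)) * (1 + norm b)) ^ ?n * norm (h' (y + t *\<^sub>R b) b)"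
        by (rule mult_right_mono) simp
      also have "\<dots> \<le> C * (1 + norm b) ^ ?n"
        using mult_right_mono[OF bound[of "y + t *\<^sub>R b"], of "(1 + norm b) ^ ?n"]
        by (simp add: power_mult_distrib mult_ac)
      finally have "norm (h' (y + t *\<^sub>R b) b) \<le> g y"
        unfolding g_def by (simp add: field_simps add_pos_nonneg)
      then show ?thesis by (simp add: mult_left_mono mult.commute[of _ "\<bar>v\<bar>"])
    qed
    show "integrable lborel (\<lambda>y. h (y + t *\<^sub>R b))" for t
      using integrable_lborel_affine[of h 1 "t *\<^sub>R b"] h by (simp add: add.commute)
  qed (use meas g in auto)
  then have "((\<lambda>t::real. LINT y|lborel. h y) has_derivative (\<lambda>v. LINT y|lborel. v *\<^sub>R h' y b)) (at 0)"
    by (simp add: int)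
  then have "(\<lambda>v::real. LINT y|lborel. v *\<^sub>R h' y b) = (\<lambda>v. 0)"
    by (rule has_derivative_unique) simp
  from fun_cong[OF this, of 1] show ?thesis by simp
qed

section \<open>Splitting a vector into two blocks\<close>

lemma vfst_vjoin [simp]: "vfst (vjoin x y) = x"
  by (simp add: vfst_def vjoin_def)

lemma vsnd_vjoin [simp]: "vsnd (vjoin x y) = y"
  by (simp add: vsnd_def vjoin_def)

lemma vjoin_vfst_vsnd [simp]: "vjoin (vfst z) (vsnd z) = z"
  by (simp add: vec_eq_iff vjoin_def vfst_def vsnd_def split: sum.split)

lemma linear_vfst: "linear vfst"
  by (rule linearI) (simp_all add: vec_eq_iff vfst_def)

lemma linear_vsnd: "linear vsnd"
  by (rule linearI) (simp_all add: vec_eq_iff vsnd_def)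

lemma vjoin_add: "vjoin (x + x') (y + y') = vjoin x y + vjoin x' y'"
  by (simp add: vec_eq_iff vjoin_def split: sum.split)

lemma linear_vjoin: "linear (\<lambda>p. vjoin (fst p) (snd p))"
  by (rule linearI) (simp_all add: vec_eq_iff vjoin_def split: sum.split)

lemma vfst_add [simp]: "vfst (x + y) = vfst x + vfst y"
  and vsnd_add [simp]: "vsnd (x + y) = vsnd x + vsnd y"
  and vfst_diff [simp]: "vfst (x - y) = vfst x - vfst y"
  and vsnd_diff [simp]: "vsnd (x - y) = vsnd x - vsnd y"
  and vfst_uminus [simp]: "vfst (- x) = - vfst x"
  and vsnd_uminus [simp]: "vsnd (- x) = - vsnd x"
  and vfst_zero [simp]: "vfst 0 = 0"
  and vsnd_zero [simp]: "vsnd 0 = 0"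
  and vfst_scaleR [simp]: "vfst (c *\<^sub>R x) = c *\<^sub>R vfst x"
  and vsnd_scaleR [simp]: "vsnd (c *\<^sub>R x) = c *\<^sub>R vsnd x"
  by (simp_all add: vec_eq_iff vfst_def vsnd_def)

lemma UNIV_sum_vec: "(\<Sum>i\<in>(UNIV::('m::finite + 'n::finite) set). f i) = (\<Sum>i\<in>UNIV. f (Inl i)) + (\<Sum>i\<in>UNIV. f (Inr i))"
  unfolding UNIV_Plus_UNIV[symmetric] by (subst sum.Plus) auto

lemma inner_vjoin_split: "(x::real^('m::finite + 'n::finite)) \<bullet> y = vfst x \<bullet> vfst y + vsnd x \<bullet> vsnd y"
  by (simp add: inner_vec_def UNIV_sum_vec vfst_def vsnd_def)

lemma norm_vjoin_split: "(norm (x::real^('m::finite + 'n::finite)))\<^sup>2 = (norm (vfst x))\<^sup>2 + (norm (vsnd x))\<^sup>2"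
  unfolding power2_norm_eq_inner by (rule inner_vjoin_split)

lemma norm_vfst_le: "norm (vfst x) \<le> norm x"
  by (rule power2_le_imp_le) (simp_all add: norm_vjoin_split)

lemma norm_vsnd_le: "norm (vsnd x) \<le> norm x"
  by (rule power2_le_imp_le) (simp_all add: norm_vjoin_split)

lemma norm_le_vfst_vsnd: "norm x \<le> norm (vfst x) + norm (vsnd x)"
  by (rule power2_le_imp_le) (simp_all add: norm_vjoin_split power2_sum)

lemma continuous_on_linear_compose:
  fixes L :: "'a::euclidean_space \<Rightarrow> 'b::real_normed_vector"
  assumes "linear L" "continuous_on A f"
  shows "continuous_on A (\<lambda>x. L (f x))"
  using assms by (intro continuous_on_compose2[OF linear_continuous_on[of L UNIV]])
    (auto simp: linear_conv_bounded_linear)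

lemmas continuous_on_vfst [continuous_intros] = continuous_on_linear_compose[OF linear_vfst]
lemmas continuous_on_vsnd [continuous_intros] = continuous_on_linear_compose[OF linear_vsnd]

lemma continuous_on_vjoin [continuous_intros]:
  "continuous_on A f \<Longrightarrow> continuous_on A g \<Longrightarrow> continuous_on A (\<lambda>x. vjoin (f x) (g x))"
  using continuous_on_linear_compose[OF linear_vjoin continuous_on_Pair, of A f g] by simp

lemma measurable_vsnd [measurable]: "vsnd \<in> borel_measurable borel"
  by (intro borel_measurable_continuous_onI continuous_intros)

lemma measurable_vjoin [measurable (raw)]:
  assumes [measurable]: "f \<in> borel_measurable M" "g \<in> borel_measurable M"
  shows "(\<lambda>x. vjoin (f x) (g x)) \<in> borel_measurable M"
proof -
  have [measurable]: "(\<lambda>p. vjoin (fst p) (snd p)) \<in> borel_measurable borel"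
    by (intro borel_measurable_continuous_onI continuous_intros)
  have "(\<lambda>x. (\<lambda>p. vjoin (fst p) (snd p)) (f x, g x)) \<in> borel_measurable M"
    by measurable
  then show ?thesis by simp
qed

section \<open>Lebesgue measure and Fubini's theorem for block vectors\<close>

lemma Basis_cart: "(Basis :: (real^'n) set) = range (\<lambda>i. axis i 1)"
  by (auto simp: Basis_vec_def)

lemma prod_Basis_cart: "(\<Prod>b\<in>(Basis::(real^'n) set). h b) = (\<Prod>i\<in>UNIV. h (axis i 1))"
  unfolding Basis_cart by (subst prod.reindex) (auto intro!: injI simp: axis_eq_axis)

text \<open>Lebesgue measure is determined by its values on boxes, and the preimage of a box is a
  product of two boxes. Fubini's theorem for integrals over joined vectors follows from
  this.\<close>

lemma lborel_vjoin:
  "distr (lborel \<Otimes>\<^sub>M lborel) borel (\<lambda>p. vjoin (fst p) (snd p)) = (lborel :: (real^('m::finite + 'n::finite)) measure)"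
proof (rule lborel_eqI[symmetric])
  fix l u :: "real^('m + 'n)" assume le: "\<And>b. b \<in> Basis \<Longrightarrow> l \<bullet> b \<le> u \<bullet> b"
  have le': "l $ i \<le> u $ i" for i
    using le[of "axis i 1"] by (auto simp: Basis_cart inner_axis)
  have "(\<lambda>p. vjoin (fst p) (snd p)) -` box l u \<inter> space (lborel \<Otimes>\<^sub>M lborel)
      = box (vfst l) (vfst u) \<times> box (vsnd l) (vsnd u)"
    by (auto simp: mem_box_cart vjoin_def vfst_def vsnd_def space_pair_measure split: sum.splits)
  then have "emeasure (distr (lborel \<Otimes>\<^sub>M lborel) borel (\<lambda>p. vjoin (fst p) (snd p))) (box l u)
      = emeasure lborel (box (vfst l) (vfst u)) * emeasure lborel (box (vsnd l) (vsnd u))"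
    by (subst emeasure_distr) (simp_all add: lborel.emeasure_pair_measure_Times)
  also have "\<dots> = (\<Prod>i\<in>UNIV. (u - l) $ Inl i) * (\<Prod>i\<in>UNIV. (u - l) $ Inr i)"
    using le' by (subst (1 2) emeasure_lborel_box)
      (auto simp: Basis_cart inner_axis vfst_def vsnd_def prod_Basis_cart[unfolded Basis_cart] ennreal_mult prod_nonneg)
  also have "\<dots> = (\<Prod>b\<in>Basis. (u - l) \<bullet> b)"
    unfolding prod_Basis_cart UNIV_Plus_UNIV[symmetric]
    by (subst prod.Plus) (auto simp: inner_axis)
  finally show "emeasure (distr (lborel \<Otimes>\<^sub>M lborel) borel (\<lambda>p. vjoin (fst p) (snd p))) (box l u)
      = (\<Prod>b\<in>Basis. (u - l) \<bullet> b)" .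
qed simp

lemma
  fixes F :: "real^('m::finite + 'n::finite) \<Rightarrow> 'b::{banach, second_countable_topology}"
  assumes F: "integrable lborel F"
  shows integrable_vjoin: "integrable (lborel \<Otimes>\<^sub>M lborel) (\<lambda>(x, y). F (vjoin x y))"
    and integral_vjoin: "(LINT z|lborel. F z) = (LINT x|lborel. LINT y|lborel. F (vjoin x y))"
proof -
  have [measurable]: "F \<in> borel_measurable borel" using F by auto
  have m: "(\<lambda>p. vjoin (fst p) (snd p)) \<in> lborel \<Otimes>\<^sub>M lborel \<rightarrow>\<^sub>M (borel :: (real^('m + 'n)) measure)"
    by measurable
  have I: "integrable (lborel \<Otimes>\<^sub>M lborel) (\<lambda>p. F (vjoin (fst p) (snd p)))"
    using F unfolding lborel_vjoin[symmetric] by (subst (asm) integrable_distr_eq) measurable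
  then show I': "integrable (lborel \<Otimes>\<^sub>M lborel) (\<lambda>(x, y). F (vjoin x y))"
    by (simp add: case_prod_unfold)
  have "(LINT z|lborel. F z) = (LINT p|(lborel \<Otimes>\<^sub>M lborel). F (vjoin (fst p) (snd p)))"
    by (subst lborel_vjoin[symmetric], subst integral_distr) measurable
  also have "\<dots> = (LINT x|lborel. LINT y|lborel. F (vjoin x y))"
    using lborel_pair.integral_fst'[OF I] by simp
  finally show "(LINT z|lborel. F z) = (LINT x|lborel. LINT y|lborel. F (vjoin x y))" .
qed

section \<open>Linear substitutions in the Lebesgue integral\<close>

lemma measurable_matrix_vector_mult [measurable]:
  "(\<lambda>x. A *v x) \<in> borel_measurable (borel :: (real^'n) measure)"
  by (intro borel_measurable_continuous_onI linear_continuous_on) (simp add: linear_conv_bounded_linear[symmetric])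

text \<open>The change of variables theorems of the library require the index type to be well-ordered,
  which a sum type is not.\<close>

lemma nn_integral_translate:
  fixes f :: "'a::euclidean_space \<Rightarrow> ennreal"
  assumes [measurable]: "f \<in> borel_measurable borel"
  shows "(\<integral>\<^sup>+x. f (x + t) \<partial>lborel) = (\<integral>\<^sup>+x. f x \<partial>lborel)"
proof -
  have "(\<integral>\<^sup>+x. f x \<partial>lborel) = (\<integral>\<^sup>+x. f x \<partial>distr lborel borel ((+) t))"
    by (simp add: lborel_distr_plus)
  also have "\<dots> = (\<integral>\<^sup>+x. f (x + t) \<partial>lborel)"
    by (subst nn_integral_distr) (auto simp: add.commute)
  finally show ?thesis ..
qed

text \<open>Insert the factor \<open>1 = \<integral> 1[l x \<le> s < l x + 1] ds\<close>; for fixed \<open>s\<close>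
  the substitution \<open>x \<mapsto> x - s v\<close> does not change \<open>l x\<close>.\<close>

lemma nn_integral_shear:
  fixes f :: "'a::euclidean_space \<Rightarrow> ennreal"
  assumes f[measurable]: "f \<in> borel_measurable borel" and l[measurable]: "l \<in> borel_measurable borel"
    and lin: "\<And>x s. l (x + s *\<^sub>R v) = (l x :: real)"
  shows "(\<integral>\<^sup>+x. f (x + l x *\<^sub>R v) \<partial>lborel) = (\<integral>\<^sup>+x. f x \<partial>lborel)"
proof -
  have one: "(\<integral>\<^sup>+s. indicator {a..<a+1} s \<partial>lborel) = (1::ennreal)" for a :: real
    by (subst nn_integral_indicator) auto
  have l_meas[measurable]: "(\<lambda>(x, s). indicator {l x..<l x + 1} s :: ennreal) \<in> borel_measurable (borel \<Otimes>\<^sub>M borel)"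
    unfolding indicator_def atLeastLessThan_iff by measurable
  let ?I = "\<integral>\<^sup>+x. \<integral>\<^sup>+s. f (x + s *\<^sub>R v) * indicator {l x..<l x + 1} s \<partial>lborel \<partial>lborel"
  have "?I = (\<integral>\<^sup>+s. \<integral>\<^sup>+x. f (x + s *\<^sub>R v) * indicator {l x..<l x + 1} s \<partial>lborel \<partial>lborel)"
    by (rule lborel_pair.Fubini'[symmetric]) measurable
  also have "\<dots> = (\<integral>\<^sup>+s. \<integral>\<^sup>+x. f x * indicator {l x..<l x + 1} s \<partial>lborel \<partial>lborel)"
  proof (rule nn_integral_cong)
    fix s :: real
    have [measurable]: "(\<lambda>x. indicator {l x..<l x + 1} s :: ennreal) \<in> borel_measurable borel"
      unfolding indicator_def atLeastLessThan_iff by measurable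
    show "(\<integral>\<^sup>+x. f (x + s *\<^sub>R v) * indicator {l x..<l x + 1} s \<partial>lborel)
        = (\<integral>\<^sup>+x. f x * indicator {l x..<l x + 1} s \<partial>lborel)"
      using nn_integral_translate[of "\<lambda>x. f x * indicator {l x..<l x + 1} s" "s *\<^sub>R v"] by (simp add: lin)
  qed
  also have "\<dots> = (\<integral>\<^sup>+x. \<integral>\<^sup>+s. f x * indicator {l x..<l x + 1} s \<partial>lborel \<partial>lborel)"
    by (rule lborel_pair.Fubini') measurable
  also have "\<dots> = (\<integral>\<^sup>+x. f x \<partial>lborel)"
    by (simp add: nn_integral_cmult one)
  finally have 1: "?I = (\<integral>\<^sup>+x. f x \<partial>lborel)" .
  \<comment> \<open>The same integral is evaluated a second time: after \<open>s = r + l x\<close>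
    the indicator is free of \<open>x\<close>, and the remaining shift by
    \<open>r *\<^sub>R v\<close> is removed by translation invariance.\<close>
  have "?I = (\<integral>\<^sup>+x. \<integral>\<^sup>+r. f (x + (r + l x) *\<^sub>R v) * indicator {0..<1} r \<partial>lborel \<partial>lborel)"
  proof (rule nn_integral_cong)
    fix x
    have "indicator {l x..<l x + 1} (r + l x) = (indicator {0..<1} r :: ennreal)" for r
      by (auto simp: indicator_def)
    then show "(\<integral>\<^sup>+s. f (x + s *\<^sub>R v) * indicator {l x..<l x + 1} s \<partial>lborel)
        = (\<integral>\<^sup>+r. f (x + (r + l x) *\<^sub>R v) * indicator {0..<1} r \<partial>lborel)"
      using nn_integral_translate[of "\<lambda>s. f (x + s *\<^sub>R v) * indicator {l x..<l x + 1} s" "l x"] by simp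
  qed
  also have "\<dots> = (\<integral>\<^sup>+r. \<integral>\<^sup>+x. f (x + (r + l x) *\<^sub>R v) * indicator {0..<1} r \<partial>lborel \<partial>lborel)"
    by (rule lborel_pair.Fubini'[symmetric]) measurable
  also have "\<dots> = (\<integral>\<^sup>+r. (\<integral>\<^sup>+x. f (x + l x *\<^sub>R v) \<partial>lborel) * indicator {0..<1} (r::real) \<partial>lborel)"
  proof (rule nn_integral_cong)
    fix r :: real
    have "(\<integral>\<^sup>+x. f (x + (r + l x) *\<^sub>R v) \<partial>lborel) = (\<integral>\<^sup>+x. f (x + l x *\<^sub>R v) \<partial>lborel)"
      using nn_integral_translate[of "\<lambda>x. f (x + l x *\<^sub>R v)" "r *\<^sub>R v"] by (simp add: lin algebra_simps)
    then show "(\<integral>\<^sup>+x. f (x + (r + l x) *\<^sub>R v) * indicator {0..<1} r \<partial>lborel)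
        = (\<integral>\<^sup>+x. f (x + l x *\<^sub>R v) \<partial>lborel) * indicator {0..<1} r"
      by (simp add: nn_integral_multc)
  qed
  also have "\<dots> = (\<integral>\<^sup>+x. f (x + l x *\<^sub>R v) \<partial>lborel)"
    using one[of 0] by (simp add: nn_integral_cmult)
  finally show ?thesis using 1 by simp
qed

text \<open>The formula is multiplicative in the matrix, so diagonal matrices, coordinate swaps and
  shears suffice. The induction predicate quantifies over \<open>f\<close> because in a product the
  hypothesis for \<open>B\<close> is applied to \<open>\<lambda>x. f (A *v x)\<close>; a matrix with
  a zero row is excluded by its determinant.\<close>

lemma nn_integral_matrix:
  fixes A :: "real^'n^'n"
  assumes "f \<in> borel_measurable borel" "det A \<noteq> 0"
  shows "(\<integral>\<^sup>+x. f x \<partial>lborel) = ennreal \<bar>det A\<bar> * (\<integral>\<^sup>+x. f (A *v x) \<partial>lborel)"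
proof -
  define P where "P A \<longleftrightarrow> (det A \<noteq> 0 \<longrightarrow> (\<forall>f\<in>borel_measurable borel.
      (\<integral>\<^sup>+x. f x \<partial>lborel) = ennreal \<bar>det A\<bar> * (\<integral>\<^sup>+x. f (A *v x) \<partial>lborel)))" for A :: "real^'n^'n"
  have "P A"
  proof (induction A rule: induct_matrix_elementary)
    case (1 A B)
    show ?case
      unfolding P_def
    proof (intro impI ballI)
      fix f :: "real^'n \<Rightarrow> ennreal" assume [measurable]: "f \<in> borel_measurable borel" and "det (A ** B) \<noteq> 0"
      then have d: "det A \<noteq> 0" "det B \<noteq> 0" by (auto simp: det_mul)
      have "(\<integral>\<^sup>+x. f x \<partial>lborel) = ennreal \<bar>det A\<bar> * (\<integral>\<^sup>+x. f (A *v x) \<partial>lborel)"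
        using 1(1) d \<open>f \<in> _\<close> unfolding P_def by blast
      also have "(\<integral>\<^sup>+x. f (A *v x) \<partial>lborel) = ennreal \<bar>det B\<bar> * (\<integral>\<^sup>+x. f (A *v (B *v x)) \<partial>lborel)"
        using 1(2) d(2) unfolding P_def by (elim impE ballE[of _ _ "\<lambda>x. f (A *v x)"]) auto
      finally show "(\<integral>\<^sup>+x. f x \<partial>lborel) = ennreal \<bar>det (A ** B)\<bar> * (\<integral>\<^sup>+x. f ((A ** B) *v x) \<partial>lborel)"
        by (simp add: det_mul abs_mult ennreal_mult matrix_vector_mul_assoc mult.assoc)
    qed
  next
    case (2 A i)
    then show ?case using det_zero_row[of i A] by (simp add: P_def)
  next
    case (3 A)
    have d: "det A = (\<Prod>i\<in>UNIV. A $ i $ i)"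
      using 3 by (rule det_diagonal)
    show ?case
      unfolding P_def
    proof (intro impI ballI)
      fix f :: "real^'n \<Rightarrow> ennreal" assume [measurable]: "f \<in> borel_measurable borel" and "det A \<noteq> 0"
      \<comment> \<open>The affine substitution rule indexes its factors by basis vectors; this
        linear form returns the diagonal entry at each \<open>axis i 1\<close>.\<close>
      let ?c = "\<lambda>b. \<Sum>i\<in>UNIV. A $ i $ i * b $ i"
      have c: "?c (axis i 1) = A $ i $ i" for i
        by (simp add: axis_def if_distrib cong: if_cong)
      have nz: "?c b \<noteq> 0" if "b \<in> Basis" for b
        using \<open>det A \<noteq> 0\<close> that d by (auto simp: Basis_cart c)
      have T: "0 + (\<Sum>b\<in>Basis. (?c b * (x \<bullet> b)) *\<^sub>R b) = A *v x" for x
      proof -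
        have "(\<Sum>b\<in>Basis. (?c b * (x \<bullet> b)) *\<^sub>R b) = (\<Sum>i\<in>UNIV. (A $ i $ i * x $ i) *\<^sub>R axis i 1)"
          unfolding Basis_cart by (subst sum.reindex) (auto intro!: injI simp: axis_eq_axis c inner_axis)
        also have "\<dots> = A *v x"
        proof (subst vec_eq_iff, rule allI)
          fix i
          have "(\<Sum>j\<in>UNIV. A $ i $ j * x $ j) = (\<Sum>j\<in>{i}. A $ i $ j * x $ j)"
            using 3 by (intro sum.mono_neutral_right) auto
          then show "(\<Sum>i\<in>UNIV. (A $ i $ i * x $ i) *\<^sub>R axis i 1) $ i = (A *v x) $ i"
            by (simp add: matrix_vector_mult_def axis_def if_distrib cong: if_cong)
        qed
        finally show ?thesis by simp
      qed
      have "(\<Prod>b\<in>Basis. \<bar>?c b\<bar>) = \<bar>det A\<bar>"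
        by (simp add: prod_Basis_cart c d abs_prod)
      then have L: "(lborel :: (real^'n) measure) = density (distr lborel borel ((*v) A)) (\<lambda>_. \<bar>det A\<bar>)"
        using lborel_affine_euclidean[of ?c 0] nz unfolding T by simp
      show "(\<integral>\<^sup>+x. f x \<partial>lborel) = ennreal \<bar>det A\<bar> * (\<integral>\<^sup>+x. f (A *v x) \<partial>lborel)"
        by (subst L) (simp add: nn_integral_density nn_integral_distr nn_integral_cmult)
    qed
  next
    case (4 m n)
    let ?p = "Transposition.transpose m n"
    let ?S = "\<chi> i j. mat 1 $ i $ ?p j :: real^'n^'n"
    have S: "?S *v x = (\<chi> i. x $ ?p i)" for x
    proof (subst vec_eq_iff, rule allI)
      fix i
      have "(\<Sum>j\<in>UNIV. mat 1 $ i $ ?p j * x $ j) = (\<Sum>j\<in>UNIV. if j = ?p i then x $ j else 0)"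
        by (intro sum.cong) (auto simp: mat_def transpose_eq_iff)
      then show "(?S *v x) $ i = (\<chi> i. x $ ?p i) $ i"
        by (simp add: matrix_vector_mult_def)
    qed
    \<comment> \<open>An involution has determinant of modulus 1; this avoids computing the sign of
      the permutation.\<close>
    have "?S ** ?S = mat 1"
      by (rule matrix_eq[THEN iffD2]) (simp add: matrix_vector_mul_assoc[symmetric] S vec_eq_iff)
    then have "det ?S * det ?S = 1"
      by (metis det_I det_mul)
    then have det: "\<bar>det ?S\<bar> = 1"
      unfolding abs_square_eq_1[symmetric] power2_eq_square .
    have L: "lborel = distr lborel borel ((*v) ?S)"
    proof (rule lborel_eqI)
      fix l u :: "real^'n" assume le: "\<And>b. b \<in> Basis \<Longrightarrow> l \<bullet> b \<le> u \<bullet> b"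
      have le': "l $ i \<le> u $ i" for i
        using le[of "axis i 1"] by (auto simp: Basis_cart inner_axis)
      have "(*v) ?S -` box l u = box (\<chi> i. l $ ?p i) (\<chi> i. u $ ?p i)"
        unfolding S by (auto simp: mem_box_cart) (metis transpose_involutory)+
      then have "emeasure (distr lborel borel ((*v) ?S)) (box l u) = emeasure lborel (box (\<chi> i. l $ ?p i) (\<chi> i. u $ ?p i))"
        by (subst emeasure_distr) auto
      also have "\<dots> = (\<Prod>i\<in>UNIV. (u - l) $ ?p i)"
        using le' by (subst emeasure_lborel_box) (auto simp: Basis_cart inner_axis prod_Basis_cart[unfolded Basis_cart])
      also have "\<dots> = (\<Prod>i\<in>UNIV. (u - l) $ i)"
        by (subst prod.reindex_bij_betw[of ?p UNIV UNIV]) auto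
      also have "\<dots> = (\<Prod>b\<in>Basis. (u - l) \<bullet> b)"
        by (simp add: prod_Basis_cart inner_axis)
      finally show "emeasure (distr lborel borel ((*v) ?S)) (box l u) = (\<Prod>b\<in>Basis. (u - l) \<bullet> b)" .
    qed simp
    have "(\<integral>\<^sup>+x. f (?S *v x) \<partial>lborel) = (\<integral>\<^sup>+x. f x \<partial>lborel)" if "f \<in> borel_measurable borel" for f
    proof -
      have "(\<integral>\<^sup>+x. f x \<partial>lborel) = (\<integral>\<^sup>+x. f x \<partial>distr lborel borel ((*v) ?S))"
        by (rule arg_cong2[where f = nn_integral, OF L refl])
      also have "\<dots> = (\<integral>\<^sup>+x. f (?S *v x) \<partial>lborel)"
        by (rule nn_integral_distr) (use that in measurable)
      finally show ?thesis ..
    qed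
    then show ?case
      unfolding P_def det by simp
  next
    case (5 m n c)
    let ?S = "\<chi> i j. if i = m \<and> j = n then c else of_bool (i = j) :: real^'n^'n"
    \<comment> \<open>A shear along \<open>axis m 1\<close>: the coordinate \<open>n\<close> is
      constant in that direction because \<open>m\<close> and \<open>n\<close> differ.\<close>
    have S: "?S *v x = x + (c * x $ n) *\<^sub>R axis m 1" for x
    proof (subst vec_eq_iff, rule allI)
      fix i
      have "(\<Sum>j\<in>UNIV. (if i = m \<and> j = n then c else of_bool (i = j)) * x $ j)
          = (\<Sum>j\<in>UNIV. (if i = j then x $ j else 0) + (if j = n then (if i = m then c * x $ j else 0) else 0))"
        using 5 by (intro sum.cong) auto
      then show "(?S *v x) $ i = (x + (c * x $ n) *\<^sub>R axis m 1) $ i"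
        by (simp add: matrix_vector_mult_def sum.distrib axis_def)
    qed
    have "?S = (\<chi> k. if k = m then row m (mat 1) + c *s row n (mat 1) else row k (mat 1))"
      using 5 by (auto simp: vec_eq_iff row_def mat_def)
    then have det: "det ?S = 1"
      using det_row_operation[OF 5, of "mat 1" c] by simp
    have "(\<integral>\<^sup>+x. f (?S *v x) \<partial>lborel) = (\<integral>\<^sup>+x. f x \<partial>lborel)" if "f \<in> borel_measurable borel" for f
      unfolding S using 5
      by (intro nn_integral_shear that) (auto simp: axis_def)
    then show ?case
      unfolding P_def det by simp
  qed
  with assms show ?thesis unfolding P_def by blast
qed

lemma lborel_matrix:
  fixes A :: "real^'n^'n"
  assumes "det A \<noteq> 0"
  shows "lborel = density (distr lborel borel ((*v) A)) (\<lambda>_. ennreal \<bar>det A\<bar>)"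
proof (rule measure_eqI)
  fix X :: "(real^'n) set" assume X: "X \<in> sets lborel"
  then have [measurable]: "X \<in> sets borel" by simp
  show "emeasure lborel X = emeasure (density (distr lborel borel ((*v) A)) (\<lambda>_. ennreal \<bar>det A\<bar>)) X"
    using nn_integral_matrix[of "indicator X" A] assms nn_integral_indicator[OF X]
    by (simp add: emeasure_density nn_integral_distr nn_integral_cmult del: nn_integral_indicator)
qed simp

lemma
  fixes A :: "real^'n^'n" and f :: "real^'n \<Rightarrow> 'b::{banach, second_countable_topology}"
  assumes [measurable]: "f \<in> borel_measurable borel" and A: "det A \<noteq> 0"
  shows integral_matrix: "(LINT x|lborel. f x) = \<bar>det A\<bar> *\<^sub>R (LINT x|lborel. f (A *v x))"
  by (subst lborel_matrix[OF A]) (simp add: integral_density integral_distr)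

section \<open>The Fourier transform\<close>

definition fourier :: "('a::euclidean_space \<Rightarrow> complex) \<Rightarrow> 'a \<Rightarrow> complex" where
  "fourier f \<xi> = (LINT x|lborel. f x * cis (- 2 * pi * (\<xi> \<bullet> x)))"

definition gauss :: "'a::euclidean_space \<Rightarrow> complex" where
  "gauss x = complex_of_real (exp (- pi * (norm x)\<^sup>2))"

lemma continuous_on_cis' [continuous_intros]: "continuous_on A f \<Longrightarrow> continuous_on A (\<lambda>x. cis (f x))"
  unfolding cis_conv_exp by (intro continuous_intros)

lemma measurable_cis [measurable]: "cis \<in> borel_measurable borel"
  by (intro borel_measurable_continuous_onI continuous_intros)

lemma measurable_cnj [measurable]: "cnj \<in> borel_measurable borel"
  by (intro borel_measurable_continuous_onI continuous_intros)

lemma continuous_on_gauss: "continuous_on A gauss"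
  unfolding gauss_def by (intro continuous_intros)

lemma tendsto_gauss: "(f \<longlongrightarrow> l) F \<Longrightarrow> ((\<lambda>x. gauss (f x)) \<longlongrightarrow> gauss l) F"
  unfolding gauss_def by (intro tendsto_intros)

lemma measurable_gauss [measurable]: "gauss \<in> borel_measurable borel"
  by (intro borel_measurable_continuous_onI continuous_on_gauss)

lemma cis_sum: "cis (\<Sum>i\<in>I. f i) = (\<Prod>i\<in>I. cis (f i))"
  by (induction I rule: infinite_finite_induct) (auto simp: cis_mult[symmetric])

lemma gauss_prod: "gauss x = (\<Prod>b\<in>Basis. gauss (x \<bullet> b))"
proof -
  have "(norm x)\<^sup>2 = (\<Sum>b\<in>Basis. (norm (x \<bullet> b))\<^sup>2)"
    unfolding power2_norm_eq_inner by (subst euclidean_inner) (simp add: power2_eq_square)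
  then show ?thesis
    by (simp add: gauss_def exp_sum[symmetric] sum_distrib_left of_real_prod[symmetric] del: of_real_prod)
qed

lemma
  fixes \<xi> :: real
  shows integrable_gauss_real: "integrable lborel (\<lambda>x::real. gauss x * cis (- 2 * pi * (\<xi> \<bullet> x)))"
    and integral_gauss_real: "(LINT x|lborel. gauss (x::real) * cis (- 2 * pi * (\<xi> \<bullet> x))) = gauss \<xi>"
proof -
  \<comment> \<open>Scaling by \<open>s\<close> turns \<open>exp (- x\<^sup>2 / 2)\<close> into
    \<open>exp (- pi * x\<^sup>2)\<close>, and the factor \<open>s\<close> from the substitution
    cancels the normalization of the normal density. The integral is then a value of its
    characteristic function.\<close>
  define s where "s = sqrt (2 * pi)"
  have s: "s > 0" "s\<^sup>2 = 2 * pi" by (auto simp: s_def)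
  let ?F = "\<lambda>x. std_normal_density x *\<^sub>R iexp ((- s * \<xi>) * x)"
  have F: "integrable lborel ?F"
    by (rule Bochner_Integration.integrable_bound[of _ std_normal_density]) auto
  have e: "s *\<^sub>R ?F (0 + s *\<^sub>R x) = gauss x * cis (- 2 * pi * (\<xi> \<bullet> x))" for x
  proof -
    have "std_normal_density (s * x) = 1 / s * exp (- pi * x\<^sup>2)"
      by (simp add: std_normal_density_def power_mult_distrib s s_def[symmetric])
    moreover have "iexp ((- s * \<xi>) * (s * x)) = cis (- 2 * pi * (\<xi> \<bullet> x))"
    proof -
      have "(- s * \<xi>) * (s * x) = - s\<^sup>2 * (\<xi> * x)" by (simp add: power2_eq_square)
      also have "\<dots> = - 2 * pi * (\<xi> \<bullet> x)" by (simp add: s)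
      finally show ?thesis unfolding cis_conv_exp by (simp only:)
    qed
    ultimately show ?thesis
      using s by (simp add: gauss_def scaleR_conv_of_real)
  qed
  have "integrable lborel (\<lambda>x. s *\<^sub>R ?F (0 + s *\<^sub>R x))"
    using integrable_lborel_affine[of ?F s 0] F s by (intro integrable_scaleR_right) auto
  then show "integrable lborel (\<lambda>x::real. gauss x * cis (- 2 * pi * (\<xi> \<bullet> x)))"
    unfolding e .
  have "(LINT x|lborel. gauss (x::real) * cis (- 2 * pi * (\<xi> \<bullet> x))) = s *\<^sub>R (LINT x|lborel. ?F (0 + s *\<^sub>R x))"
    unfolding e[symmetric] by (rule integral_scaleR_right)
  also have "\<dots> = (LINT x|lborel. ?F x)"
    using s by (subst integral_lborel_affine) auto
  also have "\<dots> = char std_normal_distribution (- s * \<xi>)"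
    unfolding char_def by (subst integral_density) (auto simp: normal_density_nonneg)
  also have "\<dots> = gauss \<xi>"
    using s by (simp add: char_std_normal_distribution gauss_def power_mult_distrib)
  finally show "(LINT x|lborel. gauss (x::real) * cis (- 2 * pi * (\<xi> \<bullet> x))) = gauss \<xi>" .
qed

text \<open>The constants in \<open>gauss\<close> and in the characters are matched so that the
  Gaussian is its own transform. Both factor over the coordinates, which reduces the claim to one
  variable.\<close>

lemma
  fixes \<xi> :: "'a::euclidean_space"
  shows integrable_gauss_cis: "integrable lborel (\<lambda>x. gauss x * cis (- 2 * pi * (\<xi> \<bullet> x)))"
    and fourier_gauss: "fourier gauss \<xi> = gauss \<xi>"
proof -
  have e: "gauss x * cis (- 2 * pi * (\<xi> \<bullet> x))
      = (\<Prod>b\<in>Basis. gauss (x \<bullet> b) * cis (- 2 * pi * ((\<xi> \<bullet> b) \<bullet> (x \<bullet> b))))" for x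
    by (subst gauss_prod, subst euclidean_inner)
      (simp only: sum_distrib_left cis_sum prod.distrib inner_real_def)
  show "integrable lborel (\<lambda>x. gauss x * cis (- 2 * pi * (\<xi> \<bullet> x)))"
    unfolding e by (intro integrable_lborel_prod_Basis integrable_gauss_real)
  show "fourier gauss \<xi> = gauss \<xi>"
    unfolding fourier_def e
    by (subst integral_lborel_prod_Basis[OF integrable_gauss_real])
      (simp only: integral_gauss_real gauss_prod[symmetric])
qed

lemma integrable_gauss: "integrable lborel gauss"
  using integrable_gauss_cis[of 0] by simp

lemma integral_gauss: "(LINT x|lborel. gauss x) = 1"
  using fourier_gauss[of 0] by (simp add: fourier_def gauss_def)

lemma gauss_bounded: "norm (gauss x) \<le> 1"
  by (simp add: gauss_def)

lemma integrable_pair_mult: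
  fixes f :: "'a::euclidean_space \<Rightarrow> complex" and g :: "'b::euclidean_space \<Rightarrow> complex"
  assumes f: "integrable lborel f" and g: "integrable lborel g"
  shows "integrable (lborel \<Otimes>\<^sub>M lborel) (\<lambda>(x, y). f x * g y)"
proof (rule lborel_pair.Fubini_integrable)
  have [measurable]: "f \<in> borel_measurable borel" "g \<in> borel_measurable borel"
    using f g by auto
  show "(\<lambda>(x, y). f x * g y) \<in> borel_measurable (lborel \<Otimes>\<^sub>M lborel)" by measurable
  have "(LINT y|lborel. norm (f x * g y)) = norm (f x) * (LINT y|lborel. norm (g y))" for x
    by (simp add: norm_mult)
  then show "integrable lborel (\<lambda>x. LINT y|lborel. norm (case (x, y) of (x, y) \<Rightarrow> f x * g y))"
    using f by simp
qed (use g in auto)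

text \<open>Justifies the exchanges of integrals below, where \<open>h\<close> is a character or a
  Gaussian and so bounded by 1.\<close>

lemma integrable_pair_mult_bounded:
  fixes f :: "'a::euclidean_space \<Rightarrow> complex" and g :: "'b::euclidean_space \<Rightarrow> complex"
  assumes f: "integrable lborel f" and g: "integrable lborel g"
    and [measurable]: "h \<in> borel_measurable (borel \<Otimes>\<^sub>M borel)" and h: "\<And>p. norm (h p) \<le> B"
  shows "integrable (lborel \<Otimes>\<^sub>M lborel) (\<lambda>(x, y). f x * g y * h (x, y) :: complex)"
proof (rule Bochner_Integration.integrable_bound)
  show "integrable (lborel \<Otimes>\<^sub>M lborel) (\<lambda>p. B *\<^sub>R (case p of (x, y) \<Rightarrow> f x * g y))"
    by (intro integrable_scaleR_right integrable_pair_mult f g)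
  have [measurable]: "f \<in> borel_measurable borel" "g \<in> borel_measurable borel"
    using f g by auto
  show "(\<lambda>(x, y). f x * g y * h (x, y)) \<in> borel_measurable (lborel \<Otimes>\<^sub>M lborel)"
    by measurable
  have "norm (f x * g y * h (x, y)) \<le> norm (B *\<^sub>R (f x * g y))" for x y
  proof -
    have "0 \<le> B" using h[of undefined] norm_ge_zero order_trans by blast
    then show ?thesis
      using mult_left_mono[OF h[of "(x, y)"], of "norm (f x * g y)"] by (simp add: norm_mult mult_ac)
  qed
  then show "AE p in lborel \<Otimes>\<^sub>M lborel. norm (case p of (x, y) \<Rightarrow> f x * g y * h (x, y))
      \<le> norm (B *\<^sub>R (case p of (x, y) \<Rightarrow> f x * g y))"
    by (intro always_eventually) auto
qed

lemma norm_fourier_le: "norm (fourier f \<xi>) \<le> (LINT x|lborel. norm (f x))"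
  unfolding fourier_def by (rule order_trans[OF integral_norm_bound]) (simp add: norm_mult)

lemma fourier_gauss_scaled:
  fixes y :: "'a::euclidean_space"
  assumes e: "\<epsilon> > 0"
  shows "integrable lborel (\<lambda>\<xi>::'a. gauss (\<epsilon> *\<^sub>R \<xi>))"
    and "(LINT \<xi>|lborel. gauss (\<epsilon> *\<^sub>R \<xi>) * cis (- 2 * pi * (y \<bullet> \<xi>)))
      = (1 / \<epsilon> ^ DIM('a)) *\<^sub>R gauss (y /\<^sub>R \<epsilon>)"
proof -
  show "integrable lborel (\<lambda>\<xi>::'a. gauss (\<epsilon> *\<^sub>R \<xi>))"
    using integrable_lborel_affine[of "gauss :: 'a \<Rightarrow> complex" \<epsilon> 0] e integrable_gauss by simp
  have "(LINT \<xi>|lborel. gauss (\<epsilon> *\<^sub>R \<xi>) * cis (- 2 * pi * (y \<bullet> \<xi>)))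
      = (LINT \<xi>|lborel. gauss (0 + \<epsilon> *\<^sub>R \<xi>) * cis (- 2 * pi * ((y /\<^sub>R \<epsilon>) \<bullet> (0 + \<epsilon> *\<^sub>R \<xi>))))"
  proof -
    have "(y /\<^sub>R \<epsilon>) \<bullet> (0 + \<epsilon> *\<^sub>R \<xi>) = y \<bullet> \<xi>" for \<xi>
      using e by (simp add: field_simps)
    then show ?thesis by (simp only: add_0_left)
  qed
  also have "\<dots> = (1 / \<bar>\<epsilon>\<bar> ^ DIM('a)) *\<^sub>R fourier gauss (y /\<^sub>R \<epsilon>)"
    unfolding fourier_def
    by (rule integral_lborel_affine[of "\<lambda>\<xi>. gauss \<xi> * cis (- 2 * pi * ((y /\<^sub>R \<epsilon>) \<bullet> \<xi>))"]) (use e in auto)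
  finally show "(LINT \<xi>|lborel. gauss (\<epsilon> *\<^sub>R \<xi>) * cis (- 2 * pi * (y \<bullet> \<xi>)))
      = (1 / \<epsilon> ^ DIM('a)) *\<^sub>R gauss (y /\<^sub>R \<epsilon>)"
    using e by (simp add: fourier_gauss)
qed

section \<open>Gaussian regularization, inversion and Parseval's identity\<close>

text \<open>The Gaussian factor makes the double integral absolutely convergent, so the integral
  over \<open>\<xi>\<close> may be taken first. It yields a Gaussian of width
  \<open>\<epsilon>\<close> centred at \<open>x\<close>, that is, an average of \<open>f\<close>
  near \<open>x\<close>. Inversion and injectivity both start from this identity.\<close>

lemma fourier_gauss_regularized:
  fixes f :: "'a::euclidean_space \<Rightarrow> complex"
  assumes f: "integrable lborel f" and e: "\<epsilon> > 0"
  shows "(LINT \<xi>|lborel. fourier f \<xi> * cis (2 * pi * (\<xi> \<bullet> x)) * gauss (\<epsilon> *\<^sub>R \<xi>))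
    = (LINT u|lborel. f (x + \<epsilon> *\<^sub>R u) * gauss u)"
proof -
  have [measurable]: "f \<in> borel_measurable borel" using f by auto
  let ?H = "\<lambda>\<xi> y. f y * cis (- 2 * pi * ((y - x) \<bullet> \<xi>)) * gauss (\<epsilon> *\<^sub>R \<xi>)"
  have cis: "cis (- 2 * pi * (\<xi> \<bullet> y)) * cis (2 * pi * (\<xi> \<bullet> x)) = cis (- 2 * pi * ((y - x) \<bullet> \<xi>))" for y \<xi>
    by (simp add: cis_mult inner_diff_left inner_commute algebra_simps)
  have I: "integrable (lborel \<Otimes>\<^sub>M lborel) (\<lambda>(\<xi>, y). ?H \<xi> y)"
    using integrable_pair_mult_bounded[OF fourier_gauss_scaled(1)[OF e] f, of "\<lambda>(\<xi>, y). cis (- 2 * pi * ((y - x) \<bullet> \<xi>))" 1]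
    by (simp add: mult_ac case_prod_unfold)
  have "(LINT \<xi>|lborel. fourier f \<xi> * cis (2 * pi * (\<xi> \<bullet> x)) * gauss (\<epsilon> *\<^sub>R \<xi>))
      = (LINT \<xi>|lborel. LINT y|lborel. ?H \<xi> y)"
    unfolding fourier_def integral_mult_left_zero[symmetric] by (simp only: mult.assoc[of "f _"] cis)
  also have "\<dots> = (LINT y|lborel. LINT \<xi>|lborel. ?H \<xi> y)"
    by (rule lborel_pair.Fubini_integral[symmetric, OF I])
  also have "\<dots> = (LINT y|lborel. (1 / \<epsilon> ^ DIM('a)) *\<^sub>R (f y * gauss ((y - x) /\<^sub>R \<epsilon>)))"
  proof (rule Bochner_Integration.integral_cong[OF refl])
    fix y
    have "(LINT \<xi>|lborel. ?H \<xi> y) = (LINT \<xi>|lborel. f y * (gauss (\<epsilon> *\<^sub>R \<xi>) * cis (- 2 * pi * ((y - x) \<bullet> \<xi>))))"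
      by (simp only: mult_ac)
    also have "\<dots> = f y * (LINT \<xi>|lborel. gauss (\<epsilon> *\<^sub>R \<xi>) * cis (- 2 * pi * ((y - x) \<bullet> \<xi>)))"
      by (rule integral_mult_right_zero)
    also have "\<dots> = (1 / \<epsilon> ^ DIM('a)) *\<^sub>R (f y * gauss ((y - x) /\<^sub>R \<epsilon>))"
      unfolding fourier_gauss_scaled(2)[OF e] by simp
    finally show "(LINT \<xi>|lborel. ?H \<xi> y) = (1 / \<epsilon> ^ DIM('a)) *\<^sub>R (f y * gauss ((y - x) /\<^sub>R \<epsilon>))" .
  qed
  also have "\<dots> = (1 / \<bar>\<epsilon>\<bar> ^ DIM('a)) *\<^sub>R (LINT y|lborel. f y * gauss ((y - x) /\<^sub>R \<epsilon>))"
    using e by simp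
  also have "\<dots> = (LINT u|lborel. f (x + \<epsilon> *\<^sub>R u) * gauss ((x + \<epsilon> *\<^sub>R u - x) /\<^sub>R \<epsilon>))"
    by (rule integral_lborel_affine[symmetric]) (use e in auto)
  also have "\<dots> = (LINT u|lborel. f (x + \<epsilon> *\<^sub>R u) * gauss u)"
    using e by simp
  finally show ?thesis .
qed

lemma LIMSEQ_inverse_Suc_scaleR:
  fixes u :: "'a::real_normed_vector"
  shows "(\<lambda>n. (1 / real (Suc n)) *\<^sub>R u) \<longlonglongrightarrow> 0"
proof -
  have "(\<lambda>n. inverse (real (Suc n)) *\<^sub>R u) \<longlonglongrightarrow> 0 *\<^sub>R u"
    by (intro tendsto_scaleR LIMSEQ_inverse_real_of_nat tendsto_const)
  then show ?thesis by (simp add: inverse_eq_divide)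
qed

text \<open>The regularized identity is used with \<open>\<epsilon> = 1 / (n + 1)\<close>: the side
  with \<open>f\<close> converges by continuity and the bound \<open>B\<close>, the side with
  \<open>fourier f\<close> by integrability of the transform.\<close>

lemma fourier_inversion:
  fixes f :: "'a::euclidean_space \<Rightarrow> complex"
  assumes f: "integrable lborel f" and cont: "continuous_on UNIV f" and bdd: "\<And>x. norm (f x) \<le> B"
    and ff: "integrable lborel (fourier f)"
  shows "f x = (LINT \<xi>|lborel. fourier f \<xi> * cis (2 * pi * (\<xi> \<bullet> x)))"
proof -
  let ?e = "\<lambda>n. 1 / real (Suc n)"
  have [measurable]: "f \<in> borel_measurable borel" using f by auto
  have "(\<lambda>n. LINT u|lborel. f (x + ?e n *\<^sub>R u) * gauss u) \<longlonglongrightarrow> (LINT u|lborel. f x * gauss (u::'a))"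
  proof (rule integral_dominated_convergence[where w = "\<lambda>u. B * norm (gauss u)"])
    show "integrable lborel (\<lambda>u::'a. B * norm (gauss u))"
      by (intro integrable_mult_right integrable_norm integrable_gauss)
    have "(\<lambda>n. f (x + ?e n *\<^sub>R u) * gauss u) \<longlonglongrightarrow> f (x + 0) * gauss u" for u
      by (intro tendsto_intros continuous_on_tendsto_compose[OF cont] LIMSEQ_inverse_Suc_scaleR) auto
    then show "AE u in lborel. (\<lambda>n. f (x + ?e n *\<^sub>R u) * gauss u) \<longlonglongrightarrow> f x * gauss u"
      by simp
  qed (auto simp: norm_mult intro!: mult_right_mono bdd)
  then have 1: "(\<lambda>n. LINT u|lborel. f (x + ?e n *\<^sub>R u) * gauss u) \<longlonglongrightarrow> f x"
    by (simp add: integral_gauss)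
  have "(\<lambda>n. LINT \<xi>|lborel. fourier f \<xi> * cis (2 * pi * (\<xi> \<bullet> x)) * gauss (?e n *\<^sub>R \<xi>))
      \<longlonglongrightarrow> (LINT \<xi>|lborel. fourier f \<xi> * cis (2 * pi * (\<xi> \<bullet> x)) * gauss (0::'a))"
  proof (rule integral_dominated_convergence[where w = "\<lambda>\<xi>. norm (fourier f \<xi>)"])
    show "AE \<xi> in lborel. (\<lambda>n. fourier f \<xi> * cis (2 * pi * (\<xi> \<bullet> x)) * gauss (?e n *\<^sub>R \<xi>))
        \<longlonglongrightarrow> fourier f \<xi> * cis (2 * pi * (\<xi> \<bullet> x)) * gauss (0::'a)"
      by (intro AE_I2 tendsto_mult tendsto_const tendsto_gauss LIMSEQ_inverse_Suc_scaleR)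
    show "AE \<xi> in lborel. norm (fourier f \<xi> * cis (2 * pi * (\<xi> \<bullet> x)) * gauss (?e n *\<^sub>R \<xi>)) \<le> norm (fourier f \<xi>)" for n
      by (auto simp: norm_mult intro!: mult_left_le gauss_bounded)
  qed (use ff in auto)
  then have 2: "(\<lambda>n. LINT u|lborel. f (x + ?e n *\<^sub>R u) * gauss u)
      \<longlonglongrightarrow> (LINT \<xi>|lborel. fourier f \<xi> * cis (2 * pi * (\<xi> \<bullet> x)))"
    by (simp only: fourier_gauss_regularized[OF f] of_nat_0_less_iff zero_less_Suc zero_less_divide_1_iff)
      (simp add: gauss_def)
  show ?thesis
    by (rule LIMSEQ_unique[OF 1 2])
qed

text \<open>Inversion for \<open>f\<close> and one exchange of integrals. The roles are asymmetric
  on purpose: \<open>g\<close> may be any integrable function, such as the modulated slice in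
  \<open>correlation_partial_fourier2\<close>.\<close>

lemma fourier_parseval:
  fixes f g :: "'a::euclidean_space \<Rightarrow> complex"
  assumes f: "integrable lborel f" and cont: "continuous_on UNIV f" and bdd: "\<And>x. norm (f x) \<le> B"
    and ff: "integrable lborel (fourier f)" and g: "integrable lborel g"
  shows "(LINT \<xi>|lborel. fourier f \<xi> * cnj (fourier g \<xi>)) = (LINT x|lborel. f x * cnj (g x))"
proof -
  let ?H = "\<lambda>\<xi> x. fourier f \<xi> * cnj (g x) * cis (2 * pi * (\<xi> \<bullet> x))"
  have I: "integrable (lborel \<Otimes>\<^sub>M lborel) (\<lambda>(\<xi>, x). ?H \<xi> x)"
    using integrable_pair_mult_bounded[of "fourier f" "\<lambda>x. cnj (g x)" "\<lambda>(\<xi>, x). cis (2 * pi * (\<xi> \<bullet> x))" 1] ff g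
    by (simp add: case_prod_unfold)
  have "(LINT \<xi>|lborel. fourier f \<xi> * cnj (fourier g \<xi>)) = (LINT \<xi>|lborel. LINT x|lborel. ?H \<xi> x)"
  proof (rule Bochner_Integration.integral_cong[OF refl])
    fix \<xi>
    have "cnj (fourier g \<xi>) = (LINT x|lborel. cnj (g x) * cis (2 * pi * (\<xi> \<bullet> x)))"
    proof -
      have "cnj (fourier g \<xi>) = (LINT x|lborel. cnj (g x * cis (- 2 * pi * (\<xi> \<bullet> x))))"
        unfolding fourier_def by (rule Bochner_Integration.integral_cnj[symmetric])
      then show ?thesis by (simp add: cis_cnj)
    qed
    then show "fourier f \<xi> * cnj (fourier g \<xi>) = (LINT x|lborel. ?H \<xi> x)"
      by (simp add: mult.assoc)
  qed
  also have "\<dots> = (LINT x|lborel. LINT \<xi>|lborel. ?H \<xi> x)"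
    by (rule lborel_pair.Fubini_integral[symmetric, OF I])
  also have "\<dots> = (LINT x|lborel. f x * cnj (g x))"
  proof (rule Bochner_Integration.integral_cong[OF refl])
    fix x
    have "(LINT \<xi>|lborel. ?H \<xi> x) = (LINT \<xi>|lborel. cnj (g x) * (fourier f \<xi> * cis (2 * pi * (\<xi> \<bullet> x))))"
      by (simp only: mult_ac)
    then show "(LINT \<xi>|lborel. ?H \<xi> x) = f x * cnj (g x)"
      using fourier_inversion[OF f cont bdd ff, of x] by simp
  qed
  finally show ?thesis .
qed

section \<open>Injectivity of the Fourier transform on integrable functions\<close>

text \<open>Since \<open>ennreal\<close> cuts off at 0, the densities built from \<open>h\<close>
  and \<open>- h\<close> are the positive and the negative part of \<open>h\<close>. They agree on
  boxes, an intersection-stable generator, hence as measures; and the two parts of a number are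
  equal only if the number is 0.\<close>

lemma AE_zero_if_box_integrals_zero:
  fixes h :: "'a::euclidean_space \<Rightarrow> real"
  assumes h: "integrable lborel h" and zero: "\<And>l u. (LINT x|lborel. h x * indicator (box l u) x) = 0"
  shows "AE x in lborel. h x = 0"
proof -
  have [measurable]: "h \<in> borel_measurable borel" using h by auto
  let ?D = "\<lambda>h. density lborel (\<lambda>x. ennreal (h x))"
  have fin: "emeasure (?D h) X \<noteq> \<infinity>" if "integrable lborel h" "X \<in> sets borel" for X and h :: "'a \<Rightarrow> real"
  proof -
    have "emeasure (?D h) X = (\<integral>\<^sup>+x. ennreal (h x) * indicator X x \<partial>lborel)"
      using that by (intro emeasure_density) auto
    also have "\<dots> \<le> (\<integral>\<^sup>+x. ennreal (norm (h x)) \<partial>lborel)"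
      by (intro nn_integral_mono) (auto simp: indicator_def intro!: ennreal_leI)
    also have "\<dots> < \<infinity>"
      using that(1) by (simp add: integrable_iff_bounded)
    finally show ?thesis by simp
  qed
  have "?D h = ?D (\<lambda>x. - h x)"
  proof (rule measure_eqI_generator_eq)
    let ?E = "range (\<lambda>(a, b). box a b::'a set)"
    show "Int_stable ?E"
      by (auto simp: Int_stable_def box_Int_box)
    show "?E \<subseteq> Pow UNIV" "sets (?D h) = sigma_sets UNIV ?E" "sets (?D (\<lambda>x. - h x)) = sigma_sets UNIV ?E"
      by (simp_all add: borel_eq_box)
    let ?A = "\<lambda>n::nat. box (- (real n *\<^sub>R One)) (real n *\<^sub>R One) :: 'a set"
    show "range ?A \<subseteq> ?E" "(\<Union>i. ?A i) = UNIV"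
      unfolding UN_box_eq_UNIV by auto
    show "emeasure (?D h) (?A i) \<noteq> \<infinity>" for i
      by (intro fin h) auto
    show "emeasure (?D h) X = emeasure (?D (\<lambda>x. - h x)) X" if X_E: "X \<in> ?E" for X
    proof -
      obtain l u where X: "X = box l u" using X_E by auto
      \<comment> \<open>\<open>enn2real\<close> also sends infinity to 0, hence the finiteness
        conditions.\<close>
      have ee: "p = q" if "enn2real p = enn2real q" "p \<noteq> \<infinity>" "q \<noteq> \<infinity>" for p q
        using that by (cases p; cases q) auto
      let ?k = "\<lambda>x. h x * indicator X x"
      have k: "integrable lborel ?k"
        using integrable_mult_indicator[of X lborel h] h unfolding X by (simp add: mult.commute)
      have e: "emeasure (?D g) X = (\<integral>\<^sup>+x. ennreal (g x * indicator X x) \<partial>lborel)" if [measurable]: "g \<in> borel_measurable borel" for g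
        unfolding X by (subst emeasure_density) (auto simp: indicator_def intro!: nn_integral_cong)
      have "enn2real (\<integral>\<^sup>+x. ennreal (?k x) \<partial>lborel) = enn2real (\<integral>\<^sup>+x. ennreal (- ?k x) \<partial>lborel)"
        using zero[of l u] real_lebesgue_integral_def[OF k] by (simp add: X)
      moreover have "emeasure (?D h) X \<noteq> \<infinity>" "emeasure (?D (\<lambda>x. - h x)) X \<noteq> \<infinity>"
        using fin[OF h, of X] fin[of "\<lambda>x. - h x" X] h by (auto simp: X)
      ultimately show ?thesis
        using e[of h] e[of "\<lambda>x. - h x"] by (intro ee) auto
    qed
  qed
  then have "AE x in lborel. ennreal (h x) = ennreal (- h x)"
    using h by (subst (asm) finite_density_unique) (auto simp: real_integrable_def)
  then show ?thesis
  proof eventually_elim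
    case (elim x)
    then show ?case
      using ennreal_eq_0_iff[of "h x"] ennreal_eq_0_iff[of "- h x"] by (cases "h x \<le> 0") auto
  qed
qed

text \<open>The Gaussian regularization of \<open>h\<close> vanishes, hence so do the integrals of \<open>h\<close> against
  continuous functions of bounded support, and these approximate indicators of boxes.\<close>

theorem fourier_injective:
  fixes h :: "'a::euclidean_space \<Rightarrow> complex"
  assumes h: "integrable lborel h" and zero: "\<And>\<xi>. fourier h \<xi> = 0"
  shows "AE x in lborel. h x = 0"
proof -
  let ?e = "\<lambda>n. 1 / real (Suc n)"
  have [measurable]: "h \<in> borel_measurable borel" using h by auto
  have w0: "(LINT y|lborel. h y * w y) = 0"
    if w: "integrable lborel w" "continuous_on UNIV w" and B: "\<And>x. norm (w x) \<le> B" for w :: "'a \<Rightarrow> complex" and B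
  proof -
    have [measurable]: "w \<in> borel_measurable borel" using w by auto
    have reg0: "(LINT y|lborel. h y * gauss ((y - x) /\<^sub>R \<epsilon>)) = 0" if "\<epsilon> > 0" for \<epsilon> x
    proof -
      have "(LINT u|lborel. h (x + \<epsilon> *\<^sub>R u) * gauss ((x + \<epsilon> *\<^sub>R u - x) /\<^sub>R \<epsilon>)) = 0"
        using fourier_gauss_regularized[OF h that, of x] that by (simp add: zero)
      then show ?thesis
        using that by (subst (asm) integral_lborel_affine) auto
    qed
    \<comment> \<open>Fubini's theorem moves the regularization from \<open>h\<close> to the
      continuous function \<open>w\<close>, whose averages converge pointwise.\<close>
    have z: "(LINT y|lborel. h y * (LINT u|lborel. w (y - \<epsilon> *\<^sub>R u) * gauss u)) = 0" if e: "\<epsilon> > 0" for \<epsilon>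
    proof -
      let ?H = "\<lambda>x y. w x * h y * gauss ((y - x) /\<^sub>R \<epsilon>)"
      have I: "integrable (lborel \<Otimes>\<^sub>M lborel) (\<lambda>(x, y). ?H x y)"
        using integrable_pair_mult_bounded[OF w(1) h, of "\<lambda>(x, y). gauss ((y - x) /\<^sub>R \<epsilon>)" 1]
        by (simp add: case_prod_unfold gauss_bounded)
      have "(LINT u|lborel. w (y - \<epsilon> *\<^sub>R u) * gauss u)
          = (1 / \<epsilon> ^ DIM('a)) *\<^sub>R (LINT x|lborel. w x * gauss ((y - x) /\<^sub>R \<epsilon>))" for y
        using integral_lborel_affine[of "\<lambda>x. w x * gauss ((y - x) /\<^sub>R \<epsilon>)" "- \<epsilon>" y] e by simp
      then have "(LINT y|lborel. h y * (LINT u|lborel. w (y - \<epsilon> *\<^sub>R u) * gauss u))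
          = (1 / \<epsilon> ^ DIM('a)) *\<^sub>R (LINT y|lborel. LINT x|lborel. ?H x y)"
        by (simp add: mult_ac flip: integral_mult_right_zero)
      also have "(LINT y|lborel. LINT x|lborel. ?H x y) = (LINT x|lborel. LINT y|lborel. ?H x y)"
        by (rule lborel_pair.Fubini_integral[OF I])
      also have "\<dots> = (LINT x|(lborel :: 'a measure). 0)"
        by (intro Bochner_Integration.integral_cong refl) (simp add: mult.assoc reg0 e)
      finally show ?thesis by simp
    qed
    have lim: "(\<lambda>n. LINT u|lborel. w (y - ?e n *\<^sub>R u) * gauss u) \<longlonglongrightarrow> (LINT u|lborel. w y * gauss (u::'a))" for y
    proof (rule integral_dominated_convergence[where w = "\<lambda>u. B * norm (gauss u)"])
      show "integrable lborel (\<lambda>u::'a. B * norm (gauss u))"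
        by (intro integrable_mult_right integrable_norm integrable_gauss)
      have "(\<lambda>n. w (y - ?e n *\<^sub>R u) * gauss u) \<longlonglongrightarrow> w (y - 0) * gauss u" for u
        by (intro tendsto_intros continuous_on_tendsto_compose[OF w(2)] LIMSEQ_inverse_Suc_scaleR) auto
      then show "AE u in lborel. (\<lambda>n. w (y - ?e n *\<^sub>R u) * gauss u) \<longlonglongrightarrow> w y * gauss u"
        by simp
    qed (auto simp: norm_mult intro!: mult_right_mono B)
    have "(\<lambda>n. LINT y|lborel. h y * (LINT u|lborel. w (y - ?e n *\<^sub>R u) * gauss u)) \<longlonglongrightarrow> (LINT y|lborel. h y * w y)"
    proof (rule integral_dominated_convergence[where w = "\<lambda>y. norm (h y) * (B * (LINT u|lborel. norm (gauss (u::'a))))"])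
      show "AE y in lborel. (\<lambda>n. h y * (LINT u|lborel. w (y - ?e n *\<^sub>R u) * gauss u)) \<longlonglongrightarrow> h y * w y"
        using tendsto_mult_left[OF lim] by (simp add: integral_gauss)
      have "norm (LINT u|lborel. w (y - ?e n *\<^sub>R u) * gauss u) \<le> B * (LINT u|lborel. norm (gauss (u::'a)))" for y n
      proof -
        have "norm (LINT u|lborel. w (y - ?e n *\<^sub>R u) * gauss u) \<le> (LINT u|lborel. B * norm (gauss (u::'a)))"
        proof (rule Bochner_Integration.integral_norm_bound_integral)
          show g: "integrable lborel (\<lambda>u::'a. B * norm (gauss u))"
            by (intro integrable_mult_right integrable_norm integrable_gauss)
          show le: "norm (w (y - ?e n *\<^sub>R u) * gauss u) \<le> B * norm (gauss u)" for u
            by (auto simp: norm_mult intro!: mult_right_mono B)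
          have "AE u in lborel. norm (w (y - ?e n *\<^sub>R u) * gauss u) \<le> norm (B * norm (gauss u))"
            unfolding real_norm_def by (intro AE_I2 order_trans[OF le abs_ge_self])
          then show "integrable lborel (\<lambda>u. w (y - ?e n *\<^sub>R u) * gauss u)"
            by (intro Bochner_Integration.integrable_bound[OF g]) measurable
        qed
        then show ?thesis by simp
      qed
      then show "AE y in lborel. norm (h y * (LINT u|lborel. w (y - ?e n *\<^sub>R u) * gauss u))
          \<le> norm (h y) * (B * (LINT u|lborel. norm (gauss (u::'a))))" for n
        by (auto simp: norm_mult intro!: mult_left_mono)
    qed (use h in auto)
    then show ?thesis
      using z[of "?e _"] by (simp add: LIMSEQ_const_iff)
  qed
  have box0: "(LINT x|lborel. h x * indicator (box l u) x) = 0" for l u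
  proof (cases "box l u = {}")
    case False
    \<comment> \<open>Zero outside the open box, and 1 as soon as \<open>n\<close> times the
      distance to its complement reaches 1.\<close>
    define w where "w n y = complex_of_real (min 1 (real n * infdist y (- box l u)))" for n y
    \<comment> \<open>The distance to the empty set is 0 by convention, so the complement must be
      known to be nonempty.\<close>
    have ne: "- box l u \<noteq> {}"
      using bounded_box[of l u] not_bounded_UNIV by (metis double_compl Compl_empty_eq)
    have w_le: "norm (w n y) \<le> indicator (box l u) y" for n y
      using infdist_nonneg[of y "- box l u"] by (auto simp: w_def indicator_def)
    have cont: "continuous_on UNIV (w n)" for n
      unfolding w_def by (intro continuous_intros)
    then have [measurable]: "w n \<in> borel_measurable borel" for n
      by (rule borel_measurable_continuous_onI)
    have int: "integrable lborel (w n)" for n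
      by (rule Bochner_Integration.integrable_bound[of _ "indicator (box l u) :: 'a \<Rightarrow> real"])
        (use w_le emeasure_lborel_box_finite[of l u] in auto)
    have lim: "(\<lambda>n. w n y) \<longlonglongrightarrow> indicator (box l u) y" for y
    proof (cases "y \<in> box l u")
      case True
      have d: "infdist y (- box l u) > 0"
        using True ne by (intro infdist_pos_not_in_closed) (auto simp: open_closed[symmetric] open_box)
      obtain N where N: "1 < real N * infdist y (- box l u)"
        using reals_Archimedean3[OF d] by blast
      have "w n y = 1" if "n \<ge> N" for n
      proof -
        have "real N * infdist y (- box l u) \<le> real n * infdist y (- box l u)"
          using that d by (intro mult_right_mono) auto
        with N show ?thesis by (simp add: w_def)
      qed
      then show ?thesis
        using True by (intro tendsto_eventually eventually_sequentiallyI[of N]) auto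
    qed (simp add: w_def)
    have "(\<lambda>n. LINT y|lborel. h y * w n y) \<longlonglongrightarrow> (LINT y|lborel. h y * indicator (box l u) y)"
    proof (rule integral_dominated_convergence[where w = "\<lambda>y. norm (h y)"])
      show "AE y in lborel. norm (h y * w n y) \<le> norm (h y)" for n
        using w_le[of n] order_trans[OF w_le indicator_le_1]
        by (auto simp: norm_mult intro!: mult_left_le)
    qed (use h lim in \<open>auto intro!: tendsto_intros\<close>)
    moreover have "(LINT y|lborel. h y * w n y) = 0" for n
      by (rule w0[OF int cont, of _ 1]) (rule order_trans[OF w_le indicator_le_1])
    ultimately show ?thesis
      by (simp add: LIMSEQ_const_iff)
  qed simp
  have hi: "integrable lborel (\<lambda>x. h x * indicator (box l u) x)" for l u
    using integrable_mult_indicator[of "box l u" lborel h] h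
    by (simp add: scaleR_conv_of_real mult.commute of_real_indicator)
  have "AE x in lborel. Re (h x) = 0"
  proof (rule AE_zero_if_box_integrals_zero)
    fix l u
    have "Re (h x) * indicator (box l u) x = Re (h x * indicator (box l u) x)" for x
      by (simp add: indicator_def)
    then show "(LINT x|lborel. Re (h x) * indicator (box l u) x) = 0"
      using integral_Re[OF hi[of l u]] box0[of l u] by (simp only: zero_complex.simps)
  qed (use h in simp)
  moreover have "AE x in lborel. Im (h x) = 0"
  proof (rule AE_zero_if_box_integrals_zero)
    fix l u
    have "Im (h x) * indicator (box l u) x = Im (h x * indicator (box l u) x)" for x
      by (simp add: indicator_def)
    then show "(LINT x|lborel. Im (h x) * indicator (box l u) x) = 0"
      using integral_Im[OF hi[of l u]] box0[of l u] by (simp only: zero_complex.simps)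
  qed (use h in simp)
  ultimately show ?thesis
    by eventually_elim (simp add: complex_eq_iff)
qed

section \<open>Continuous operators on the Schwartz space\<close>

lemma schwartz_continuousI':
  fixes P :: "('a::euclidean_space \<Rightarrow> complex) \<Rightarrow> 'b::euclidean_space \<Rightarrow> complex"
  assumes "\<And>f x. f \<in> schwartz \<Longrightarrow> P f differentiable (at x)"
    and deriv: "\<And>b. b \<in> Basis \<Longrightarrow> \<exists>D. schwartz_continuous D \<and> (\<forall>f\<in>schwartz. dir_deriv b (P f) = P (D f))"
    and "\<And>N. \<exists>M C. \<forall>f\<in>schwartz. \<forall>x. (1 + norm x) ^ N * norm (P f x) \<le> C * schwartz_norm M f"
  shows "schwartz_continuous P"
proof (rule schwartz_continuousI[OF assms(1) _ assms(3)])
  fix b :: 'b assume "b \<in> Basis"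
  then obtain D where "schwartz_continuous D" "\<And>f. f \<in> schwartz \<Longrightarrow> dir_deriv b (P f) = P (D f)"
    using deriv by blast
  then show "\<exists>D R. schwartz_continuous D \<and> schwartz_continuous R \<and>
      (\<forall>f\<in>schwartz. dir_deriv b (P f) = (\<lambda>x. P (D f) x + R f x))"
    by (intro exI[of _ D] exI[of _ "\<lambda>f x. 0"]) (auto intro: schwartz_continuous_zero)
qed

text \<open>Submultiplicativity of the weight: a decay estimate at \<open>x\<close> can be split
  between \<open>x + y\<close> and \<open>- y\<close>. The estimates for translations and
  correlations rest on it.\<close>

lemma one_plus_norm_le: "1 + norm (x + y) \<le> (1 + norm x) * (1 + norm (y::'a::real_normed_vector))"
proof -
  have "0 \<le> norm x * norm y" by simp
  with norm_triangle_ineq[of x y] show ?thesis unfolding ring_distribs by linarith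
qed

lemma one_plus_norm_power_le:
  "(1 + norm (x + y)) ^ N \<le> (1 + norm x) ^ N * (1 + norm (y::'a::real_normed_vector)) ^ N"
  unfolding power_mult_distrib[symmetric] by (intro power_mono one_plus_norm_le) auto

lemma weighted_norm_coord_le:
  assumes "b \<in> Basis"
  shows "(1 + norm x) ^ N * norm (complex_of_real (x \<bullet> b) * z) \<le> (1 + norm x) ^ Suc N * norm z"
proof -
  have "\<bar>x \<bullet> b\<bar> \<le> 1 + norm x"
    using Basis_le_norm[OF assms, of x] by simp
  then have "(1 + norm x) ^ N * (\<bar>x \<bullet> b\<bar> * norm z) \<le> (1 + norm x) ^ N * ((1 + norm x) * norm z)"
    by (intro mult_left_mono mult_right_mono) auto
  then show ?thesis by (simp add: norm_mult mult_ac)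
qed

lemma schwartz_continuous_coord:
  fixes b :: "'a::euclidean_space"
  assumes "b \<in> Basis"
  shows "schwartz_continuous (\<lambda>f x. complex_of_real (x \<bullet> b) * f x)"
proof (rule schwartz_continuousI)
  fix f :: "'a \<Rightarrow> complex" and x :: 'a assume f: "f \<in> schwartz"
  note schwartz_has_derivative[OF f, derivative_intros]
  show "(\<lambda>x. complex_of_real (x \<bullet> b) * f x) differentiable at x"
    using schwartz_has_derivative[OF f] unfolding differentiable_def
    by (intro exI) (rule derivative_eq_intros | simp)+
next
  fix c :: 'a assume c: "c \<in> Basis"
  have "dir_deriv c (\<lambda>x. complex_of_real (x \<bullet> b) * f x)
      = (\<lambda>x. complex_of_real (x \<bullet> b) * dir_deriv c f x + complex_of_real (c \<bullet> b) * f x)"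
    if f: "f \<in> schwartz" for f
  proof -
    have "((\<lambda>x. complex_of_real (x \<bullet> b) * f x) has_derivative
        (\<lambda>v. complex_of_real (x \<bullet> b) * frechet_derivative f (at x) v + complex_of_real (v \<bullet> b) * f x)) (at x)" for x
      by (intro has_derivative_mult frechet_derivative_works[THEN iffD1] schwartz_differentiable f
          has_derivative_of_real has_derivative_inner_left has_derivative_ident)
    from dir_deriv_eq[OF this] show ?thesis by (simp add: dir_deriv_def)
  qed
  then show "\<exists>D R. schwartz_continuous D \<and> schwartz_continuous R \<and> (\<forall>f\<in>schwartz.
      dir_deriv c (\<lambda>x. complex_of_real (x \<bullet> b) * f x) = (\<lambda>x. complex_of_real (x \<bullet> b) * D f x + R f x))"
    by (intro exI[of _ "dir_deriv c"] exI[of _ "\<lambda>f x. complex_of_real (c \<bullet> b) * f x"] conjI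
        schwartz_continuous_dir_deriv c schwartz_continuous_cmult schwartz_continuous_id) simp
next
  fix N
  have "(1 + norm x) ^ N * norm (complex_of_real (x \<bullet> b) * f x) \<le> 1 * schwartz_norm (Suc N) f"
    if "f \<in> schwartz" for f x
    using order_trans[OF weighted_norm_coord_le[OF assms] schwartz_norm_bound[OF that]] by simp
  then show "\<exists>M C. \<forall>f\<in>schwartz. \<forall>x. (1 + norm x) ^ N * norm (complex_of_real (x \<bullet> b) * f x) \<le> C * schwartz_norm M f"
    by blast
qed

text \<open>An injective linear map is bounded below, so decay in \<open>L x\<close> is decay in
  \<open>x\<close>; by the chain rule a derivative only replaces \<open>f\<close> by a fixed
  combination of its partial derivatives.\<close>

lemma schwartz_continuous_linear:
  fixes L :: "'a::euclidean_space \<Rightarrow> 'b::euclidean_space"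
  assumes L: "linear L" "inj L"
  shows "schwartz_continuous (\<lambda>f x. f (L x))"
proof (rule schwartz_continuousI')
  have D: "((\<lambda>x. f (L x)) has_derivative (\<lambda>v. \<Sum>b\<in>Basis. (L v \<bullet> b) *\<^sub>R dir_deriv b f (L x))) (at x)"
    if "f \<in> schwartz" for f x
    by (rule has_derivative_compose[OF linear_imp_has_derivative[OF L(1)] schwartz_has_derivative[OF that]])
  show "(\<lambda>x. f (L x)) differentiable at x" if "f \<in> schwartz" for f x
    using D[OF that] unfolding differentiable_def by blast
  show "\<exists>D. schwartz_continuous D \<and> (\<forall>f\<in>schwartz. dir_deriv b (\<lambda>x. f (L x)) = (\<lambda>x. D f (L x)))" for b
    by (intro exI[of _ "\<lambda>f x. \<Sum>c\<in>Basis. complex_of_real (L b \<bullet> c) * dir_deriv c f x"] conjI ballI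
        schwartz_continuous_sum schwartz_continuous_cmult schwartz_continuous_dir_deriv)
      (auto simp: dir_deriv_eq[OF D] scaleR_conv_of_real)
  fix N
  obtain B where B: "B > 0" "\<And>x. B * norm x \<le> norm (L x)"
    using linear_inj_bounded_below_pos[OF L] by blast
  \<comment> \<open>\<open>norm x\<close> is at most \<open>norm (L x) / B\<close>, so this factor
    covers both summands of \<open>1 + norm x\<close>.\<close>
  define K where "K = 1 + 1 / B"
  have K: "1 + norm x \<le> K * (1 + norm (L x))" for x
  proof -
    have "norm x \<le> norm (L x) / B" using B by (simp add: field_simps)
    moreover have "0 \<le> 1 / B + norm (L x)" using B by simp
    moreover have "K * (1 + norm (L x)) = 1 + norm (L x) / B + (1 / B + norm (L x))"
      by (simp add: K_def algebra_simps)
    ultimately show ?thesis by linarith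
  qed
  have "(1 + norm x) ^ N * norm (f (L x)) \<le> K ^ N * schwartz_norm N f" if f: "f \<in> schwartz" for f x
  proof -
    have "(1 + norm x) ^ N * norm (f (L x)) \<le> (K * (1 + norm (L x))) ^ N * norm (f (L x))"
      by (intro mult_right_mono power_mono K) auto
    also have "\<dots> = K ^ N * ((1 + norm (L x)) ^ N * norm (f (L x)))"
      by (simp add: power_mult_distrib)
    also have "\<dots> \<le> K ^ N * schwartz_norm N f"
      using B(1) by (intro mult_left_mono schwartz_norm_bound f) (auto simp: K_def)
    finally show ?thesis .
  qed
  then show "\<exists>M C. \<forall>f\<in>schwartz. \<forall>x. (1 + norm x) ^ N * norm (f (L x)) \<le> C * schwartz_norm M f"
    by blast
qed

lemma dir_deriv_translate:
  assumes "f \<in> schwartz" shows "dir_deriv b (\<lambda>x. f (x + a)) = (\<lambda>x. dir_deriv b f (x + a))"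
proof -
  have "((\<lambda>x. f (x + a)) has_derivative frechet_derivative f (at (x + a))) (at x)" for x
  proof -
    have "((\<lambda>x. x + a) has_derivative (\<lambda>v. v)) (at x)"
      by (auto intro!: derivative_eq_intros)
    from has_derivative_compose[OF this frechet_derivative_works[THEN iffD1, OF schwartz_differentiable[OF assms]]]
    show ?thesis .
  qed
  from dir_deriv_eq[OF this] show ?thesis by (simp add: dir_deriv_def)
qed

lemma schwartz_continuous_translate:
  "schwartz_continuous (\<lambda>f x. f (x + a :: 'a::euclidean_space))"
proof (rule schwartz_continuousI')
  show "(\<lambda>x. f (x + a)) differentiable at x" if "f \<in> schwartz" for f x
    using differentiable_chain_at[of "\<lambda>x. x + a" x f] schwartz_differentiable[OF that] by (simp add: o_def)
  show "\<exists>D. schwartz_continuous D \<and> (\<forall>f\<in>schwartz. dir_deriv b (\<lambda>x. f (x + a)) = (\<lambda>x. D f (x + a)))"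
    if "b \<in> Basis" for b
    using that by (intro exI[of _ "dir_deriv b"]) (auto simp: dir_deriv_translate schwartz_continuous_dir_deriv)
  fix N
  have "(1 + norm x) ^ N * norm (f (x + a)) \<le> (1 + norm a) ^ N * schwartz_norm N f" if f: "f \<in> schwartz" for f x
  proof -
    have "(1 + norm x) ^ N * norm (f (x + a)) \<le> ((1 + norm (x + a)) ^ N * (1 + norm a) ^ N) * norm (f (x + a))"
      using one_plus_norm_power_le[of "x + a" "- a" N] by (intro mult_right_mono) auto
    also have "\<dots> = (1 + norm a) ^ N * ((1 + norm (x + a)) ^ N * norm (f (x + a)))"
      by (simp add: mult_ac)
    also have "\<dots> \<le> (1 + norm a) ^ N * schwartz_norm N f"
      by (intro mult_left_mono schwartz_norm_bound f) auto
    finally show ?thesis .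
  qed
  then show "\<exists>M C. \<forall>f\<in>schwartz. \<forall>x. (1 + norm x) ^ N * norm (f (x + a)) \<le> C * schwartz_norm M f"
    by blast
qed

lemma foldr_dir_deriv_translate:
  assumes "f \<in> schwartz" "set vs \<subseteq> Basis"
  shows "foldr dir_deriv vs (\<lambda>x. f (x + a)) = (\<lambda>x. foldr dir_deriv vs f (x + a))"
  using assms by (induction vs) (auto simp: dir_deriv_translate schwartz_foldr_dir_deriv)

lemma has_derivative_cis_inner:
  "((\<lambda>x. cis (c * (\<xi> \<bullet> x))) has_derivative (\<lambda>v. complex_of_real (c * (\<xi> \<bullet> v)) * (\<i> * cis (c * (\<xi> \<bullet> x))))) (at x)"
proof -
  have "((\<lambda>x. \<i> * complex_of_real (c * (\<xi> \<bullet> x))) has_derivative (\<lambda>v. \<i> * complex_of_real (c * (\<xi> \<bullet> v)))) (at x)"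
    by (intro has_derivative_mult_right has_derivative_of_real has_derivative_inner_right has_derivative_ident)
  from has_derivative_compose[OF this DERIV_exp[unfolded has_field_derivative_def]]
  show ?thesis by (simp add: cis_conv_exp mult_ac)
qed

lemma schwartz_continuous_modulation:
  "schwartz_continuous (\<lambda>f x. cis (c * (\<xi> \<bullet> x)) * f (x :: 'a::euclidean_space))"
proof (rule schwartz_continuousI')
  have D: "((\<lambda>x. cis (c * (\<xi> \<bullet> x)) * f x) has_derivative
      (\<lambda>v. cis (c * (\<xi> \<bullet> x)) * frechet_derivative f (at x) v + complex_of_real (c * (\<xi> \<bullet> v)) * (\<i> * cis (c * (\<xi> \<bullet> x))) * f x)) (at x)"
    if "f \<in> schwartz" for f and x :: 'a
    by (intro has_derivative_mult frechet_derivative_works[THEN iffD1] schwartz_differentiable that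
          has_derivative_cis_inner)
  show "(\<lambda>x. cis (c * (\<xi> \<bullet> x)) * f x) differentiable at x" if "f \<in> schwartz" for f x
    using D[OF that] unfolding differentiable_def by blast
  show "\<exists>D. schwartz_continuous D \<and> (\<forall>f\<in>schwartz. dir_deriv b (\<lambda>x. cis (c * (\<xi> \<bullet> x)) * f x) = (\<lambda>x. cis (c * (\<xi> \<bullet> x)) * D f x))"
    if "b \<in> Basis" for b
    by (intro exI[of _ "\<lambda>f x. dir_deriv b f x + (complex_of_real (c * (\<xi> \<bullet> b)) * \<i>) * f x"] conjI ballI
        schwartz_continuous_add schwartz_continuous_cmult schwartz_continuous_dir_deriv that schwartz_continuous_id)
      (subst dir_deriv_eq[OF D], assumption, simp add: dir_deriv_def algebra_simps)
  show "\<exists>M C. \<forall>f\<in>schwartz. \<forall>x. (1 + norm x) ^ N * norm (cis (c * (\<xi> \<bullet> x)) * f x) \<le> C * schwartz_norm M f" for N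
    by (intro exI[of _ N] exI[of _ 1]) (auto simp: norm_mult schwartz_norm_bound)
qed

lemma schwartz_cnj:
  assumes "f \<in> schwartz" shows "(\<lambda>x. cnj (f x)) \<in> schwartz"
proof (rule schwartz_coinduct[where X = "(\<lambda>f x. cnj (f x)) ` schwartz"])
  have D: "((\<lambda>x. cnj (f x)) has_derivative (\<lambda>v. cnj (frechet_derivative f (at x) v))) (at x)"
    if "f \<in> schwartz" for f :: "'a \<Rightarrow> complex" and x
    by (intro bounded_linear.has_derivative[OF bounded_linear_cnj] frechet_derivative_works[THEN iffD1]
        schwartz_differentiable that)
  show "g differentiable at x" if "g \<in> (\<lambda>f x. cnj (f x)) ` schwartz" for g and x :: 'a
    using that D unfolding differentiable_def by blast
  show "\<exists>C. \<forall>x. (1 + norm x) ^ N * norm (g x) \<le> C" if "g \<in> (\<lambda>f x. cnj (f x)) ` schwartz" for g :: "'a \<Rightarrow> complex" and N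
    using that schwartz_norm_bound by fastforce
  show "dir_deriv b g \<in> (\<lambda>f x. cnj (f x)) ` schwartz" if g: "g \<in> (\<lambda>f x. cnj (f x)) ` schwartz" and b: "b \<in> Basis" for g :: "'a \<Rightarrow> complex" and b
  proof -
    obtain f where f: "f \<in> schwartz" "g = (\<lambda>x. cnj (f x))" using g by blast
    then have "dir_deriv b g = (\<lambda>x. cnj (dir_deriv b f x))"
      by (simp add: dir_deriv_eq[OF D]) (simp add: dir_deriv_def)
    with schwartz_dir_deriv[OF f(1) b] show ?thesis by blast
  qed
qed (use assms in blast)

lemma tensor_schwartz:
  fixes f :: "real^'m \<Rightarrow> complex" and g :: "real^'n \<Rightarrow> complex"
  assumes "f \<in> schwartz" "g \<in> schwartz" shows "tensor f g \<in> schwartz"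
proof (rule schwartz_coinduct[where X = "{tensor f g |f g. f \<in> schwartz \<and> g \<in> schwartz}"])
  have D: "(tensor f g has_derivative (\<lambda>v. f (vfst z) * frechet_derivative g (at (vsnd z)) (vsnd v)
      + frechet_derivative f (at (vfst z)) (vfst v) * g (vsnd z))) (at z)"
    if "f \<in> schwartz" "g \<in> schwartz" for f :: "real^'m \<Rightarrow> complex" and g :: "real^'n \<Rightarrow> complex" and z
    unfolding tensor_def
    by (intro has_derivative_mult has_derivative_compose[OF linear_imp_has_derivative[OF linear_vfst]]
        has_derivative_compose[OF linear_imp_has_derivative[OF linear_vsnd]]
        frechet_derivative_works[THEN iffD1] schwartz_differentiable that)
  fix h :: "real^('m + 'n) \<Rightarrow> complex" assume "h \<in> {tensor f g |f g. f \<in> schwartz \<and> g \<in> schwartz}"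
  then obtain f g where h: "f \<in> schwartz" "g \<in> schwartz" "h = tensor f g" by blast
  show "h differentiable at z" for z
    using D[OF h(1,2)] unfolding h(3) differentiable_def by blast
  show "\<exists>C. \<forall>z. (1 + norm z) ^ N * norm (h z) \<le> C" for N
  proof (intro exI allI)
    fix z :: "real^('m + 'n)"
    \<comment> \<open>Decay in each block separately gives joint decay, because the joint weight is
      at most the product of the two weights.\<close>
    have "1 + norm z \<le> (1 + norm (vfst z)) * (1 + norm (vsnd z))"
    proof -
      have "0 \<le> norm (vfst z) * norm (vsnd z)" by simp
      with norm_le_vfst_vsnd[of z] show ?thesis unfolding ring_distribs by linarith
    qed
    then have "(1 + norm z) ^ N * norm (h z) \<le> ((1 + norm (vfst z)) * (1 + norm (vsnd z))) ^ N * norm (h z)"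
      by (intro mult_right_mono power_mono) auto
    also have "\<dots> = ((1 + norm (vfst z)) ^ N * norm (f (vfst z))) * ((1 + norm (vsnd z)) ^ N * norm (g (vsnd z)))"
      by (simp add: h(3) tensor_def norm_mult power_mult_distrib mult_ac)
    also have "\<dots> \<le> schwartz_norm N f * schwartz_norm N g"
      by (intro mult_mono schwartz_norm_bound schwartz_norm_nonneg h) auto
    finally show "(1 + norm z) ^ N * norm (h z) \<le> schwartz_norm N f * schwartz_norm N g" .
  qed
  fix b :: "real^('m + 'n)" assume "b \<in> Basis"
  then obtain i where b: "b = axis i 1" by (auto simp: Basis_cart)
  have dd: "dir_deriv b h = (\<lambda>z. f (vfst z) * frechet_derivative g (at (vsnd z)) (vsnd b)
      + frechet_derivative f (at (vfst z)) (vfst b) * g (vsnd z))"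
    unfolding h(3) by (rule dir_deriv_eq[OF D[OF h(1,2)]])
  have lin: "linear (frechet_derivative f (at z))" "linear (frechet_derivative g (at z'))" for z z'
    using linear_frechet_derivative schwartz_differentiable h by blast+
  \<comment> \<open>A basis vector lies in one of the two blocks, so one summand of the product rule
    vanishes and the other is again a tensor product.\<close>
  show "dir_deriv b h \<in> {tensor f g |f g. f \<in> schwartz \<and> g \<in> schwartz}"
  proof (cases i)
    case (Inl j)
    have "vfst b = axis j 1" "vsnd b = 0"
      by (auto simp: b Inl vfst_def vsnd_def axis_def vec_eq_iff)
    then have "dir_deriv b h = tensor (dir_deriv (axis j 1) f) g"
      unfolding dd tensor_def by (simp add: linear_0[OF lin(2)] dir_deriv_def)
    moreover have "dir_deriv (axis j 1) f \<in> schwartz"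
      by (rule schwartz_dir_deriv[OF h(1)]) (simp add: Basis_cart)
    ultimately show ?thesis using h by blast
  next
    case (Inr j)
    have "vfst b = 0" "vsnd b = axis j 1"
      by (auto simp: b Inr vfst_def vsnd_def axis_def vec_eq_iff)
    then have "dir_deriv b h = tensor f (dir_deriv (axis j 1) g)"
      unfolding dd tensor_def by (simp add: linear_0[OF lin(1)] dir_deriv_def)
    moreover have "dir_deriv (axis j 1) g \<in> schwartz"
      by (rule schwartz_dir_deriv[OF h(2)]) (simp add: Basis_cart)
    ultimately show ?thesis using h by blast
  qed
qed (use assms in blast)

text \<open>Polynomials times the Gaussian, generated by just those operations that the product rule
  produces; this is the class \<open>X\<close> for which \<open>schwartz_coinduct\<close> is applied
  to \<open>gauss\<close>.\<close>

inductive_set gauss_span :: "('a::euclidean_space \<Rightarrow> complex) set" where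
  gauss: "gauss \<in> gauss_span"
| coord: "f \<in> gauss_span \<Longrightarrow> b \<in> Basis \<Longrightarrow> (\<lambda>x. complex_of_real (x \<bullet> b) * f x) \<in> gauss_span"
| cmult: "f \<in> gauss_span \<Longrightarrow> (\<lambda>x. c * f x) \<in> gauss_span"
| add: "f \<in> gauss_span \<Longrightarrow> g \<in> gauss_span \<Longrightarrow> (\<lambda>x. f x + g x) \<in> gauss_span"

lemma has_derivative_gauss:
  "(gauss has_derivative (\<lambda>v. complex_of_real (- 2 * pi * (x \<bullet> v)) * gauss x)) (at x)"
proof -
  have "((\<lambda>x. complex_of_real (exp (- pi * (x \<bullet> x)))) has_derivative
      (\<lambda>v. complex_of_real (exp (- pi * (x \<bullet> x)) * (- pi * (x \<bullet> v + v \<bullet> x))))) (at x)"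
    by (intro has_derivative_of_real) (auto intro!: derivative_eq_intros)
  moreover have "(\<lambda>v. complex_of_real (exp (- pi * (x \<bullet> x)) * (- pi * (x \<bullet> v + v \<bullet> x))))
      = (\<lambda>v. complex_of_real (- 2 * pi * (x \<bullet> v)) * gauss x)"
    by (simp add: gauss_def power2_norm_eq_inner inner_commute fun_eq_iff algebra_simps)
  ultimately show ?thesis
    unfolding gauss_def[abs_def] power2_norm_eq_inner by simp
qed

text \<open>A single term of the exponential series gives
  \<open>(1 + r) ^ N \<le> fact N * exp (1 + r)\<close>. The constant 2 comes from
  \<open>1 + r - pi * r\<^sup>2 \<le> 2\<close>, which holds since \<open>pi \<ge> 1\<close> and
  \<open>r \<le> 1 + r\<^sup>2\<close>.\<close>

lemma gauss_decay: "(1 + norm x) ^ N * norm (gauss x) \<le> fact N * exp 2"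
proof -
  let ?r = "norm x"
  have "(1 + ?r) ^ N / fact N \<le> exp (1 + ?r)"
    using sum_le_suminf[OF summable_exp, of "{N}" "1 + ?r"] by (simp add: exp_def divide_inverse mult.commute)
  then have "(1 + ?r) ^ N \<le> fact N * exp (1 + ?r)"
    by (simp add: field_simps)
  then have "(1 + ?r) ^ N * norm (gauss x) \<le> fact N * exp (1 + ?r) * exp (- pi * ?r\<^sup>2)"
    unfolding gauss_def by (intro mult_mono) auto
  also have "\<dots> = fact N * exp (1 + ?r - pi * ?r\<^sup>2)"
    by (simp add: exp_add[symmetric] exp_diff[symmetric] mult.assoc)
  also have "\<dots> \<le> fact N * exp 2"
  proof -
    have "1 * ?r\<^sup>2 \<le> pi * ?r\<^sup>2"
      using pi_ge_two by (intro mult_right_mono) auto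
    moreover have "0 \<le> (?r - 1)\<^sup>2" by simp
    then have "2 * ?r \<le> 1 + ?r\<^sup>2" by (simp add: power2_diff)
    with norm_ge_zero[of x] have "?r \<le> 1 + ?r\<^sup>2" by linarith
    ultimately have "1 + ?r - pi * ?r\<^sup>2 \<le> 2" by linarith
    then show ?thesis by (intro mult_left_mono) auto
  qed
  finally show ?thesis .
qed

lemma gauss_span_deriv:
  assumes "f \<in> gauss_span"
  shows "\<exists>f'. (\<forall>x. (f has_derivative f' x) (at x)) \<and> (\<forall>b\<in>Basis. (\<lambda>x. f' x b) \<in> gauss_span)"
  using assms
proof induction
  case gauss
  have "(\<lambda>x. complex_of_real (- 2 * pi) * (complex_of_real (x \<bullet> b) * gauss x)) \<in> gauss_span" if "b \<in> Basis" for b :: 'a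
    by (intro gauss_span.intros that)
  then show ?case
    by (intro exI[of _ "\<lambda>x v. complex_of_real (- 2 * pi * (x \<bullet> v)) * gauss x"] conjI allI ballI
        has_derivative_gauss) (simp add: mult.assoc)
next
  case (coord f b)
  then obtain f' where f': "\<And>x. (f has_derivative f' x) (at x)" "\<And>c. c \<in> Basis \<Longrightarrow> (\<lambda>x. f' x c) \<in> gauss_span"
    by blast
  show ?case
    by (intro exI[of _ "\<lambda>x v. complex_of_real (x \<bullet> b) * f' x v + complex_of_real (v \<bullet> b) * f x"] conjI allI ballI
        has_derivative_mult has_derivative_of_real has_derivative_inner_left has_derivative_ident f'
        gauss_span.intros coord)
next
  case (cmult f c)
  then obtain f' where f': "\<And>x. (f has_derivative f' x) (at x)" "\<And>c. c \<in> Basis \<Longrightarrow> (\<lambda>x. f' x c) \<in> gauss_span"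
    by blast
  show ?case
    by (intro exI[of _ "\<lambda>x v. c * f' x v"] conjI allI ballI has_derivative_mult_right f' gauss_span.intros)
next
  case (add f g)
  then obtain f' g' where f': "\<And>x. (f has_derivative f' x) (at x)" "\<And>c. c \<in> Basis \<Longrightarrow> (\<lambda>x. f' x c) \<in> gauss_span"
    and g': "\<And>x. (g has_derivative g' x) (at x)" "\<And>c. c \<in> Basis \<Longrightarrow> (\<lambda>x. g' x c) \<in> gauss_span"
    by blast
  show ?case
    by (intro exI[of _ "\<lambda>x v. f' x v + g' x v"] conjI allI ballI has_derivative_add f' g' gauss_span.intros)
qed

lemma gauss_span_bound:
  "f \<in> gauss_span \<Longrightarrow> \<exists>C. \<forall>x. (1 + norm x) ^ N * norm (f x) \<le> C"
proof (induction arbitrary: N rule: gauss_span.induct)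
  case gauss
  show ?case using gauss_decay by blast
next
  case (coord f b)
  obtain C where C: "\<And>x. (1 + norm x) ^ Suc N * norm (f x) \<le> C" using coord by blast
  have "(1 + norm x) ^ N * norm (complex_of_real (x \<bullet> b) * f x) \<le> C" for x
    by (rule order_trans[OF weighted_norm_coord_le[OF coord(2)] C])
  then show ?case by blast
next
  case (cmult f c)
  obtain C where C: "\<And>x. (1 + norm x) ^ N * norm (f x) \<le> C" using cmult by blast
  have "(1 + norm x) ^ N * norm (c * f x) \<le> norm c * C" for x
    using mult_left_mono[OF C[of x], of "norm c"] by (simp add: norm_mult mult_ac)
  then show ?case by blast
next
  case (add f g)
  obtain C D where C: "\<And>x. (1 + norm x) ^ N * norm (f x) \<le> C" and D: "\<And>x. (1 + norm x) ^ N * norm (g x) \<le> D"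
    using add by metis
  have "(1 + norm x) ^ N * norm (f x + g x) \<le> C + D" for x
    by (rule order_trans[OF weighted_norm_add_le add_mono[OF C D]])
  then show ?case by blast
qed

lemma gauss_schwartz: "gauss \<in> schwartz"
proof (rule schwartz_coinduct[OF gauss_span.gauss])
  fix f :: "'a \<Rightarrow> complex" and x b assume f: "f \<in> gauss_span"
  then obtain f' where f': "\<And>x. (f has_derivative f' x) (at x)" "\<And>c. c \<in> Basis \<Longrightarrow> (\<lambda>x. f' x c) \<in> gauss_span"
    using gauss_span_deriv by blast
  show "f differentiable at x" using f'(1) unfolding differentiable_def by blast
  show "dir_deriv b f \<in> gauss_span" if "b \<in> Basis"
    unfolding dir_deriv_eq[OF f'(1)] by (rule f'(2)[OF that])
qed (rule gauss_span_bound)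

text \<open>One factor \<open>1 + norm x\<close> is at most 1 plus the sum of the
  \<open>\<bar>x \<bullet> b\<bar>\<close>, and each coordinate can be moved inside \<open>P\<close>
  at the cost of an operator \<open>E\<close>. Thus every polynomial weight reduces to the plain sup
  bound.\<close>

lemma weighted_bound_by_coordinates:
  fixes P :: "('a::euclidean_space \<Rightarrow> complex) \<Rightarrow> 'b::euclidean_space \<Rightarrow> complex"
  assumes bound: "\<exists>M C. \<forall>f\<in>schwartz. \<forall>x. norm (P f x) \<le> C * schwartz_norm M f"
    and coord: "\<And>b. b \<in> Basis \<Longrightarrow> \<exists>E. schwartz_continuous E \<and>
        (\<forall>f\<in>schwartz. \<forall>x. complex_of_real (x \<bullet> b) * P f x = P (E f) x)"
  shows "\<exists>M C. \<forall>f\<in>schwartz. \<forall>x. (1 + norm x) ^ N * norm (P f x) \<le> C * schwartz_norm M f"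
proof (induction N)
  case 0
  show ?case using bound by simp
next
  case (Suc N)
  then obtain M C where MC: "\<And>f x. f \<in> schwartz \<Longrightarrow> (1 + norm x) ^ N * norm (P f x) \<le> C * schwartz_norm M f"
    by blast
  obtain E where E: "\<And>b. b \<in> Basis \<Longrightarrow> schwartz_continuous (E b)"
      "\<And>b f x. b \<in> Basis \<Longrightarrow> f \<in> schwartz \<Longrightarrow> complex_of_real (x \<bullet> b) * P f x = P (E b f) x"
    using coord by metis
  have "\<exists>M C. \<forall>f\<in>schwartz. \<forall>x. (1 + norm x) ^ N * norm (P (E b f) x) \<le> C * schwartz_norm M f" if b: "b \<in> Basis" for b
  proof -
    obtain K D where KD: "\<And>f. f \<in> schwartz \<Longrightarrow> schwartz_norm M (E b f) \<le> D * schwartz_norm K f"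
      using schwartz_continuous_norm[OF E(1)[OF b]] by metis
    have "(1 + norm x) ^ N * norm (P (E b f) x) \<le> (\<bar>C\<bar> * D) * schwartz_norm K f" if f: "f \<in> schwartz" for f x
    proof -
      have Ef: "E b f \<in> schwartz" by (rule schwartz_continuousD[OF E(1)[OF b] f])
      have "(1 + norm x) ^ N * norm (P (E b f) x) \<le> C * schwartz_norm M (E b f)"
        by (rule MC[OF Ef])
      also have "\<dots> \<le> \<bar>C\<bar> * schwartz_norm M (E b f)"
        by (intro mult_right_mono schwartz_norm_nonneg Ef) auto
      also have "\<dots> \<le> \<bar>C\<bar> * (D * schwartz_norm K f)"
        by (intro mult_left_mono KD f) auto
      finally show ?thesis by (simp add: mult_ac)
    qed
    then show ?thesis by blast
  qed
  then have "\<exists>M C. \<forall>f\<in>schwartz. \<forall>x. (\<Sum>b\<in>Basis. (1 + norm x) ^ N * norm (P (E b f) x)) \<le> C * schwartz_norm M f"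
    by (intro sum_schwartz_norm_bound finite_Basis)
  then obtain K D where KD: "\<And>f x. f \<in> schwartz \<Longrightarrow>
      (\<Sum>b\<in>Basis. (1 + norm x) ^ N * norm (P (E b f) x)) \<le> D * schwartz_norm K f"
    by blast
  have "(1 + norm x) ^ Suc N * norm (P f x) \<le> (\<bar>C\<bar> + \<bar>D\<bar>) * schwartz_norm (max M K) f" if f: "f \<in> schwartz" for f x
  proof -
    have "(1 + norm x) ^ Suc N * norm (P f x) = (1 + norm x) ^ N * ((1 + norm x) * norm (P f x))"
      by simp
    also have "\<dots> \<le> (1 + norm x) ^ N * ((1 + (\<Sum>b\<in>Basis. \<bar>x \<bullet> b\<bar>)) * norm (P f x))"
      by (intro mult_left_mono mult_right_mono add_left_mono norm_le_l1) auto
    also have "\<dots> = (1 + norm x) ^ N * norm (P f x)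
        + (\<Sum>b\<in>Basis. (1 + norm x) ^ N * norm (complex_of_real (x \<bullet> b) * P f x))"
      by (simp add: norm_mult algebra_simps sum_distrib_left)
    also have "\<dots> = (1 + norm x) ^ N * norm (P f x) + (\<Sum>b\<in>Basis. (1 + norm x) ^ N * norm (P (E b f) x))"
      by (simp add: E(2) f)
    also have "\<dots> \<le> C * schwartz_norm M f + D * schwartz_norm K f"
      by (intro add_mono MC KD f)
    also have "\<dots> \<le> \<bar>C\<bar> * schwartz_norm (max M K) f + \<bar>D\<bar> * schwartz_norm (max M K) f"
      by (intro add_mono mult_mono schwartz_norm_mono schwartz_norm_nonneg f) auto
    finally show ?thesis by (simp add: algebra_simps)
  qed
  then show ?case by blast
qed

section \<open>The partial Fourier transform\<close>

lemma partial_fourier2_eq_fourier: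
  "partial_fourier2 f z = fourier (\<lambda>y. f (vjoin (vfst z) y)) (vsnd z)"
  by (simp add: partial_fourier2_def fourier_def)


lemma schwartz_slice_bound:
  fixes f :: "real^('m::finite + 'n::finite) \<Rightarrow> complex"
  assumes "f \<in> schwartz"
  shows "(1 + norm y) ^ N * norm (f (vjoin x y)) \<le> schwartz_norm N f"
proof -
  have "norm y \<le> norm (vjoin x y)"
    using norm_vsnd_le[of "vjoin x y"] by simp
  then have "(1 + norm y) ^ N * norm (f (vjoin x y)) \<le> (1 + norm (vjoin x y)) ^ N * norm (f (vjoin x y))"
    by (intro mult_right_mono power_mono) auto
  with schwartz_norm_bound[OF assms, of "vjoin x y" N] show ?thesis by linarith
qed

lemma measurable_slice:
  assumes "f \<in> schwartz"
  shows "(\<lambda>y. f (vjoin x y)) \<in> borel_measurable borel"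
  using schwartz_measurable[OF assms] by measurable

lemma integrable_slice:
  assumes "f \<in> schwartz"
  shows "integrable lborel (\<lambda>y. f (vjoin x y))"
  by (rule integrable_decayI[OF measurable_slice[OF assms] schwartz_slice_bound[OF assms]])

lemma integrable_slice_cis:
  assumes "f \<in> schwartz"
  shows "integrable lborel (\<lambda>y. f (vjoin x y) * cis (- 2 * pi * (\<xi> \<bullet> y)))"
  by (rule Bochner_Integration.integrable_bound[OF integrable_slice[OF assms, of x]])
    (use measurable_slice[OF assms] in \<open>auto simp: norm_mult\<close>)

lemma has_derivative_slice:
  fixes f :: "real^('m::finite + 'n::finite) \<Rightarrow> complex"
  assumes "f \<in> schwartz"
  shows "((\<lambda>y. f (vjoin x y)) has_derivative (\<lambda>v. frechet_derivative f (at (vjoin x y)) (vjoin 0 v))) (at y)"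
proof -
  have lin: "linear (\<lambda>v. vjoin (0::real^'m) (v::real^'n))"
    using linear_compose[OF _ linear_vjoin, of "\<lambda>v. (0, v)"]
    by (auto simp: o_def linear_iff)
  have "((\<lambda>y. vjoin x y) has_derivative (\<lambda>v. vjoin 0 v)) (at y)"
  proof -
    have eq: "(\<lambda>y::real^'n. vjoin x y) = (\<lambda>y. vjoin x 0 + vjoin 0 y)"
      using vjoin_add[of x 0 0] by (intro ext) simp
    have "((\<lambda>y. vjoin x 0 + vjoin 0 y) has_derivative (\<lambda>v. 0 + vjoin 0 v)) (at y)"
      by (intro has_derivative_add has_derivative_const linear_imp_has_derivative lin)
    then show ?thesis by (subst eq) (simp only: add_0_left)
  qed
  from has_derivative_compose[OF this frechet_derivative_works[THEN iffD1, OF schwartz_differentiable[OF assms]]]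
  show ?thesis .
qed

lemma vfst_axis_Inl [simp]: "vfst (axis (Inl j) c) = axis j c"
  and vsnd_axis_Inl [simp]: "vsnd (axis (Inl j) c) = 0"
  and vfst_axis_Inr [simp]: "vfst (axis (Inr k) c) = 0"
  and vsnd_axis_Inr [simp]: "vsnd (axis (Inr k) c) = axis k c"
  by (auto simp: vfst_def vsnd_def axis_def vec_eq_iff)

lemma vjoin_axis_Inl: "vjoin (axis j c) 0 = axis (Inl j) c"
  and vjoin_axis_Inr: "vjoin 0 (axis k c) = axis (Inr k) c"
  by (auto simp: vjoin_def axis_def vec_eq_iff split: sum.split)

text \<open>Directions in the first block differentiate \<open>f\<close>; directions in the second
  differentiate the character and bring down a factor of size at most a multiple of
  \<open>norm y\<close>. Both are dominated, uniformly in \<open>z\<close>, by a multiple of the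
  integrable decay function.\<close>

lemma has_derivative_partial_fourier2:
  fixes f :: "real^('m::finite + 'n::finite) \<Rightarrow> complex"
  assumes f: "f \<in> schwartz"
  shows "(partial_fourier2 f has_derivative (\<lambda>v. LINT y|lborel.
      (frechet_derivative f (at (vjoin (vfst z) y)) (vjoin (vfst v) 0)
        + complex_of_real (- 2 * pi * (vsnd v \<bullet> y)) * \<i> * f (vjoin (vfst z) y)) * cis (- 2 * pi * (vsnd z \<bullet> y)))) (at z)"
proof -
  let ?n = "2 * DIM(real^'n)"
  let ?p = "\<lambda>z y. vjoin (vfst z) y"
  let ?K' = "\<lambda>z y v. (frechet_derivative f (at (?p z y)) (vjoin (vfst v) 0)
        + complex_of_real (- 2 * pi * (vsnd v \<bullet> y)) * \<i> * f (?p z y)) * cis (- 2 * pi * (vsnd z \<bullet> y))"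
  \<comment> \<open>One summand for each part of \<open>?K'\<close>. The index \<open>Suc ?n\<close>
    pays for the factor \<open>y\<close> that the character contributes.\<close>
  define S where "S = (\<Sum>b\<in>Basis. schwartz_norm ?n (dir_deriv b f)) + 2 * pi * schwartz_norm (Suc ?n) f"
  have fr: "frechet_derivative f (at x) v = (\<Sum>b\<in>Basis. (v \<bullet> b) *\<^sub>R dir_deriv b f x)" for x v
    by (rule fun_cong[OF frechet_derivative_at[OF schwartz_has_derivative[OF f], symmetric]])
  have "((\<lambda>z. LINT y|lborel. f (?p z y) * cis (- 2 * pi * (vsnd z \<bullet> y))) has_derivative (\<lambda>v. LINT y|lborel. ?K' z y v)) (at z)"
  proof (rule has_derivative_integral_dominated[where r = 1 and g = "\<lambda>y. S * (1 / (1 + norm y) ^ ?n)"])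
    fix z :: "real^('m + 'n)" and y :: "real^'n"
    have lin: "linear (\<lambda>v::real^('m + 'n). vjoin (vfst v) (0::real^'n))"
      by (rule linearI) (simp_all add: vec_eq_iff vjoin_def vfst_def split: sum.split)
    have "((\<lambda>z. ?p z y) has_derivative (\<lambda>v. vjoin (vfst v) 0)) (at z)"
    proof -
      have eq: "(\<lambda>z::real^('m+'n). ?p z y) = (\<lambda>z. vjoin (vfst z) 0 + vjoin 0 y)"
        by (intro ext) (simp flip: vjoin_add)
      have "((\<lambda>z::real^('m+'n). vjoin (vfst z) 0 + vjoin 0 y) has_derivative (\<lambda>v. vjoin (vfst v) 0 + 0)) (at z)"
        by (intro has_derivative_add has_derivative_const linear_imp_has_derivative lin)
      then show ?thesis by (subst eq) (simp only: add_0_right)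
    qed
    from has_derivative_compose[OF this frechet_derivative_works[THEN iffD1, OF schwartz_differentiable[OF f]]]
    have 1: "((\<lambda>z. f (?p z y)) has_derivative (\<lambda>v. frechet_derivative f (at (?p z y)) (vjoin (vfst v) 0))) (at z)" .
    have 2: "((\<lambda>z. cis (- 2 * pi * (y \<bullet> vsnd z))) has_derivative
        (\<lambda>v. complex_of_real (- 2 * pi * (y \<bullet> vsnd v)) * (\<i> * cis (- 2 * pi * (y \<bullet> vsnd z))))) (at z)"
      by (rule has_derivative_compose[OF linear_imp_has_derivative[OF linear_vsnd] has_derivative_cis_inner])
    show "((\<lambda>z. f (?p z y) * cis (- 2 * pi * (vsnd z \<bullet> y))) has_derivative ?K' z y) (at z)"
      using has_derivative_mult[OF 1 2] by (simp add: inner_commute algebra_simps)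
    show "norm (?K' z y v) \<le> S * (1 / (1 + norm y) ^ ?n) * norm v" for v
    proof -
      let ?w = "1 / (1 + norm y) ^ ?n"
      have w: "norm (g (?p z y)) \<le> schwartz_norm ?n g * ?w" if "g \<in> schwartz" for g :: "real^('m+'n) \<Rightarrow> complex"
        using schwartz_slice_bound[OF that, of y ?n "vfst z"]
        by (simp add: pos_le_divide_eq add_pos_nonneg mult.commute)
      have nv: "norm (vjoin (vfst v) 0 :: real^('m+'n)) \<le> norm v"
        using norm_vfst_le[of v] norm_le_vfst_vsnd[of "vjoin (vfst v) (0::real^'n)"] by simp
      have "norm (frechet_derivative f (at (?p z y)) (vjoin (vfst v) 0))
          \<le> (\<Sum>b\<in>Basis. norm v * (schwartz_norm ?n (dir_deriv b f) * ?w))"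
        unfolding fr
      proof (rule sum_norm_le)
        fix b :: "real^('m+'n)" assume b: "b \<in> Basis"
        show "norm ((vjoin (vfst v) 0 \<bullet> b) *\<^sub>R dir_deriv b f (?p z y)) \<le> norm v * (schwartz_norm ?n (dir_deriv b f) * ?w)"
          unfolding norm_scaleR
          by (intro mult_mono w schwartz_dir_deriv f b order_trans[OF Basis_le_norm[OF b] nv]) auto
      qed
      moreover have "norm (complex_of_real (- 2 * pi * (vsnd v \<bullet> y)) * \<i> * f (?p z y))
          \<le> norm v * (2 * pi * schwartz_norm (Suc ?n) f * ?w)"
      proof -
        have "\<bar>vsnd v \<bullet> y\<bar> \<le> norm v * (1 + norm y)"
          using Cauchy_Schwarz_ineq2[of "vsnd v" y] mult_mono[OF norm_vsnd_le[of v], of "norm y" "1 + norm y"] by simp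
        moreover have "(1 + norm y) * norm (f (?p z y)) \<le> schwartz_norm (Suc ?n) f * ?w"
          using schwartz_slice_bound[OF f, of y "Suc ?n" "vfst z"]
          by (simp add: pos_le_divide_eq add_pos_nonneg mult_ac)
        ultimately have "\<bar>vsnd v \<bullet> y\<bar> * norm (f (?p z y)) \<le> norm v * (schwartz_norm (Suc ?n) f * ?w)"
          using mult_right_mono[of "\<bar>vsnd v \<bullet> y\<bar>" "norm v * (1 + norm y)" "norm (f (?p z y))"]
            mult_left_mono[of "(1 + norm y) * norm (f (?p z y))" "schwartz_norm (Suc ?n) f * ?w" "norm v"]
          by (simp add: mult.assoc)
        then have "2 * pi * (\<bar>vsnd v \<bullet> y\<bar> * norm (f (?p z y))) \<le> 2 * pi * (norm v * (schwartz_norm (Suc ?n) f * ?w))"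
          by (intro mult_left_mono) auto
        moreover have "norm (complex_of_real (- 2 * pi * (vsnd v \<bullet> y)) * \<i> * f (?p z y))
            = 2 * pi * (\<bar>vsnd v \<bullet> y\<bar> * norm (f (?p z y)))"
          by (simp add: norm_mult abs_mult)
        ultimately show ?thesis by (simp only: mult_ac)
      qed
      ultimately have "norm (frechet_derivative f (at (?p z y)) (vjoin (vfst v) 0)
          + complex_of_real (- 2 * pi * (vsnd v \<bullet> y)) * \<i> * f (?p z y))
          \<le> (\<Sum>b\<in>Basis. norm v * (schwartz_norm ?n (dir_deriv b f) * ?w)) + norm v * (2 * pi * schwartz_norm (Suc ?n) f * ?w)"
        by (intro order_trans[OF norm_triangle_ineq] add_mono)
      also have "\<dots> = S * ?w * norm v"
        unfolding S_def by (simp only: ring_distribs sum_distrib_left sum_distrib_right mult_ac)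
      finally show ?thesis
        by (simp only: norm_mult norm_cis mult_1_right)
    qed
  next
    show "integrable lborel (\<lambda>y::real^'n. S * (1 / (1 + norm y) ^ ?n))"
      by (intro integrable_mult_right integrable_decay)
    show "integrable lborel (\<lambda>y. f (?p z y) * cis (- 2 * pi * (vsnd z \<bullet> y)))" for z
      by (rule integrable_slice_cis[OF f])
    have [measurable]: "(\<lambda>y. dir_deriv b f (vjoin x y)) \<in> borel_measurable borel" if "b \<in> Basis" for b x
      by (intro measurable_slice schwartz_dir_deriv f that)
    have [measurable]: "(\<lambda>y. f (vjoin x y)) \<in> borel_measurable borel" for x
      by (rule measurable_slice[OF f])
    show "(\<lambda>y. ?K' z y v) \<in> borel_measurable borel" for v
      unfolding fr by measurable
  qed simp
  then show ?thesis
    unfolding partial_fourier2_def[abs_def] .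
qed

lemma dir_deriv_partial_fourier2:
  fixes f :: "real^('m::finite + 'n::finite) \<Rightarrow> complex"
  assumes f: "f \<in> schwartz"
  shows "dir_deriv (axis (Inl j) 1) (partial_fourier2 f) = partial_fourier2 (dir_deriv (axis (Inl j) 1) f)"
    and "dir_deriv (axis (Inr k) 1) (partial_fourier2 f)
      = partial_fourier2 (\<lambda>z. (- 2 * pi * \<i>) * (complex_of_real (z \<bullet> axis (Inr k) 1) * f z))"
proof -
  have lin: "linear (frechet_derivative f (at z))" for z
    by (rule linear_frechet_derivative[OF schwartz_differentiable[OF f]])
  have z: "vjoin 0 0 = (0 :: real^('m + 'n))"
    by (simp add: vec_eq_iff vjoin_def split: sum.split)
  show "dir_deriv (axis (Inl j) 1) (partial_fourier2 f) = partial_fourier2 (dir_deriv (axis (Inl j) 1) f)"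
    unfolding dir_deriv_eq[OF has_derivative_partial_fourier2[OF f]]
    by (simp add: partial_fourier2_def fun_eq_iff vjoin_axis_Inl) (simp add: dir_deriv_def)
  show "dir_deriv (axis (Inr k) 1) (partial_fourier2 f)
      = partial_fourier2 (\<lambda>z. (- 2 * pi * \<i>) * (complex_of_real (z \<bullet> axis (Inr k) 1) * f z))"
    unfolding dir_deriv_eq[OF has_derivative_partial_fourier2[OF f]]
    by (simp add: partial_fourier2_def fun_eq_iff z linear_0[OF lin] inner_vjoin_split inner_commute mult_ac)
qed

lemma coord_partial_fourier2_Inl:
  "complex_of_real (z \<bullet> axis (Inl j) 1) * partial_fourier2 f z
    = partial_fourier2 (\<lambda>z. complex_of_real (z \<bullet> axis (Inl j) 1) * f z) z"
  by (simp add: partial_fourier2_def inner_vjoin_split mult.assoc)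

text \<open>Integration by parts: the derivative of the slice times the character integrates to 0,
  and the product rule splits it into the two terms to be compared.\<close>

lemma coord_partial_fourier2_Inr:
  fixes f :: "real^('m::finite + 'n::finite) \<Rightarrow> complex"
  assumes f: "f \<in> schwartz"
  shows "complex_of_real (z \<bullet> axis (Inr k) 1) * partial_fourier2 f z
    = partial_fourier2 (\<lambda>z. 1 / (2 * pi * \<i>) * dir_deriv (axis (Inr k) 1) f z) z"
proof -
  let ?n = "2 * DIM(real^'n)"
  let ?x = "vfst z" and ?\<xi> = "vsnd z"
  let ?b = "axis k 1 :: real^'n"
  let ?c = "\<lambda>y. cis (- 2 * pi * (?\<xi> \<bullet> y))"
  let ?h' = "\<lambda>y v. f (vjoin ?x y) * (complex_of_real (- 2 * pi * (?\<xi> \<bullet> v)) * (\<i> * ?c y))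
      + frechet_derivative f (at (vjoin ?x y)) (vjoin 0 v) * ?c y"
  have B: "axis (Inr k) 1 \<in> (Basis :: (real^('m + 'n)) set)" by (simp add: Basis_cart)
  note df = schwartz_dir_deriv[OF f B]
  have h'b: "?h' y ?b = (- 2 * pi * \<i> * complex_of_real (?\<xi> \<bullet> ?b)) * (f (vjoin ?x y) * ?c y)
      + dir_deriv (axis (Inr k) 1) f (vjoin ?x y) * ?c y" for y
    by (simp add: vjoin_axis_Inr dir_deriv_def)
  have "(LINT y|lborel. ?h' y ?b) = 0"
  proof (rule integral_derivative_zero[where h' = ?h' and b = ?b])
    show "((\<lambda>y. f (vjoin ?x y) * ?c y) has_derivative ?h' y) (at y)" for y
      by (rule has_derivative_mult[OF has_derivative_slice[OF f] has_derivative_cis_inner])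
    show "integrable lborel (\<lambda>y. f (vjoin ?x y) * ?c y)"
      by (rule integrable_slice_cis[OF f])
    show "(\<lambda>y. ?h' y ?b) \<in> borel_measurable borel"
      unfolding h'b using measurable_slice[OF f] measurable_slice[OF df] by measurable
    show "(1 + norm y) ^ ?n * norm (?h' y ?b)
        \<le> norm (- 2 * pi * \<i> * complex_of_real (?\<xi> \<bullet> ?b)) * schwartz_norm ?n f
          + schwartz_norm ?n (dir_deriv (axis (Inr k) 1) f)" for y
    proof -
      have "norm (?h' y ?b) \<le> norm (- 2 * pi * \<i> * complex_of_real (?\<xi> \<bullet> ?b)) * norm (f (vjoin ?x y))
          + norm (dir_deriv (axis (Inr k) 1) f (vjoin ?x y))"
        unfolding h'b by (rule order_trans[OF norm_triangle_ineq]) (simp add: norm_mult)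
      then have "(1 + norm y) ^ ?n * norm (?h' y ?b) \<le> (1 + norm y) ^ ?n * (norm (- 2 * pi * \<i> * complex_of_real (?\<xi> \<bullet> ?b)) * norm (f (vjoin ?x y))
          + norm (dir_deriv (axis (Inr k) 1) f (vjoin ?x y)))"
        by (rule mult_left_mono) simp
      also have "\<dots> = norm (- 2 * pi * \<i> * complex_of_real (?\<xi> \<bullet> ?b)) * ((1 + norm y) ^ ?n * norm (f (vjoin ?x y)))
          + (1 + norm y) ^ ?n * norm (dir_deriv (axis (Inr k) 1) f (vjoin ?x y))"
        by (simp only: ring_distribs mult_ac)
      also have "\<dots> \<le> norm (- 2 * pi * \<i> * complex_of_real (?\<xi> \<bullet> ?b)) * schwartz_norm ?n f
          + schwartz_norm ?n (dir_deriv (axis (Inr k) 1) f)"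
        by (intro add_mono mult_left_mono schwartz_slice_bound f df norm_ge_zero)
      finally show ?thesis .
    qed
  qed
  then have "(- 2 * pi * \<i> * complex_of_real (?\<xi> \<bullet> ?b)) * partial_fourier2 f z
      + partial_fourier2 (dir_deriv (axis (Inr k) 1) f) z = 0"
    unfolding h'b partial_fourier2_def
    by (subst (asm) Bochner_Integration.integral_add)
      (intro integrable_mult_right integrable_slice_cis f df, intro integrable_slice_cis df,
        simp only: integral_mult_right_zero)
  then have "partial_fourier2 (dir_deriv (axis (Inr k) 1) f) z = 2 * pi * \<i> * (complex_of_real (?\<xi> \<bullet> ?b) * partial_fourier2 f z)"
    by (simp add: algebra_simps add_eq_0_iff)
  moreover have "partial_fourier2 (\<lambda>z. 1 / (2 * pi * \<i>) * dir_deriv (axis (Inr k) 1) f z) z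
      = 1 / (2 * pi * \<i>) * partial_fourier2 (dir_deriv (axis (Inr k) 1) f) z"
    unfolding partial_fourier2_def by (simp only: mult.assoc integral_mult_right_zero)
  ultimately show ?thesis
    by (simp add: inner_vjoin_split)
qed

text \<open>Derivatives and coordinates pass through the transform, unchanged in the first block and
  exchanged, up to constants, in the second. Only the unweighted bound is left, and it follows from
  the decay of the slices.\<close>

theorem schwartz_continuous_partial_fourier2:
  "schwartz_continuous (partial_fourier2 :: (real^('m::finite + 'n::finite) \<Rightarrow> complex) \<Rightarrow> _)"
proof (rule schwartz_continuousI')
  show "partial_fourier2 f differentiable at z" if "f \<in> schwartz" for f and z :: "real^('m + 'n)"
    using has_derivative_partial_fourier2[OF that] unfolding differentiable_def by blast
next
  fix b :: "real^('m + 'n)" assume b: "b \<in> Basis"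
  then obtain i where i: "b = axis i 1" by (auto simp: Basis_cart)
  show "\<exists>D. schwartz_continuous D \<and> (\<forall>f\<in>schwartz. dir_deriv b (partial_fourier2 f) = partial_fourier2 (D f))"
  proof (cases i)
    case (Inl j)
    show ?thesis
      by (intro exI[of _ "dir_deriv b"] conjI schwartz_continuous_dir_deriv[OF b])
        (simp add: i Inl dir_deriv_partial_fourier2)
  next
    case (Inr k)
    show ?thesis
      by (intro exI[of _ "\<lambda>f z. (- 2 * pi * \<i>) * (complex_of_real (z \<bullet> b) * f z)"] conjI
          schwartz_continuous_cmult schwartz_continuous_coord[OF b])
        (simp add: i Inr dir_deriv_partial_fourier2)
  qed
next
  let ?n = "2 * DIM(real^'n)"
  show "\<exists>M C. \<forall>f\<in>schwartz. \<forall>z::real^('m + 'n). (1 + norm z) ^ N * norm (partial_fourier2 f z) \<le> C * schwartz_norm M f" for N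
  proof (rule weighted_bound_by_coordinates)
    have "norm (partial_fourier2 f z) \<le> (LINT y|lborel. 1 / (1 + norm (y::real^'n)) ^ ?n) * schwartz_norm ?n f"
      if f: "f \<in> schwartz" for f and z :: "real^('m + 'n)"
    proof -
      have "norm (partial_fourier2 f z) \<le> (LINT y|lborel. norm (f (vjoin (vfst z) y)))"
        unfolding partial_fourier2_eq_fourier by (rule norm_fourier_le)
      also have "\<dots> \<le> (LINT y|lborel. schwartz_norm ?n f * (1 / (1 + norm (y::real^'n)) ^ ?n))"
      proof (rule integral_mono)
        show "norm (f (vjoin (vfst z) y)) \<le> schwartz_norm ?n f * (1 / (1 + norm y) ^ ?n)" for y
          using schwartz_slice_bound[OF f, of y ?n "vfst z"]
          by (simp add: pos_le_divide_eq add_pos_nonneg mult.commute)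
      qed (intro integrable_norm integrable_slice f integrable_mult_right integrable_decay)+
      also have "\<dots> = (LINT y|lborel. 1 / (1 + norm (y::real^'n)) ^ ?n) * schwartz_norm ?n f"
        by (subst integral_mult_right_zero) (rule mult.commute)
      finally show ?thesis .
    qed
    then show "\<exists>M C. \<forall>f\<in>schwartz. \<forall>z::real^('m + 'n). norm (partial_fourier2 f z) \<le> C * schwartz_norm M f"
      by blast
  next
    fix b :: "real^('m + 'n)" assume b: "b \<in> Basis"
    then obtain i where i: "b = axis i 1" by (auto simp: Basis_cart)
    show "\<exists>E. schwartz_continuous E \<and> (\<forall>f\<in>schwartz. \<forall>z::real^('m + 'n). complex_of_real (z \<bullet> b) * partial_fourier2 f z = partial_fourier2 (E f) z)"
    proof (cases i)
      case (Inl j)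
      show ?thesis
        by (intro exI[of _ "\<lambda>f z. complex_of_real (z \<bullet> b) * f z"] conjI schwartz_continuous_coord[OF b])
          (simp add: i Inl coord_partial_fourier2_Inl)
    next
      case (Inr k)
      show ?thesis
        by (intro exI[of _ "\<lambda>f z. 1 / (2 * pi * \<i>) * dir_deriv b f z"] conjI schwartz_continuous_cmult
            schwartz_continuous_dir_deriv[OF b]) (unfold i Inr, intro ballI allI coord_partial_fourier2_Inr)
    qed
  qed
qed

lemma partial_fourier2_schwartz:
  "f \<in> schwartz \<Longrightarrow> partial_fourier2 f \<in> schwartz"
  by (rule schwartz_continuousD[OF schwartz_continuous_partial_fourier2])

lemma partial_fourier2_add:
  assumes "f \<in> schwartz" "g \<in> schwartz"
  shows "partial_fourier2 (\<lambda>x. f x + g x) = (\<lambda>z. partial_fourier2 f z + partial_fourier2 g z)"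
  unfolding partial_fourier2_def ring_distribs
  by (intro ext Bochner_Integration.integral_add integrable_slice_cis assms)

lemma partial_fourier2_cmult:
  "partial_fourier2 (\<lambda>x. c * f x) = (\<lambda>z. c * partial_fourier2 f z)"
  unfolding partial_fourier2_def by (simp add: mult.assoc)

lemma integrable_schwartz_compose_mult:
  fixes g :: "'b \<Rightarrow> complex"
  assumes F: "F \<in> schwartz" and q[measurable]: "q \<in> borel_measurable M" and g: "integrable M g"
  shows "integrable M (\<lambda>w. F (q w) * g w)"
proof (rule Bochner_Integration.integrable_bound)
  have [measurable]: "F \<in> borel_measurable borel" "g \<in> borel_measurable M"
    using g by (auto intro: schwartz_measurable[OF F])
  show "(\<lambda>w. F (q w) * g w) \<in> borel_measurable M" by measurable
  show "integrable M (\<lambda>w. schwartz_norm 0 F *\<^sub>R g w)"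
    by (intro integrable_scaleR_right g)
  have "norm (F (q w) * g w) \<le> norm (schwartz_norm 0 F *\<^sub>R g w)" for w
    using mult_right_mono[OF schwartz_norm_bound[OF F, of "q w" 0], of "norm (g w)"] schwartz_norm_nonneg[OF F, of 0]
    by (simp add: norm_mult)
  then show "AE w in M. norm (F (q w) * g w) \<le> norm (schwartz_norm 0 F *\<^sub>R g w)" by simp
qed

lemma schwartz_mult_cnj_integrable:
  fixes F G :: "'a::euclidean_space \<Rightarrow> complex"
  assumes "F \<in> schwartz" "G \<in> schwartz"
  shows "integrable lborel (\<lambda>z. F z * cnj (G z))"
  using assms by (intro integrable_schwartz_compose_mult integrable_cnj schwartz_integrable) auto

lemma slice_continuous_on: "f \<in> schwartz \<Longrightarrow> continuous_on A (\<lambda>y. f (vjoin x y))"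
  by (rule continuous_on_compose2[OF schwartz_continuous_on[of f UNIV]]) (auto intro!: continuous_intros)

lemma fourier_slice_integrable:
  fixes f :: "real^('m::finite + 'n::finite) \<Rightarrow> complex"
  assumes "f \<in> schwartz"
  shows "integrable lborel (fourier (\<lambda>y. f (vjoin x y)))"
proof -
  have "fourier (\<lambda>y. f (vjoin x y)) = (\<lambda>y. partial_fourier2 f (vjoin x y))"
    by (simp add: partial_fourier2_eq_fourier fun_eq_iff)
  then show ?thesis
    using integrable_slice[OF partial_fourier2_schwartz[OF assms], of x] by simp
qed

lemma fourier_parseval_slice:
  fixes f :: "real^('m::finite + 'n::finite) \<Rightarrow> complex"
  assumes f: "f \<in> schwartz" and g: "integrable lborel g"
  shows "(LINT \<xi>|lborel. fourier (\<lambda>y. f (vjoin x y)) \<xi> * cnj (fourier g \<xi>)) = (LINT y|lborel. f (vjoin x y) * cnj (g y))"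
  by (rule fourier_parseval[where B = "schwartz_norm 0 f"])
    (use schwartz_norm_bound[OF f, of _ 0] in \<open>auto intro: integrable_slice slice_continuous_on fourier_slice_integrable f g\<close>)

lemma partial_fourier2_parseval:
  fixes F G :: "real^('m::finite + 'n::finite) \<Rightarrow> complex"
  assumes F: "F \<in> schwartz" and G: "G \<in> schwartz"
  shows "(LINT z|lborel. partial_fourier2 F z * cnj (partial_fourier2 G z)) = (LINT z|lborel. F z * cnj (G z))"
proof -
  have "(LINT z|lborel. partial_fourier2 F z * cnj (partial_fourier2 G z))
      = (LINT x|lborel. LINT \<xi>|lborel. partial_fourier2 F (vjoin x \<xi>) * cnj (partial_fourier2 G (vjoin x \<xi>)))"
    by (intro integral_vjoin schwartz_mult_cnj_integrable partial_fourier2_schwartz F G)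
  also have "\<dots> = (LINT x|lborel. LINT y|lborel. F (vjoin x y) * cnj (G (vjoin x y)))"
    by (simp add: partial_fourier2_eq_fourier fourier_parseval_slice[OF F integrable_slice[OF G]])
  also have "\<dots> = (LINT z|lborel. F z * cnj (G z))"
    by (intro integral_vjoin[symmetric] schwartz_mult_cnj_integrable F G)
  finally show ?thesis .
qed

section \<open>Correlation\<close>

text \<open>The function at which \<open>u\<close> is evaluated when the convolution
  \<open>dist_conv u g\<close> is tested against \<open>f\<close>.\<close>

definition correlation :: "('a::euclidean_space \<Rightarrow> complex) \<Rightarrow> ('a \<Rightarrow> complex) \<Rightarrow> 'a \<Rightarrow> complex" where
  "correlation g f = (\<lambda>x. LINT y|lborel. f y * cnj (g (y - x)))"

text \<open>With the shift on \<open>f\<close>, all derivatives in \<open>x\<close> fall on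
  \<open>f\<close>, the argument in which continuity is wanted.\<close>

lemma correlation_shift:
  assumes "f \<in> schwartz" "g \<in> schwartz"
  shows "correlation g f x = (LINT y|lborel. f (x + y) * cnj (g y))"
proof -
  have [measurable]: "f \<in> borel_measurable borel" "g \<in> borel_measurable borel"
    using assms by (auto intro: schwartz_measurable)
  show ?thesis
    unfolding correlation_def
    using integral_lborel_affine[of "\<lambda>y. f y * cnj (g (y - x))" 1 x] by simp
qed

lemma correlation_integrable:
  fixes f g :: "'a::euclidean_space \<Rightarrow> complex"
  assumes "f \<in> schwartz" "g \<in> schwartz"
  shows "integrable lborel (\<lambda>y. f (x + y) * cnj (g y))"
  using assms by (intro integrable_schwartz_compose_mult integrable_cnj schwartz_integrable) auto

lemma has_derivative_correlation:
  fixes f g :: "'a::euclidean_space \<Rightarrow> complex"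
  assumes f: "f \<in> schwartz" and g: "g \<in> schwartz"
  shows "(correlation g f has_derivative
      (\<lambda>v. LINT y|lborel. (\<Sum>b\<in>Basis. (v \<bullet> b) *\<^sub>R dir_deriv b f (x + y)) * cnj (g y))) (at x)"
proof -
  have [measurable]: "g \<in> borel_measurable borel" by (rule schwartz_measurable[OF g])
  have eq: "correlation g f = (\<lambda>x. LINT y|lborel. f (x + y) * cnj (g y))"
    by (intro ext correlation_shift f g)
  define S where "S = (\<Sum>b\<in>Basis. schwartz_norm 0 (dir_deriv b f))"
  have [measurable]: "dir_deriv b f \<in> borel_measurable borel" if "b \<in> Basis" for b
    by (intro schwartz_measurable schwartz_dir_deriv f that)
  have "((\<lambda>x. LINT y|lborel. f (x + y) * cnj (g y)) has_derivative
    (\<lambda>v. LINT y|lborel. (\<Sum>b\<in>Basis. (v \<bullet> b) *\<^sub>R dir_deriv b f (x + y)) * cnj (g y))) (at x)"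
  proof (rule has_derivative_integral_dominated[where r = 1 and g = "\<lambda>y. S * norm (g y)"])
    show "((\<lambda>x. f (x + y) * cnj (g y)) has_derivative
        (\<lambda>v. (\<Sum>b\<in>Basis. (v \<bullet> b) *\<^sub>R dir_deriv b f (x + y)) * cnj (g y))) (at x)" for x y
    proof (intro has_derivative_mult_left)
      have "((\<lambda>x. x + y) has_derivative (\<lambda>v. v)) (at x)"
        by (auto intro!: derivative_eq_intros)
      from has_derivative_compose[OF this schwartz_has_derivative[OF f]]
      show "((\<lambda>x. f (x + y)) has_derivative (\<lambda>v. \<Sum>b\<in>Basis. (v \<bullet> b) *\<^sub>R dir_deriv b f (x + y))) (at x)" .
    qed
    show "norm ((\<Sum>b\<in>Basis. (v \<bullet> b) *\<^sub>R dir_deriv b f (x + y)) * cnj (g y)) \<le> S * norm (g y) * norm v" for x y v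
    proof -
      have "norm (\<Sum>b\<in>Basis. (v \<bullet> b) *\<^sub>R dir_deriv b f (x + y)) \<le> (\<Sum>b\<in>Basis. norm v * schwartz_norm 0 (dir_deriv b f))"
      proof (rule sum_norm_le)
        fix b :: 'a assume b: "b \<in> Basis"
        have "norm (dir_deriv b f (x + y)) \<le> schwartz_norm 0 (dir_deriv b f)"
          using schwartz_norm_bound[OF schwartz_dir_deriv[OF f b], of _ 0] by simp
        then show "norm ((v \<bullet> b) *\<^sub>R dir_deriv b f (x + y)) \<le> norm v * schwartz_norm 0 (dir_deriv b f)"
          unfolding norm_scaleR by (intro mult_mono Basis_le_norm b) auto
      qed
      then have "norm (\<Sum>b\<in>Basis. (v \<bullet> b) *\<^sub>R dir_deriv b f (x + y)) \<le> S * norm v"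
        by (simp add: S_def sum_distrib_left mult.commute)
      then show ?thesis
        using mult_right_mono[of "norm (\<Sum>b\<in>Basis. (v \<bullet> b) *\<^sub>R dir_deriv b f (x + y))" "S * norm v" "norm (g y)"]
        by (simp add: norm_mult mult_ac)
    qed
    show "integrable lborel (\<lambda>y. S * norm (g y))"
      by (intro integrable_mult_right integrable_norm schwartz_integrable g)
    show "integrable lborel (\<lambda>y. f (x + y) * cnj (g y))" for x
      by (rule correlation_integrable[OF f g])
    show "(\<lambda>y. (\<Sum>b\<in>Basis. (v \<bullet> b) *\<^sub>R dir_deriv b f (x + y)) * cnj (g y)) \<in> borel_measurable borel" for v
      by measurable
  qed simp
  then show ?thesis
    by (subst eq)
qed

lemma dir_deriv_correlation:
  fixes f g :: "'a::euclidean_space \<Rightarrow> complex"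
  assumes f: "f \<in> schwartz" and g: "g \<in> schwartz" and b: "b \<in> Basis"
  shows "dir_deriv b (correlation g f) = correlation g (dir_deriv b f)"
proof -
  have "(\<Sum>c\<in>Basis. (b \<bullet> c) *\<^sub>R dir_deriv c f z) = dir_deriv b f z" for z
    using b by (simp add: inner_Basis if_distrib[where f = "\<lambda>t. t *\<^sub>R _"] cong: if_cong)
  then show ?thesis
    unfolding dir_deriv_eq[OF has_derivative_correlation[OF f g]]
    by (simp add: fun_eq_iff correlation_shift[OF schwartz_dir_deriv[OF f b] g])
qed

lemma foldr_dir_deriv_correlation:
  fixes f g :: "'a::euclidean_space \<Rightarrow> complex"
  assumes "f \<in> schwartz" "g \<in> schwartz" "set vs \<subseteq> Basis"
  shows "foldr dir_deriv vs (correlation g f) = correlation g (foldr dir_deriv vs f)"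
  using assms by (induction vs) (auto simp: dir_deriv_correlation schwartz_foldr_dir_deriv)

text \<open>The weight at \<open>x\<close> is split between \<open>x + y\<close> and
  \<open>y\<close>: the first part is absorbed by a seminorm of \<open>f\<close>, the second by a
  weighted integral of \<open>g\<close>, which is the constant of the estimate.\<close>

theorem schwartz_continuous_correlation:
  fixes g :: "'a::euclidean_space \<Rightarrow> complex"
  assumes g: "g \<in> schwartz"
  shows "schwartz_continuous (correlation g)"
proof (rule schwartz_continuousI')
  show "correlation g f differentiable at x" if "f \<in> schwartz" for f x
    using has_derivative_correlation[OF that g] unfolding differentiable_def by blast
  show "\<exists>D. schwartz_continuous D \<and> (\<forall>f\<in>schwartz. dir_deriv b (correlation g f) = correlation g (D f))"
    if b: "b \<in> Basis" for b
    by (intro exI[of _ "dir_deriv b"] conjI ballI schwartz_continuous_dir_deriv b dir_deriv_correlation g)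
  fix N
  have "(1 + norm x) ^ N * norm (correlation g f x) \<le> (LINT y|lborel. (1 + norm y) ^ N * norm (g y)) * schwartz_norm N f"
    if f: "f \<in> schwartz" for f x
  proof -
    have i: "integrable lborel (\<lambda>y. (1 + norm y) ^ N * norm (g y))"
      by (rule schwartz_integrable_weighted[OF g])
    have "(1 + norm x) ^ N * norm (correlation g f x) \<le> (1 + norm x) ^ N * (LINT y|lborel. norm (f (x + y) * cnj (g y)))"
      unfolding correlation_shift[OF f g] by (intro mult_left_mono integral_norm_bound) auto
    also have "\<dots> = (LINT y|lborel. (1 + norm x) ^ N * norm (f (x + y) * cnj (g y)))"
      by simp
    also have "\<dots> \<le> (LINT y|lborel. schwartz_norm N f * ((1 + norm y) ^ N * norm (g y)))"
    proof (rule integral_mono)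
      fix y
      have "(1 + norm x) ^ N \<le> (1 + norm (x + y)) ^ N * (1 + norm y) ^ N"
        using one_plus_norm_power_le[of "x + y" "- y" N] by simp
      then have "(1 + norm x) ^ N * norm (f (x + y) * cnj (g y))
          \<le> ((1 + norm (x + y)) ^ N * (1 + norm y) ^ N) * norm (f (x + y) * cnj (g y))"
        by (rule mult_right_mono) simp
      also have "\<dots> = ((1 + norm (x + y)) ^ N * norm (f (x + y))) * ((1 + norm y) ^ N * norm (g y))"
        by (simp add: norm_mult mult_ac)
      also have "\<dots> \<le> schwartz_norm N f * ((1 + norm y) ^ N * norm (g y))"
        by (intro mult_right_mono schwartz_norm_bound f) auto
      finally show "(1 + norm x) ^ N * norm (f (x + y) * cnj (g y)) \<le> \<dots>" .
    qed (intro integrable_mult_right integrable_norm correlation_integrable f g i)+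
    also have "\<dots> = (LINT y|lborel. (1 + norm y) ^ N * norm (g y)) * schwartz_norm N f"
      by simp
    finally show ?thesis .
  qed
  then show "\<exists>M C. \<forall>f\<in>schwartz. \<forall>x. (1 + norm x) ^ N * norm (correlation g f x) \<le> C * schwartz_norm M f"
    by blast
qed

text \<open>A shift of the frequency is a modulation before the transform, so on each slice
  Parseval's identity removes both transforms at once. The modulation left over is conjugated and
  becomes the character of a Fourier transform in \<open>y\<close>; an exchange of integrals brings
  the \<open>y\<close> integral outside.\<close>

lemma correlation_partial_fourier2:
  fixes f g :: "real^('m::finite + 'n::finite) \<Rightarrow> complex"
  assumes f: "f \<in> schwartz" and g: "g \<in> schwartz"
  shows "correlation (partial_fourier2 g) (partial_fourier2 f)
    = partial_fourier2 (\<lambda>z. LINT t|lborel. cnj (g (vjoin t (vsnd z))) * f (vjoin (vfst z + t) (vsnd z)))"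
proof
  fix w :: "real^('m + 'n)"
  let ?x = "vfst w" and ?\<xi> = "vsnd w"
  have vj: "vjoin x \<eta> - w = vjoin (x - ?x) (\<eta> - ?\<xi>)" for x \<eta>
    by (simp add: vec_eq_iff vjoin_def vfst_def vsnd_def split: sum.split)
  \<comment> \<open>Carries the frequency shift by the second block of \<open>w\<close>.\<close>
  define M where "M y = cis (2 * pi * (?\<xi> \<bullet> y))" for y
  have M[measurable]: "M \<in> borel_measurable borel" unfolding M_def[abs_def] by measurable
  have mod: "fourier h (\<eta> - ?\<xi>) = fourier (\<lambda>y. h y * M y) \<eta>" for h \<eta>
    unfolding fourier_def M_def
    by (simp add: mult.assoc cis_mult inner_diff_left algebra_simps)
  have gM: "integrable lborel (\<lambda>y. g (vjoin x y) * M y)" for x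
    by (rule Bochner_Integration.integrable_bound[OF integrable_slice[OF g, of x]])
      (use measurable_slice[OF g] in \<open>auto simp: norm_mult M_def\<close>)
  have g': "(\<lambda>z. partial_fourier2 g (z - w)) \<in> schwartz"
    using schwartz_continuousD[OF schwartz_continuous_translate partial_fourier2_schwartz[OF g], of "- w"] by simp
  have "correlation (partial_fourier2 g) (partial_fourier2 f) w
      = (LINT x|lborel. LINT \<eta>|lborel. partial_fourier2 f (vjoin x \<eta>) * cnj (partial_fourier2 g (vjoin x \<eta> - w)))"
    unfolding correlation_def
    by (intro integral_vjoin schwartz_mult_cnj_integrable partial_fourier2_schwartz f g')
  also have "\<dots> = (LINT x|lborel. LINT y|lborel. f (vjoin x y) * cnj (g (vjoin (x - ?x) y) * M y))"
    unfolding vj partial_fourier2_eq_fourier vfst_vjoin vsnd_vjoin mod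
    by (simp only: fourier_parseval_slice[OF f gM])
  also have "\<dots> = (LINT t|lborel. LINT y|lborel. f (vjoin (?x + t) y) * cnj (g (vjoin t y) * M y))"
  proof -
    let ?H = "\<lambda>x. LINT y|lborel. f (vjoin x y) * cnj (g (vjoin (x - ?x) y) * M y)"
    have [measurable]: "f \<in> borel_measurable borel" "g \<in> borel_measurable borel"
      using f g by (auto intro: schwartz_measurable)
    have "?H \<in> borel_measurable borel" by measurable
    from integral_lborel_affine[OF this, of 1 ?x] show ?thesis by simp
  qed
  also have "\<dots> = (LINT y|lborel. LINT t|lborel. f (vjoin (?x + t) y) * cnj (g (vjoin t y) * M y))"
  proof (rule lborel_pair.Fubini_integral[symmetric])
    have [measurable]: "f \<in> borel_measurable borel" "g \<in> borel_measurable borel"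
      using f g by (auto intro: schwartz_measurable)
    have "integrable (lborel \<Otimes>\<^sub>M lborel) (\<lambda>(t, y). g (vjoin t y) * M y)"
    proof (rule Bochner_Integration.integrable_bound[OF integrable_vjoin[OF schwartz_integrable[OF g]]])
      show "AE p in lborel \<Otimes>\<^sub>M lborel. norm (case p of (t, y) \<Rightarrow> g (vjoin t y) * M y) \<le> norm (case p of (t, y) \<Rightarrow> g (vjoin t y))"
        by (intro always_eventually) (auto simp: norm_mult M_def)
    qed measurable
    then have "integrable (lborel \<Otimes>\<^sub>M lborel) (\<lambda>p. f (vjoin (?x + fst p) (snd p)) * cnj (case p of (t, y) \<Rightarrow> g (vjoin t y) * M y))"
      by (intro integrable_schwartz_compose_mult f integrable_cnj) measurable
    then show "integrable (lborel \<Otimes>\<^sub>M lborel) (\<lambda>(t, y). f (vjoin (?x + t) y) * cnj (g (vjoin t y) * M y))"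
      by (simp add: case_prod_unfold)
  qed
  also have "\<dots> = partial_fourier2 (\<lambda>z. LINT t|lborel. cnj (g (vjoin t (vsnd z))) * f (vjoin (vfst z + t) (vsnd z))) w"
    unfolding partial_fourier2_def vfst_vjoin vsnd_vjoin
  proof (rule Bochner_Integration.integral_cong[OF refl])
    fix y
    have "f (vjoin (?x + t) y) * cnj (g (vjoin t y) * M y)
        = (cnj (g (vjoin t y)) * f (vjoin (?x + t) y)) * cis (- 2 * pi * (?\<xi> \<bullet> y))" for t
      by (simp add: M_def cis_cnj mult_ac)
    then show "(LINT t|lborel. f (vjoin (?x + t) y) * cnj (g (vjoin t y) * M y))
        = (LINT t|lborel. cnj (g (vjoin t y)) * f (vjoin (?x + t) y)) * cis (- 2 * pi * (?\<xi> \<bullet> y))"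
      by (simp only: integral_mult_left_zero)
  qed
  finally show "correlation (partial_fourier2 g) (partial_fourier2 f) w = \<dots>" .
qed

section \<open>Tempered distributions are determined by their values on tensor products\<close>

lemma tempered_add: "u \<in> tempered \<Longrightarrow> f \<in> schwartz \<Longrightarrow> g \<in> schwartz \<Longrightarrow> u (\<lambda>x. f x + g x) = u f + u g"
  and tempered_cmult: "u \<in> tempered \<Longrightarrow> f \<in> schwartz \<Longrightarrow> u (\<lambda>x. c * f x) = cnj c * u f"
  by (simp_all add: tempered_def)

lemma tempered_zero: "u \<in> tempered \<Longrightarrow> u (\<lambda>x. 0) = 0"
  using tempered_cmult[of u "\<lambda>x. 0" 0] by simp

lemma tempered_bound:
  assumes "u \<in> tempered"
  obtains N C where "0 \<le> C" "\<And>f. f \<in> schwartz \<Longrightarrow> norm (u f) \<le> C * schwartz_norm N f"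
proof -
  obtain N C where NC: "\<And>f. f \<in> schwartz \<Longrightarrow> norm (u f) \<le> C * schwartz_norm N f"
    using assms unfolding tempered_def by blast
  have "norm (u f) \<le> \<bar>C\<bar> * schwartz_norm N f" if "f \<in> schwartz" for f
    using NC[OF that] mult_right_mono[OF abs_ge_self[of C] schwartz_norm_nonneg[OF that, of N]] by linarith
  then show thesis by (intro that[of "\<bar>C\<bar>" N]) auto
qed

lemma tempered_sum:
  assumes u: "u \<in> tempered" and f: "\<And>i. i \<in> I \<Longrightarrow> f i \<in> schwartz"
  shows "u (\<lambda>x. \<Sum>i\<in>I. c i * f i x) = (\<Sum>i\<in>I. cnj (c i) * u (f i))"
  using f
  by (induction I rule: infinite_finite_induct)
    (auto simp: tempered_zero[OF u] tempered_add[OF u] tempered_cmult[OF u] schwartz_sum schwartz_cmult)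

lemma tempered_diff:
  assumes "u \<in> tempered" "f \<in> schwartz" "g \<in> schwartz"
  shows "u (\<lambda>x. f x - g x) = u f - u g"
  using tempered_add[OF assms(1,2) schwartz_cmult[OF assms(3), of "-1"]] tempered_cmult[OF assms(1,3), of "-1"] by simp

lemma tempered_compose:
  assumes u: "u \<in> tempered" and T: "schwartz_continuous T"
    and add: "\<And>f g. f \<in> schwartz \<Longrightarrow> g \<in> schwartz \<Longrightarrow> T (\<lambda>x. f x + g x) = (\<lambda>x. T f x + T g x)"
    and cmult: "\<And>c f. f \<in> schwartz \<Longrightarrow> T (\<lambda>x. c * f x) = (\<lambda>x. c * T f x)"
  shows "(\<lambda>f. u (T f)) \<in> tempered"
proof -
  obtain N C where NC: "0 \<le> C" "\<And>f. f \<in> schwartz \<Longrightarrow> norm (u f) \<le> C * schwartz_norm N f"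
    using tempered_bound[OF u] by metis
  obtain M D where MD: "\<And>f. f \<in> schwartz \<Longrightarrow> schwartz_norm N (T f) \<le> D * schwartz_norm M f"
    using schwartz_continuous_norm[OF T] by metis
  have "norm (u (T f)) \<le> (C * D) * schwartz_norm M f" if "f \<in> schwartz" for f
    using NC(2)[OF schwartz_continuousD[OF T that]] mult_left_mono[OF MD[OF that] NC(1)] by (simp add: mult.assoc)
  then show ?thesis
    unfolding tempered_def
    by (auto simp: add cmult tempered_add[OF u] tempered_cmult[OF u] schwartz_continuousD[OF T])
qed

text \<open>The mean value inequality on the segment from \<open>x + w\<close> to
  \<open>x + w'\<close>. It uses one more derivative, hence \<open>Suc N\<close>;
  \<open>DIM('a)\<close> counts the partial derivatives; points of the segment lie within
  \<open>norm w + norm w'\<close> of \<open>x\<close>, and moving the weight to them costs the power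
  of \<open>1 + norm w + norm w'\<close>.\<close>

lemma schwartz_translate_lipschitz:
  fixes f :: "'a::euclidean_space \<Rightarrow> complex"
  assumes f: "f \<in> schwartz" and vs: "set vs \<subseteq> Basis" "length vs \<le> N"
  shows "(1 + norm x) ^ N * norm (foldr dir_deriv vs f (x + w) - foldr dir_deriv vs f (x + w'))
    \<le> DIM('a) * schwartz_norm (Suc N) f * (1 + norm w + norm w') ^ N * norm (w - w')"
proof -
  let ?F = "foldr dir_deriv vs f"
  let ?K = "DIM('a) * schwartz_norm (Suc N) f * (1 + norm w + norm w') ^ N"
  have F: "?F \<in> schwartz" by (rule schwartz_foldr_dir_deriv[OF f vs(1)])
  have p: "(1 + norm x) ^ N > 0" by (simp add: add_pos_nonneg)
  have "norm (?F (x + w) - ?F (x + w')) \<le> ?K / (1 + norm x) ^ N * norm (x + w - (x + w'))"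
  proof (rule differentiable_bound[of "closed_segment (x + w) (x + w')"])
    fix y assume y: "y \<in> closed_segment (x + w) (x + w')"
    show "(?F has_derivative (\<lambda>v. \<Sum>b\<in>Basis. (v \<bullet> b) *\<^sub>R dir_deriv b ?F y)) (at y within closed_segment (x + w) (x + w'))"
      by (rule has_derivative_at_withinI[OF schwartz_has_derivative[OF F]])
    obtain t where t: "0 \<le> t" "t \<le> 1" "y = (1 - t) *\<^sub>R (x + w) + t *\<^sub>R (x + w')"
      using y by (auto simp: closed_segment_def)
    then have y': "x = y - ((1 - t) *\<^sub>R w + t *\<^sub>R w')"
      by (simp add: algebra_simps)
    have "norm ((1 - t) *\<^sub>R w + t *\<^sub>R w') \<le> norm w + norm w'"
    proof (rule order_trans[OF norm_triangle_ineq])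
      have "(1 - t) * norm w \<le> 1 * norm w" "t * norm w' \<le> 1 * norm w'"
        using t by (intro mult_right_mono; simp)+
      then show "norm ((1 - t) *\<^sub>R w) + norm (t *\<^sub>R w') \<le> norm w + norm w'"
        using t by simp
    qed
    then have "(1 + norm y) * (1 + norm ((1 - t) *\<^sub>R w + t *\<^sub>R w')) \<le> (1 + norm y) * (1 + norm w + norm w')"
      by (intro mult_left_mono) auto
    with one_plus_norm_le[of y "- ((1 - t) *\<^sub>R w + t *\<^sub>R w')"]
    have "1 + norm x \<le> (1 + norm y) * (1 + norm w + norm w')"
      unfolding y' norm_minus_cancel diff_conv_add_uminus by linarith
    then have "(1 + norm x) ^ N \<le> ((1 + norm y) * (1 + norm w + norm w')) ^ N"
      by (intro power_mono) auto
    then have le: "(1 + norm x) ^ N \<le> (1 + norm y) ^ N * (1 + norm w + norm w') ^ N"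
      by (simp add: power_mult_distrib)
    have d: "norm (dir_deriv b ?F y) \<le> schwartz_norm (Suc N) f * (1 + norm w + norm w') ^ N / (1 + norm x) ^ N"
      if b: "b \<in> Basis" for b
    proof -
      have "(1 + norm y) ^ N * norm (dir_deriv b ?F y) \<le> (1 + norm y) ^ Suc N * norm (dir_deriv b ?F y)"
        by (intro mult_right_mono power_increasing) auto
      also have "\<dots> \<le> schwartz_norm (Suc N) f"
        using schwartz_norm_upper[OF f, of "b # vs" "Suc N" y] b vs by simp
      finally have 1: "(1 + norm y) ^ N * norm (dir_deriv b ?F y) \<le> schwartz_norm (Suc N) f" .
      have "(1 + norm x) ^ N * norm (dir_deriv b ?F y) \<le> ((1 + norm y) ^ N * (1 + norm w + norm w') ^ N) * norm (dir_deriv b ?F y)"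
        by (intro mult_right_mono le) auto
      also have "\<dots> = ((1 + norm y) ^ N * norm (dir_deriv b ?F y)) * (1 + norm w + norm w') ^ N"
        by (simp add: mult_ac)
      also have "\<dots> \<le> schwartz_norm (Suc N) f * (1 + norm w + norm w') ^ N"
        by (intro mult_right_mono 1) auto
      finally show ?thesis
        using p by (simp add: pos_le_divide_eq mult.commute)
    qed
    show "onorm (\<lambda>v. \<Sum>b\<in>Basis. (v \<bullet> b) *\<^sub>R dir_deriv b ?F y) \<le> ?K / (1 + norm x) ^ N"
    proof (rule onorm_bound)
      show "0 \<le> ?K / (1 + norm x) ^ N"
        using schwartz_norm_nonneg[OF f] by (intro divide_nonneg_nonneg mult_nonneg_nonneg) auto
      fix v :: 'a
      have "norm (\<Sum>b\<in>Basis. (v \<bullet> b) *\<^sub>R dir_deriv b ?F y)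
          \<le> (\<Sum>b\<in>(Basis::'a set). norm v * (schwartz_norm (Suc N) f * (1 + norm w + norm w') ^ N / (1 + norm x) ^ N))"
        by (rule sum_norm_le) (unfold norm_scaleR, intro mult_mono Basis_le_norm d, auto)
      then show "norm (\<Sum>b\<in>Basis. (v \<bullet> b) *\<^sub>R dir_deriv b ?F y) \<le> ?K / (1 + norm x) ^ N * norm v"
        by (simp add: mult_ac)
    qed
  qed auto
  then have "norm (?F (x + w) - ?F (x + w')) \<le> ?K * norm (w - w') / (1 + norm x) ^ N"
    by simp
  then show ?thesis
    using p by (simp add: pos_le_divide_eq mult.commute)
qed

text \<open>Serves two limits: in one, \<open>q\<close> is a simple function approximating
  \<open>p w = w\<close>; in the other, \<open>p w = 0\<close> and
  \<open>q w = (1 / c) *\<^sub>R w\<close>. Each is the preceding Lipschitz estimate integrated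
  against \<open>g\<close>.\<close>

lemma schwartz_norm_integral_difference_le:
  fixes f h :: "'a::euclidean_space \<Rightarrow> complex" and p q :: "'b::euclidean_space \<Rightarrow> 'a"
  assumes f: "f \<in> schwartz" and [measurable]: "p \<in> borel_measurable borel" "q \<in> borel_measurable borel"
    and g: "integrable lborel g"
    and h: "\<And>vs x. set vs \<subseteq> Basis \<Longrightarrow> foldr dir_deriv vs h x
      = (LINT w|lborel. foldr dir_deriv vs f (x + p w) * g w) - (LINT w|lborel. foldr dir_deriv vs f (x + q w) * g w)"
    and w: "integrable lborel (\<lambda>w. (1 + norm (p w) + norm (q w)) ^ N * norm (p w - q w) * norm (g w))"
  shows "schwartz_norm N h \<le> DIM('a) * schwartz_norm (Suc N) f
    * (LINT w|lborel. (1 + norm (p w) + norm (q w)) ^ N * norm (p w - q w) * norm (g w))"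
proof (rule schwartz_norm_least)
  fix vs :: "'a list" and x assume vs: "set vs \<subseteq> Basis" "length vs \<le> N"
  let ?F = "foldr dir_deriv vs f" and ?K = "DIM('a) * schwartz_norm (Suc N) f"
  have i: "integrable lborel (\<lambda>w. ?F (x + r w) * g w)" if [measurable]: "r \<in> borel_measurable borel" for r
    by (intro integrable_schwartz_compose_mult schwartz_foldr_dir_deriv f vs g) measurable
  have "foldr dir_deriv vs h x = (LINT w|lborel. (?F (x + p w) - ?F (x + q w)) * g w)"
    unfolding h[OF vs(1)] left_diff_distrib by (intro Bochner_Integration.integral_diff[symmetric] i) measurable
  then have "(1 + norm x) ^ N * norm (foldr dir_deriv vs h x)
      \<le> (1 + norm x) ^ N * (LINT w|lborel. norm ((?F (x + p w) - ?F (x + q w)) * g w))"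
    by (simp only:) (intro mult_left_mono integral_norm_bound, auto)
  also have "\<dots> = (LINT w|lborel. (1 + norm x) ^ N * norm ((?F (x + p w) - ?F (x + q w)) * g w))"
    by simp
  also have "\<dots> \<le> (LINT w|lborel. ?K * ((1 + norm (p w) + norm (q w)) ^ N * norm (p w - q w) * norm (g w)))"
  proof (rule integral_mono)
    show "integrable lborel (\<lambda>w. (1 + norm x) ^ N * norm ((?F (x + p w) - ?F (x + q w)) * g w))"
      unfolding left_diff_distrib
      by (intro integrable_mult_right integrable_norm Bochner_Integration.integrable_diff i) measurable
    show "(1 + norm x) ^ N * norm ((?F (x + p w) - ?F (x + q w)) * g w)
        \<le> ?K * ((1 + norm (p w) + norm (q w)) ^ N * norm (p w - q w) * norm (g w))" for w
      using mult_right_mono[OF schwartz_translate_lipschitz[OF f vs, of x "p w" "q w"], of "norm (g w)"]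
      by (simp add: norm_mult mult.assoc)
  qed (intro integrable_mult_right w)
  also have "\<dots> = ?K * (LINT w|lborel. (1 + norm (p w) + norm (q w)) ^ N * norm (p w - q w) * norm (g w))"
    by (rule integral_mult_right_zero)
  finally show "(1 + norm x) ^ N * norm (foldr dir_deriv vs h x) \<le> \<dots>" .
qed

text \<open>The correlation is the limit, in every seminorm, of finite linear combinations of translates
  of \<open>f\<close>: replace the integration variable by simple functions converging to the identity.\<close>

lemma tempered_correlation_eq_0:
  fixes f g :: "'a::euclidean_space \<Rightarrow> complex"
  assumes u: "u \<in> tempered" and f: "f \<in> schwartz" and g: "g \<in> schwartz"
    and zero: "\<And>w. u (\<lambda>x. f (x + w)) = 0"
  shows "u (correlation g f) = 0"
proof -
  obtain N C where NC: "0 \<le> C" "\<And>f. f \<in> schwartz \<Longrightarrow> norm (u f) \<le> C * schwartz_norm N f"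
    using tempered_bound[OF u] by metis
  obtain s :: "nat \<Rightarrow> 'a \<Rightarrow> 'a" where s: "\<And>i. simple_function lborel (s i)" "\<And>w. (\<lambda>i. s i w) \<longlonglongrightarrow> w"
      "\<And>i w. dist (s i w) 0 \<le> 2 * dist w 0"
    using borel_measurable_implies_sequence_metric[of "\<lambda>w::'a. w" lborel 0] by auto
  have [measurable]: "s i \<in> borel_measurable borel" for i
    using borel_measurable_simple_function[OF s(1)[of i]] by simp
  have sn: "norm (s i w) \<le> 2 * norm w" for i w using s(3)[of i w] by simp
  have [measurable]: "g \<in> borel_measurable borel" by (rule schwartz_measurable[OF g])
  let ?E = "\<lambda>i w. (1 + norm w + norm (s i w)) ^ N * norm (w - s i w) * norm (g w)"
  define e where "e i = DIM('a) * schwartz_norm (Suc N) f * (LINT w|lborel. ?E i w)" for i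
  \<comment> \<open>The simple functions satisfy \<open>norm (s i w) \<le> 2 * norm w\<close>, so
    each of the \<open>Suc N\<close> factors of \<open>?E i w\<close> before
    \<open>norm (g w)\<close> is at most \<open>3 * (1 + norm w)\<close>.\<close>
  let ?D = "\<lambda>w. 3 ^ Suc N * ((1 + norm w) ^ Suc N * norm (g w))"
  have D: "integrable lborel ?D"
    by (intro integrable_mult_right schwartz_integrable_weighted g)
  have ED: "norm (?E i w) \<le> ?D w" for i w
  proof -
    have 1: "1 + norm w + norm (s i w) \<le> 3 * (1 + norm w)" using sn[of i w] by simp
    have 2: "norm (w - s i w) \<le> 3 * (1 + norm w)"
      using norm_triangle_ineq4[of w "s i w"] sn[of i w] by simp
    have "?E i w \<le> (3 * (1 + norm w)) ^ N * (3 * (1 + norm w)) * norm (g w)"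
      by (intro mult_mono power_mono 1 2 mult_nonneg_nonneg) auto
    also have "\<dots> = ?D w" by (simp only: power_mult_distrib power_Suc mult_ac)
    finally have "?E i w \<le> ?D w" .
    moreover have "0 \<le> ?E i w" by (intro mult_nonneg_nonneg) auto
    ultimately show ?thesis by (simp only: real_norm_def abs_of_nonneg)
  qed
  have E: "integrable lborel (?E i)" for i
  proof (rule Bochner_Integration.integrable_bound[OF D])
    show "?E i \<in> borel_measurable lborel" by measurable
    show "AE w in lborel. norm (?E i w) \<le> norm (?D w)"
      unfolding real_norm_def by (intro AE_I2 order_trans[OF ED[unfolded real_norm_def] abs_ge_self])
  qed
  have "(\<lambda>i. LINT w|lborel. ?E i w) \<longlonglongrightarrow> (LINT w|(lborel::'a measure). 0)"
  proof (rule integral_dominated_convergence[where w = ?D])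
    have "(\<lambda>i. ?E i w) \<longlonglongrightarrow> (1 + norm w + norm w) ^ N * norm (w - w) * norm (g w)" for w
      by (intro tendsto_intros s(2))
    then show "AE w in lborel. (\<lambda>i. ?E i w) \<longlonglongrightarrow> 0" by simp
  qed (use D ED in auto)
  then have e0: "e \<longlonglongrightarrow> 0"
    unfolding e_def[abs_def] by (auto intro: tendsto_mult_right_zero)
  have "norm (u (correlation g f)) \<le> C * e i" for i
  proof -
    let ?V = "s i ` UNIV"
    have V: "finite ?V" using simple_functionD(1)[OF s(1)[of i]] by simp
    have sv: "s i -` {v} \<in> sets borel" for v
      using measurable_sets[of "s i" borel borel "{v}"] by simp
    \<comment> \<open>The mass of \<open>cnj g\<close> on the level set of \<open>s i\<close> at
      \<open>v\<close>. With these coefficients the finite sum of translates is an integral against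
      \<open>cnj g\<close> with displacement \<open>s i w\<close>.\<close>
    define c where "c v = (LINT w|lborel. indicator (s i -` {v}) w * cnj (g w))" for v
    have gi: "integrable lborel (\<lambda>w. indicator (s i -` {v}) w * cnj (g w))" for v
      using integrable_mult_indicator[of "s i -` {v}" lborel "\<lambda>w. cnj (g w)"] schwartz_integrable[OF g] sv[of v]
      by (simp add: scaleR_conv_of_real of_real_indicator)
    let ?R = "\<lambda>x. \<Sum>v\<in>?V. c v * f (x + v)"
    have fv: "(\<lambda>x. f (x + v)) \<in> schwartz" for v
      by (rule schwartz_continuousD[OF schwartz_continuous_translate f])
    have R: "?R \<in> schwartz"
      by (intro schwartz_sum schwartz_cmult fv)
    have uR: "u ?R = 0"
      unfolding tempered_sum[OF u fv] by (simp add: zero)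
    have sum: "(\<Sum>v\<in>?V. c v * F (x + v)) = (LINT w|lborel. F (x + s i w) * cnj (g w))" for F :: "'a \<Rightarrow> complex" and x
    proof -
      have "(\<Sum>v\<in>?V. c v * F (x + v)) = (LINT w|lborel. (\<Sum>v\<in>?V. F (x + v) * (indicator (s i -` {v}) w * cnj (g w))))"
        unfolding c_def
        by (subst Bochner_Integration.integral_sum)
          (intro integrable_mult_right gi, simp only: integral_mult_right_zero mult.commute[of _ "F _"])
      also have "\<dots> = (LINT w|lborel. F (x + s i w) * cnj (g w))"
      proof (rule Bochner_Integration.integral_cong[OF refl])
        fix w
        have "(\<Sum>v\<in>?V. F (x + v) * (indicator (s i -` {v}) w * cnj (g w)))
            = (\<Sum>v\<in>?V. if s i w = v then F (x + v) * cnj (g w) else 0)"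
          by (intro sum.cong) (auto simp: indicator_def)
        also have "\<dots> = F (x + s i w) * cnj (g w)"
          using V by (subst sum.delta') auto
        finally show "(\<Sum>v\<in>?V. F (x + v) * (indicator (s i -` {v}) w * cnj (g w))) = F (x + s i w) * cnj (g w)" .
      qed
      finally show ?thesis .
    qed
    have cf: "correlation g f \<in> schwartz"
      by (rule schwartz_continuousD[OF schwartz_continuous_correlation[OF g] f])
    have "norm (u (correlation g f)) = norm (u (\<lambda>x. correlation g f x + - 1 * ?R x))"
      using tempered_diff[OF u cf R] uR by simp
    also have "\<dots> \<le> C * schwartz_norm N (\<lambda>x. correlation g f x + - 1 * ?R x)"
      by (intro NC schwartz_add schwartz_cmult cf R)
    also have "schwartz_norm N (\<lambda>x. correlation g f x + - 1 * ?R x) \<le> e i"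
      unfolding e_def complex_mod_cnj[of "g _", symmetric]
    proof (rule schwartz_norm_integral_difference_le[OF f])
      fix vs :: "'a list" and x assume vs: "set vs \<subseteq> Basis"
      have F: "foldr dir_deriv vs f \<in> schwartz" by (rule schwartz_foldr_dir_deriv[OF f vs])
      show "foldr dir_deriv vs (\<lambda>x. correlation g f x + - 1 * ?R x) x
          = (LINT w|lborel. foldr dir_deriv vs f (x + w) * cnj (g w)) - (LINT w|lborel. foldr dir_deriv vs f (x + s i w) * cnj (g w))"
        by (simp only: foldr_dir_deriv_add[OF cf schwartz_cmult[OF R] vs] foldr_dir_deriv_cmult[OF R vs]
            foldr_dir_deriv_correlation[OF f g vs] foldr_dir_deriv_sum[OF schwartz_cmult[OF fv] vs]
            foldr_dir_deriv_cmult[OF fv vs] foldr_dir_deriv_translate[OF f vs])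
            (simp add: correlation_shift[OF F g] sum)
    qed (use E schwartz_integrable[OF g] in auto)
    finally show ?thesis using NC(1) by (simp add: mult_left_mono)
  qed
  moreover have "(\<lambda>i. C * e i) \<longlonglongrightarrow> C * 0"
    by (intro tendsto_intros e0)
  ultimately have "norm (u (correlation g f)) \<le> C * 0"
    by (intro LIMSEQ_le_const) auto
  then show ?thesis by simp
qed

text \<open>After rescaling, the correlation averages the translates of \<open>f\<close> by
  \<open>(1 / c) *\<^sub>R w\<close> against the probability density \<open>gauss w\<close>. It
  therefore differs from \<open>f\<close> by a constant times \<open>1 / c\<close> in each
  seminorm.\<close>

lemma tempered_approximate_identity:
  fixes f :: "'a::euclidean_space \<Rightarrow> complex"
  assumes u: "u \<in> tempered" and f: "f \<in> schwartz"
    and zero: "\<And>c. c > 0 \<Longrightarrow> u (correlation (\<lambda>x. complex_of_real (c ^ DIM('a)) * gauss (c *\<^sub>R x)) f) = 0"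
  shows "u f = 0"
proof -
  obtain N C where NC: "0 \<le> C" "\<And>f. f \<in> schwartz \<Longrightarrow> norm (u f) \<le> C * schwartz_norm N f"
    using tempered_bound[OF u] by metis
  let ?G = "\<lambda>c x::'a. complex_of_real (c ^ DIM('a)) * gauss (c *\<^sub>R x)"
  let ?K = "DIM('a) * schwartz_norm (Suc N) f"
  define J where "J = (LINT w|lborel. (1 + norm (w::'a)) ^ Suc N * norm (gauss w))"
  have G: "?G c \<in> schwartz" if "c > 0" for c
    using that by (intro schwartz_cmult schwartz_continuousD[OF schwartz_continuous_linear gauss_schwartz])
      (auto intro: injI linear_scaleR)
  have corr: "correlation (?G c) h x = (LINT w|lborel. h (x + (1 / c) *\<^sub>R w) * gauss w)"
    if h: "h \<in> schwartz" and c: "c > 0" for h x c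
  proof -
    have [measurable]: "h \<in> borel_measurable borel" by (rule schwartz_measurable[OF h])
    have "correlation (?G c) h x = (LINT y|lborel. complex_of_real (c ^ DIM('a)) * (h (x + (1 / c) *\<^sub>R (0 + c *\<^sub>R y)) * gauss (0 + c *\<^sub>R y)))"
      unfolding correlation_shift[OF h G[OF c]] using c by (simp add: gauss_def mult_ac)
    also have "\<dots> = complex_of_real (c ^ DIM('a)) * (LINT y|lborel. h (x + (1 / c) *\<^sub>R (0 + c *\<^sub>R y)) * gauss (0 + c *\<^sub>R y))"
      by (rule integral_mult_right_zero)
    also have "(LINT y|lborel. h (x + (1 / c) *\<^sub>R (0 + c *\<^sub>R y)) * gauss (0 + c *\<^sub>R y))
        = (1 / \<bar>c\<bar> ^ DIM('a)) *\<^sub>R (LINT w|lborel. h (x + (1 / c) *\<^sub>R w) * gauss w)"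
      by (rule integral_lborel_affine[of "\<lambda>w. h (x + (1 / c) *\<^sub>R w) * gauss w"]) (use c in auto)
    finally show ?thesis using c by (simp add: scaleR_conv_of_real)
  qed
  have J: "integrable lborel (\<lambda>w::'a. (1 + norm w) ^ Suc N * norm (gauss w))"
    by (rule schwartz_integrable_weighted[OF gauss_schwartz])
  have "norm (u f) \<le> C * (1 / real (Suc n) * (?K * J))" for n
  proof -
    define c where "c = real (Suc n)"
    have c: "c > 0" "1 / c \<le> 1" by (auto simp: c_def)
    have cf: "correlation (?G c) f \<in> schwartz"
      by (rule schwartz_continuousD[OF schwartz_continuous_correlation[OF G[OF c(1)]] f])
    have "norm (u f) = norm (u (\<lambda>x. f x + - 1 * correlation (?G c) f x))"
      using tempered_diff[OF u f cf] zero[OF c(1)] by simp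
    also have "\<dots> \<le> C * schwartz_norm N (\<lambda>x. f x + - 1 * correlation (?G c) f x)"
      by (intro NC schwartz_add schwartz_cmult cf f)
    also have "schwartz_norm N (\<lambda>x. f x + - 1 * correlation (?G c) f x) \<le> 1 / c * (?K * J)"
    proof -
      let ?E = "\<lambda>w::'a. (1 + norm (0::'a) + norm ((1 / c) *\<^sub>R w)) ^ N * norm (0 - (1 / c) *\<^sub>R w) * norm (gauss w)"
      have E: "?E w \<le> 1 / c * ((1 + norm w) ^ Suc N * norm (gauss w))" for w
      proof -
        have cw: "norm ((1 / c) *\<^sub>R w) \<le> norm w"
          using mult_right_mono[OF c(2), of "norm w"] c by simp
        have "?E w = (1 + norm ((1 / c) *\<^sub>R w)) ^ N * (1 / c * norm w) * norm (gauss w)"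
          using c by simp
        also have "\<dots> \<le> (1 + norm w) ^ N * (1 / c * (1 + norm w)) * norm (gauss w)"
          using c cw by (intro mult_mono power_mono mult_left_mono mult_nonneg_nonneg) auto
        finally show ?thesis by (simp only: power_Suc mult_ac)
      qed
      have iE: "integrable lborel ?E"
      proof (rule Bochner_Integration.integrable_bound)
        show "integrable lborel (\<lambda>w::'a. 1 / c * ((1 + norm w) ^ Suc N * norm (gauss w)))"
          by (intro integrable_mult_right J)
        have "0 \<le> ?E w" for w by (intro mult_nonneg_nonneg) auto
        with E show "AE w in lborel. norm (?E w) \<le> norm (1 / c * ((1 + norm w) ^ Suc N * norm (gauss w)))"
          by (intro AE_I2) (metis abs_of_nonneg order_trans real_norm_def)
      qed measurable
      have "schwartz_norm N (\<lambda>x. f x + - 1 * correlation (?G c) f x) \<le> ?K * (LINT w|lborel. ?E w)"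
      proof (rule schwartz_norm_integral_difference_le[OF f _ _ integrable_gauss _ iE])
        fix vs :: "'a list" and x assume vs: "set vs \<subseteq> Basis"
        have F: "foldr dir_deriv vs f \<in> schwartz" by (rule schwartz_foldr_dir_deriv[OF f vs])
        show "foldr dir_deriv vs (\<lambda>x. f x + - 1 * correlation (?G c) f x) x
            = (LINT w|lborel. foldr dir_deriv vs f (x + 0) * gauss (w::'a)) - (LINT w|lborel. foldr dir_deriv vs f (x + (1 / c) *\<^sub>R w) * gauss w)"
          by (simp only: foldr_dir_deriv_add[OF f schwartz_cmult[OF cf] vs] foldr_dir_deriv_cmult[OF cf vs]
              foldr_dir_deriv_correlation[OF f G[OF c(1)] vs] corr[OF F c(1)]) (simp add: integral_gauss)
      qed measurable
      also have "\<dots> \<le> ?K * (LINT w|lborel. 1 / c * ((1 + norm (w::'a)) ^ Suc N * norm (gauss w)))"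
        using E iE schwartz_norm_nonneg[OF f] by (intro mult_left_mono integral_mono integrable_mult_right J) auto
      also have "\<dots> = 1 / c * (?K * J)"
        unfolding J_def integral_mult_right_zero by (simp only: mult_ac)
      finally show ?thesis .
    qed
    finally show ?thesis using NC(1) by (simp add: mult_left_mono c_def)
  qed
  moreover have "(\<lambda>n. C * (1 / real (Suc n) * (?K * J))) \<longlonglongrightarrow> C * (0 * (?K * J))"
    using LIMSEQ_inverse_real_of_nat by (intro tendsto_intros) (simp add: inverse_eq_divide)
  ultimately have "norm (u f) \<le> C * (0 * (?K * J))"
    by (intro LIMSEQ_le_const) auto
  then show ?thesis by simp
qed

theorem tempered_eq_0_if_tensor:
  fixes u :: "(real^('m::finite + 'n::finite) \<Rightarrow> complex) \<Rightarrow> complex"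
  assumes u: "u \<in> tempered"
    and zero: "\<And>f g. f \<in> schwartz \<Longrightarrow> g \<in> schwartz \<Longrightarrow> u (tensor g (\<lambda>y. cnj (f y))) = 0"
    and f: "f \<in> schwartz"
  shows "u f = 0"
proof (rule tempered_approximate_identity[OF u f])
  fix c :: real assume c: "c > 0"
  let ?a = "complex_of_real (c ^ DIM(real^('m + 'n)))"
  let ?G = "\<lambda>x::real^('m + 'n). ?a * gauss (c *\<^sub>R x)"
  have scaled: "(\<lambda>x::real^'k::finite. gauss (c *\<^sub>R x)) \<in> schwartz"
    using c by (intro schwartz_continuousD[OF schwartz_continuous_linear gauss_schwartz]) (auto intro: injI linear_scaleR)
  have G: "?G \<in> schwartz"
    by (intro schwartz_cmult scaled)
  let ?g = "\<lambda>w. cnj (f (- w))"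
  have g: "?g \<in> schwartz"
    by (intro schwartz_cnj schwartz_continuousD[OF schwartz_continuous_linear f]) (auto intro: injI linearI)
  have [measurable]: "f \<in> borel_measurable borel" by (rule schwartz_measurable[OF f])
  \<comment> \<open>The Gaussian is even, so the convolution can be read with exchanged roles: no
    longer an average of translates of \<open>f\<close>, but one of translated Gaussians, weighted
    by the values of \<open>f\<close>.\<close>
  have "correlation ?G f = correlation ?g ?G"
  proof
    fix x
    have e: "gauss (- y) = gauss y" for y :: "real^('m + 'n)" by (simp add: gauss_def)
    have "correlation ?g ?G x = (LINT y|lborel. ?G (x + y) * f (- y))"
      unfolding correlation_shift[OF G g] by simp
    also have "\<dots> = (LINT y|lborel. ?G (x - y) * f y)"
      using integral_lborel_affine[of "\<lambda>y. ?G (x - y) * f y" "-1" 0] by simp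
    also have "\<dots> = correlation ?G f x"
      unfolding correlation_def
    proof (rule Bochner_Integration.integral_cong[OF refl])
      fix y
      have "cnj (gauss (c *\<^sub>R (y - x))) = gauss (c *\<^sub>R (x - y))"
        using e[of "c *\<^sub>R (x - y)"] by (simp add: gauss_def scaleR_minus_right[symmetric] del: scaleR_minus_right)
      then show "?G (x - y) * f y = f y * cnj (?G (y - x))" by simp
    qed
    finally show "correlation ?G f x = correlation ?g ?G x" ..
  qed
  moreover have "u (correlation ?g ?G) = 0"
  proof (rule tempered_correlation_eq_0[OF u G g])
    fix w
    have split: "gauss z = gauss (vfst z) * gauss (vsnd z)" for z :: "real^('m + 'n)"
      by (simp add: gauss_def norm_vjoin_split distrib_left exp_add[symmetric] of_real_mult[symmetric] del: of_real_mult)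
    \<comment> \<open>The Gaussian factors over the two blocks, and being real it may be written
      with the conjugation that \<open>zero\<close> demands.\<close>
    have "(\<lambda>x. ?G (x + w)) = tensor (\<lambda>x. ?a * gauss (c *\<^sub>R (x + vfst w))) (\<lambda>y. cnj (gauss (c *\<^sub>R (y + vsnd w))))"
      by (simp add: tensor_def fun_eq_iff split[of "c *\<^sub>R _"] mult.assoc) (simp add: gauss_def)
    then show "u (\<lambda>x. ?G (x + w)) = 0"
      by (simp only:) (intro zero schwartz_cmult schwartz_continuousD[OF schwartz_continuous_translate scaled])
  qed
  ultimately show "u (correlation ?G f) = 0" by simp
qed

section \<open>Metaplectic operators\<close>

lemma block_mult_vec: "block A B C D *v z = vjoin (A *v vfst z + B *v vsnd z) (C *v vfst z + D *v vsnd z)"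
  by (simp add: vec_eq_iff matrix_vector_mult_def block_def vjoin_def UNIV_sum_vec vfst_def vsnd_def split: sum.split)

lemma D_mat_mult_vec: "D_mat E *v w = vjoin (matrix_inv E *v vfst w) (transpose E *v vsnd w)"
  by (simp add: D_mat_def block_mult_vec)

text \<open>A quarter turn in the plane of second position and second frequency, the phase-space
  picture of a Fourier transform in that variable; the first pair stays fixed.\<close>

lemma A_FT2_mult_vec:
  "A_FT2 *v w = vjoin (vjoin (vfst (vfst w)) (vsnd (vsnd w))) (vjoin (vfst (vsnd w)) (- vsnd (vfst w)))"
proof -
  have neg: "- mat 1 *v x = - x" for x :: "real^'n"
    by (simp add: vec_eq_iff matrix_vector_mult_def mat_def sum_negf if_distrib[where f = "\<lambda>t. t * _"] cong: if_cong)
  show ?thesis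
    by (simp add: A_FT2_def block_mult_vec neg flip: vjoin_add)
qed

lemma matrix_inv_cancel:
  assumes "invertible E"
  shows "E *v (matrix_inv E *v x) = x" "matrix_inv E *v (E *v x) = x"
proof -
  have "E ** matrix_inv E = mat 1 \<and> matrix_inv E ** E = mat 1"
    using assms unfolding matrix_inv_def invertible_def by (rule someI_ex)
  then show "E *v (matrix_inv E *v x) = x" "matrix_inv E *v (E *v x) = x"
    by (simp_all add: matrix_vector_mul_assoc)
qed

section \<open>Intertwining relations with the phase-space shifts\<close>

text \<open>Positions transform by the inverse of \<open>E\<close> and frequencies by its transpose,
  so the pairing of the two, and with it the phase factor of \<open>rho\<close>, is
  preserved.\<close>

lemma rho_compose_matrix:
  assumes "invertible E"
  shows "rho w \<tau> F (E *v z) = rho (D_mat E *v w) \<tau> (\<lambda>z. F (E *v z)) z"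
proof -
  have "E *v (z - matrix_inv E *v vfst w) = E *v z - vfst w"
    using matrix_inv_cancel[OF assms] by (simp add: matrix_vector_mult_diff_distrib)
  then show ?thesis
    by (simp add: rho_def modulation_def translation_def D_mat_mult_vec dot_lmul_matrix matrix_inv_cancel[OF assms])
qed

text \<open>In the second variable a substitution turns the translation into a modulation, and the
  modulation becomes a translation of the transform. The symmetric phase in \<open>rho\<close>
  leaves no remainder.\<close>

lemma partial_fourier2_rho:
  fixes F :: "real^('n::finite + 'n) \<Rightarrow> complex"
  assumes F: "F \<in> schwartz"
  shows "partial_fourier2 (rho w \<tau> F) z = rho (A_FT2 *v w) \<tau> (partial_fourier2 F) z"
proof -
  let ?x1 = "vfst (vfst w)" and ?x2 = "vsnd (vfst w)" and ?\<xi>1 = "vfst (vsnd w)" and ?\<xi>2 = "vsnd (vsnd w)"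
  let ?z1 = "vfst z" and ?z2 = "vsnd z"
  let ?g = "\<lambda>y. rho w \<tau> F (vjoin ?z1 y) * cis (- 2 * pi * (?z2 \<bullet> y))"
  \<comment> \<open>The sign of \<open>?x2 \<bullet> ?\<xi>2\<close> has flipped: the substitution
    contributes minus twice the original phase of this pair.\<close>
  let ?k = "cis (2 * pi * \<tau>) * cis (- pi * (?\<xi>1 \<bullet> ?x1 - ?x2 \<bullet> ?\<xi>2)) * cis (2 * pi * (?\<xi>1 \<bullet> ?z1 - ?x2 \<bullet> ?z2))"
  have [measurable]: "F \<in> borel_measurable borel" by (rule schwartz_measurable[OF F])
  have "?g (?x2 + y) = ?k * (F (vjoin (?z1 - ?x1) y) * cis (- 2 * pi * ((?z2 - ?\<xi>2) \<bullet> y)))" for y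
  proof -
    have v: "vjoin ?z1 (?x2 + y) - vfst w = vjoin (?z1 - ?x1) y"
      by (simp add: vec_eq_iff vjoin_def vfst_def vsnd_def split: sum.split)
    have ph: "2 * pi * \<tau> + (- pi * (vsnd w \<bullet> vfst w)) + 2 * pi * (vsnd w \<bullet> vjoin ?z1 (?x2 + y)) + (- 2 * pi * (?z2 \<bullet> (?x2 + y)))
        = 2 * pi * \<tau> + (- pi * (?\<xi>1 \<bullet> ?x1 - ?x2 \<bullet> ?\<xi>2)) + 2 * pi * (?\<xi>1 \<bullet> ?z1 - ?x2 \<bullet> ?z2) + (- 2 * pi * ((?z2 - ?\<xi>2) \<bullet> y))"
      by (simp add: inner_vjoin_split inner_add_right inner_diff_left inner_commute[of ?x2] algebra_simps)
    have "?g (?x2 + y) = (cis (2 * pi * \<tau>) * cis (- pi * (vsnd w \<bullet> vfst w)) * cis (2 * pi * (vsnd w \<bullet> vjoin ?z1 (?x2 + y)))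
        * cis (- 2 * pi * (?z2 \<bullet> (?x2 + y)))) * F (vjoin (?z1 - ?x1) y)"
      by (simp only: rho_def modulation_def translation_def v mult_ac)
    also have "\<dots> = ?k * (F (vjoin (?z1 - ?x1) y) * cis (- 2 * pi * ((?z2 - ?\<xi>2) \<bullet> y)))"
      unfolding cis_mult ph by (simp only: cis_mult[symmetric] mult_ac)
    finally show ?thesis .
  qed
  moreover have "(LINT y|lborel. ?g y) = (LINT y|lborel. ?g (?x2 + 1 *\<^sub>R y))"
    unfolding rho_def modulation_def translation_def by (subst integral_lborel_affine) auto
  ultimately have "partial_fourier2 (rho w \<tau> F) z = ?k * partial_fourier2 F (z - vjoin ?x1 ?\<xi>2)"
    unfolding partial_fourier2_def by simp
  also have "\<dots> = rho (A_FT2 *v w) \<tau> (partial_fourier2 F) z"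
    by (simp add: rho_def modulation_def translation_def A_FT2_mult_vec inner_vjoin_split mult.assoc)
  finally show ?thesis .
qed

lemma schwartz_matrix:
  fixes E :: "real^'m^'m"
  assumes "invertible E"
  shows "schwartz_continuous (\<lambda>F z. F (E *v z))"
  using assms by (intro schwartz_continuous_linear) (auto simp: inj_matrix_vector_mult)

lemma schwartz_rho: "F \<in> schwartz \<Longrightarrow> rho w \<tau> F \<in> schwartz"
  unfolding rho_def[abs_def] modulation_def translation_def
  by (intro schwartz_cmult schwartz_continuousD[OF schwartz_continuous_modulation])
    (use schwartz_continuousD[OF schwartz_continuous_translate, of F "- vfst w"] in simp)

section \<open>Square-integrable functions and matrix coefficients\<close>

lemma schwartz_L2:
  assumes "F \<in> schwartz" shows "F \<in> L2"
  using integrable_norm[OF schwartz_mult_cnj_integrable[OF assms assms]] schwartz_measurable[OF assms]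
  by (simp add: L2_def norm_mult power2_eq_square)

lemma L2_mult_integrable:
  assumes "F \<in> L2" "G \<in> L2" shows "integrable lborel (\<lambda>x. F x * cnj (G x))"
proof -
  have [measurable]: "F \<in> borel_measurable borel" "G \<in> borel_measurable borel"
    using assms by (auto simp: L2_def)
  show ?thesis
  proof (rule Bochner_Integration.integrable_bound)
    show "integrable lborel (\<lambda>x. (norm (F x))\<^sup>2 + (norm (G x))\<^sup>2)"
      using assms by (simp add: L2_def)
    have "norm (F x * cnj (G x)) \<le> norm ((norm (F x))\<^sup>2 + (norm (G x))\<^sup>2)" for x
    proof -
      have "0 \<le> norm (F x) * norm (G x)" by simp
      with sum_squares_bound[of "norm (F x)" "norm (G x)"]
      have "norm (F x) * norm (G x) \<le> (norm (F x))\<^sup>2 + (norm (G x))\<^sup>2"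
        unfolding mult.assoc by linarith
      then show ?thesis by (simp add: norm_mult)
    qed
    then show "AE x in lborel. norm (F x * cnj (G x)) \<le> norm ((norm (F x))\<^sup>2 + (norm (G x))\<^sup>2)" by simp
  qed measurable
qed

lemma L2_translate:
  assumes "F \<in> L2" shows "(\<lambda>t. F (t - x)) \<in> L2"
proof -
  have [measurable]: "F \<in> borel_measurable borel" using assms by (auto simp: L2_def)
  have "integrable lborel (\<lambda>t. (norm (F (- x + 1 *\<^sub>R t)))\<^sup>2)"
    using assms by (subst integrable_lborel_affine) (auto simp: L2_def)
  then show ?thesis by (simp add: L2_def)
qed

text \<open>Up to a phase, the matrix coefficient is the short-time Fourier transform of
  \<open>F\<close> with window \<open>G\<close>.\<close>

lemma L2_inner_rho:
  "L2_inner F (rho (vjoin x \<xi>) 0 G) = cis (pi * (\<xi> \<bullet> x)) * fourier (\<lambda>t. F t * cnj (G (t - x))) \<xi>"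
proof -
  have "F t * cnj (rho (vjoin x \<xi>) 0 G t) = cis (pi * (\<xi> \<bullet> x)) * (F t * cnj (G (t - x)) * cis (- 2 * pi * (\<xi> \<bullet> t)))" for t
    by (simp add: rho_def modulation_def translation_def cis_cnj mult_ac)
  then show ?thesis
    unfolding L2_inner_def fourier_def by (simp only: integral_mult_right_zero)
qed

lemma AE_lborel_reflect:
  fixes t :: "'a::euclidean_space"
  assumes [measurable]: "Measurable.pred borel P" and "AE x in lborel. P (t - x)"
  shows "AE x in lborel. P x"
proof -
  have "lborel = distr lborel borel (\<lambda>x. t + (-1) *\<^sub>R x)"
    using lborel_affine[of "-1" t] by (simp add: density_1)
  then show ?thesis
    using assms by (subst \<open>lborel = _\<close>) (simp add: AE_distr_iff)
qed

text \<open>Equality of all matrix coefficients of two pairs means equality of the Fourier transforms of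
  \<open>t \<mapsto> F t \<cdot> cnj (G (t - x))\<close> for all \<open>x\<close>, hence of the tensor products.\<close>

lemma matrix_coefficients_determine_tensor:
  fixes F G F' G' :: "real^'m \<Rightarrow> complex"
  assumes L2: "F \<in> L2" "G \<in> L2" "F' \<in> L2" "G' \<in> L2"
    and eq: "\<And>w. L2_inner F (rho w 0 G) = \<delta> * L2_inner F' (rho w 0 G')"
  shows "AE s in lborel. AE t in lborel. F t * cnj (G s) = \<delta> * (F' t * cnj (G' s))"
proof -
  have [measurable]: "F \<in> borel_measurable borel" "G \<in> borel_measurable borel"
      "F' \<in> borel_measurable borel" "G' \<in> borel_measurable borel"
    using L2 by (auto simp: L2_def)
  have 1: "AE t in lborel. F t * cnj (G (t - x)) = \<delta> * (F' t * cnj (G' (t - x)))" for x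
  proof -
    let ?h = "\<lambda>t. F t * cnj (G (t - x)) - \<delta> * (F' t * cnj (G' (t - x)))"
    have i: "integrable lborel (\<lambda>t. F t * cnj (G (t - x)))" "integrable lborel (\<lambda>t. F' t * cnj (G' (t - x)))"
      by (intro L2_mult_integrable L2_translate L2)+
    have icis: "integrable lborel (\<lambda>t. h t * cis (- 2 * pi * (\<xi> \<bullet> t)))" if "integrable lborel h" for h :: "real^'m \<Rightarrow> complex" and \<xi>
      by (rule Bochner_Integration.integrable_bound[OF that]) (use that in \<open>auto simp: norm_mult\<close>)
    have "AE t in lborel. ?h t = 0"
    proof (rule fourier_injective)
      show "integrable lborel ?h"
        by (intro Bochner_Integration.integrable_diff integrable_mult_right i)
      fix \<xi>
      have "fourier ?h \<xi> = fourier (\<lambda>t. F t * cnj (G (t - x))) \<xi> - \<delta> * fourier (\<lambda>t. F' t * cnj (G' (t - x))) \<xi>"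
        unfolding fourier_def left_diff_distrib mult.assoc[of \<delta>]
        by (subst Bochner_Integration.integral_diff[OF icis[OF i(1)] integrable_mult_right[OF icis[OF i(2)]]])
          (simp only: integral_mult_right_zero)
      moreover have "cis (pi * (\<xi> \<bullet> x)) * fourier (\<lambda>t. F t * cnj (G (t - x))) \<xi>
          = cis (pi * (\<xi> \<bullet> x)) * (\<delta> * fourier (\<lambda>t. F' t * cnj (G' (t - x))) \<xi>)"
        using eq[of "vjoin x \<xi>"] by (simp add: L2_inner_rho mult_ac)
      ultimately show "fourier ?h \<xi> = 0" by simp
    qed
    then show ?thesis by simp
  qed
  \<comment> \<open>So far the null set depends on \<open>x\<close>. Exchanging the quantifiers
    permits the substitution \<open>s = t - x\<close> for fixed \<open>t\<close>.\<close>
  have "AE t in lborel. AE x in lborel. F t * cnj (G (t - x)) = \<delta> * (F' t * cnj (G' (t - x)))"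
  proof (subst lborel_pair.AE_commute)
    show "{p \<in> space (lborel \<Otimes>\<^sub>M lborel). F (fst p) * cnj (G (fst p - snd p)) = \<delta> * (F' (fst p) * cnj (G' (fst p - snd p)))}
        \<in> sets (lborel \<Otimes>\<^sub>M lborel)" by measurable
  qed (use 1 in simp)
  then have "AE t in lborel. AE s in lborel. F t * cnj (G s) = \<delta> * (F' t * cnj (G' s))"
  proof eventually_elim
    case (elim t)
    show ?case
      by (rule AE_lborel_reflect[OF _ elim]) measurable
  qed
  moreover have "{p \<in> space (lborel \<Otimes>\<^sub>M lborel). F (snd p) * cnj (G (fst p)) = \<delta> * (F' (snd p) * cnj (G' (fst p)))}
      \<in> sets (lborel \<Otimes>\<^sub>M lborel)" by measurable
  ultimately show ?thesis
    by (subst lborel_pair.AE_commute)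
qed

lemma L2_inner_cong_AE:
  assumes "F \<in> L2" "G \<in> L2" "F' \<in> L2" "G' \<in> L2"
    and "AE x in lborel. F x = F' x" "AE x in lborel. G x = G' x"
  shows "L2_inner F G = L2_inner F' G'"
proof -
  have [measurable]: "F \<in> borel_measurable borel" "G \<in> borel_measurable borel"
      "F' \<in> borel_measurable borel" "G' \<in> borel_measurable borel"
    using assms by (auto simp: L2_def)
  show ?thesis
    unfolding L2_inner_def
  proof (rule integral_cong_AE)
    show "AE x in lborel. F x * cnj (G x) = F' x * cnj (G' x)"
      using assms(5,6) by eventually_elim simp
  qed measurable
qed

text \<open>The substitution by \<open>E\<close> is the only source of the determinant, since the
  partial Fourier transform preserves inner products.\<close>

lemma L2_inner_partial_fourier2_matrix:
  fixes E :: "real^('n::finite + 'n) ^ ('n + 'n)"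
  assumes E: "invertible E" and F: "F \<in> schwartz" and G: "G \<in> schwartz"
  shows "L2_inner F G = \<bar>det E\<bar> * L2_inner (partial_fourier2 (\<lambda>z. F (E *v z))) (partial_fourier2 (\<lambda>z. G (E *v z)))"
proof -
  have [measurable]: "F \<in> borel_measurable borel" "G \<in> borel_measurable borel"
    using F G by (auto intro: schwartz_measurable)
  have "L2_inner F G = \<bar>det E\<bar> * (LINT z|lborel. F (E *v z) * cnj (G (E *v z)))"
    unfolding L2_inner_def using E
    by (subst integral_matrix[of _ E]) (auto simp: invertible_det_nz scaleR_conv_of_real)
  then show ?thesis
    unfolding L2_inner_def
    by (simp add: partial_fourier2_parseval schwartz_continuousD[OF schwartz_matrix[OF E]] F G)
qed

theorem metaplectic_eq_partial_fourier2:
  fixes E :: "real^('n::finite + 'n) ^ ('n + 'n)"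
  assumes U: "metaplectic U (A_FT2 ** D_mat E)" and E: "invertible E"
  obtains c where "(norm c)\<^sup>2 = \<bar>det E\<bar>"
    and "\<And>F. F \<in> schwartz \<Longrightarrow> AE x in lborel. U F x = c * partial_fourier2 (\<lambda>z. F (E *v z)) x"
proof -
  let ?A = "A_FT2 ** D_mat E"
  let ?V = "\<lambda>F. partial_fourier2 (\<lambda>z. F (E *v z))"
  define \<delta> where "\<delta> = complex_of_real \<bar>det E\<bar>"
  have \<delta>: "\<delta> \<noteq> 0" using E by (simp add: \<delta>_def invertible_det_nz)
  have V: "?V F \<in> schwartz" if "F \<in> schwartz" for F
    by (intro partial_fourier2_schwartz schwartz_continuousD[OF schwartz_matrix[OF E]] that)
  have un: "unitary_L2 U" and inter: "\<And>w \<tau> F. F \<in> L2 \<Longrightarrow> AE x in lborel. U (rho w \<tau> F) x = rho (?A *v w) \<tau> (U F) x"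
    using U by (auto simp: metaplectic_def)
  have UL: "U F \<in> L2" if "F \<in> L2" for F
    using un that by (simp add: unitary_L2_def)
  have Uinner: "L2_inner (U F) (U G) = L2_inner F G" if "F \<in> L2" "G \<in> L2" for F G
    using un that by (simp add: unitary_L2_def)
  have rho_L2: "rho w \<tau> F \<in> L2" if "F \<in> L2" for w \<tau> and F :: "real^('n + 'n) \<Rightarrow> complex"
  proof -
    have L: "(\<lambda>t. F (t - vfst w)) \<in> L2" by (rule L2_translate[OF that])
    then have [measurable]: "(\<lambda>t. F (t - vfst w)) \<in> borel_measurable borel" by (simp add: L2_def)
    have "rho w \<tau> F \<in> borel_measurable borel"
      unfolding rho_def[abs_def] modulation_def translation_def by measurable
    then show ?thesis
      using L by (simp add: L2_def rho_def modulation_def translation_def norm_mult)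
  qed
  \<comment> \<open>Matrix coefficients are compared at every \<open>w'\<close>, while the relation
    for \<open>U\<close> speaks of the points \<open>?A *v w\<close>. The witness inverts the two
    factors of \<open>?A\<close> in turn.\<close>
  have surj: "\<exists>w. ?A *v w = w'" for w' :: "real^(('n + 'n) + ('n + 'n))"
  proof -
    let ?y = "vjoin (vjoin (vfst (vfst w')) (- vsnd (vsnd w'))) (vjoin (vfst (vsnd w')) (vsnd (vfst w')))"
    let ?w = "vjoin (E *v vfst ?y) (transpose (matrix_inv E) *v vsnd ?y)"
    have "transpose E ** transpose (matrix_inv E) = mat 1"
      unfolding matrix_transpose_mul[symmetric]
      by (metis E matrix_eq matrix_inv_cancel(2) matrix_vector_mul_assoc matrix_vector_mul_lid transpose_mat)
    then have "transpose E *v (transpose (matrix_inv E) *v y) = y" for y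
      by (simp only: matrix_vector_mul_assoc matrix_vector_mul_lid)
    then have "D_mat E *v ?w = ?y"
      by (simp only: D_mat_mult_vec vfst_vjoin vsnd_vjoin matrix_inv_cancel[OF E])
    then have "?A *v ?w = A_FT2 *v ?y"
      by (simp only: matrix_vector_mul_assoc[symmetric])
    also have "\<dots> = w'" by (simp add: A_FT2_mult_vec)
    finally show ?thesis by blast
  qed
  have tensor_eq: "AE s in lborel. AE t in lborel. U F t * cnj (U G s) = \<delta> * (?V F t * cnj (?V G s))"
    if F: "F \<in> schwartz" and G: "G \<in> schwartz" for F G
  proof (rule matrix_coefficients_determine_tensor)
    note L = schwartz_L2[OF F] schwartz_L2[OF G]
    show "U F \<in> L2" "U G \<in> L2" "?V F \<in> L2" "?V G \<in> L2"
      using UL L by (auto intro: schwartz_L2 V F G)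
    fix w'
    obtain w where w: "w' = ?A *v w" using surj by metis
    have "L2_inner (U F) (rho w' 0 (U G)) = L2_inner (U F) (U (rho w 0 G))"
    proof (rule L2_inner_cong_AE)
      show "AE x in lborel. rho w' 0 (U G) x = U (rho w 0 G) x"
        using inter[OF L(2), of w 0] unfolding w by eventually_elim simp
    qed (use UL L rho_L2 in auto)
    also have "\<dots> = L2_inner F (rho w 0 G)"
      by (intro Uinner L rho_L2)
    also have "\<dots> = \<delta> * L2_inner (?V F) (?V (rho w 0 G))"
      unfolding \<delta>_def by (rule L2_inner_partial_fourier2_matrix[OF E F schwartz_rho[OF G]])
    also have "?V (rho w 0 G) = rho w' 0 (?V G)"
      unfolding w rho_compose_matrix[OF E]
      by (intro ext) (simp only: partial_fourier2_rho[OF schwartz_continuousD[OF schwartz_matrix[OF E] G]] matrix_vector_mul_assoc)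
    finally show "L2_inner (U F) (rho w' 0 (U G)) = \<delta> * L2_inner (?V F) (rho w' 0 (?V G))" .
  qed
  \<comment> \<open>A fixed reference function determines the scalar; the square of the Gaussian is
    a rescaled Gaussian, so its norm is visibly nonzero.\<close>
  let ?g = "gauss :: real^('n + 'n) \<Rightarrow> complex"
  have g: "?g \<in> schwartz" "?g \<in> L2" by (auto intro: gauss_schwartz schwartz_L2)
  have nz: "L2_inner ?g ?g \<noteq> 0"
  proof -
    have "?g x * cnj (?g x) = ?g (0 + sqrt 2 *\<^sub>R x)" for x
      by (simp add: gauss_def power_mult_distrib exp_add[symmetric] of_real_mult[symmetric] del: of_real_mult)
    then have "L2_inner ?g ?g = (1 / \<bar>sqrt 2\<bar> ^ DIM(real^('n + 'n))) *\<^sub>R (LINT x|lborel. ?g x)"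
      unfolding L2_inner_def by (simp only:) (rule integral_lborel_affine, auto)
    then show ?thesis by (simp add: integral_gauss)
  qed
  \<comment> \<open>Lets identities that hold almost everywhere be frozen at one point and divided
    by a nonzero value there.\<close>
  have ex_nonzero: "\<exists>s. Q s \<and> H s \<noteq> 0" if "AE s in lborel. Q s" "L2_inner H H \<noteq> 0" "H \<in> L2" for Q and H :: "real^('n + 'n) \<Rightarrow> complex"
  proof (rule ccontr)
    assume "\<not> ?thesis"
    then have "AE s in lborel. H s = 0"
      using that(1) by (auto elim: eventually_mono)
    then have "L2_inner H H = L2_inner (\<lambda>x::real^('n + 'n). 0) (\<lambda>x. 0)"
      by (intro L2_inner_cong_AE that) (auto simp: L2_def)
    then show False using that(2) by (simp add: L2_inner_def)
  qed
  obtain s where s: "AE t in lborel. U ?g t * cnj (U ?g s) = \<delta> * (?V ?g t * cnj (?V ?g s))" "U ?g s \<noteq> 0"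
    using ex_nonzero[OF tensor_eq[OF g(1) g(1)], of "U ?g"] nz by (auto simp: Uinner UL g)
  \<comment> \<open>Solves the tensor identity for \<open>F = G = ?g\<close>, frozen at
    \<open>s\<close>, for \<open>U ?g t\<close>.\<close>
  define c where "c = \<delta> * cnj (?V ?g s) / cnj (U ?g s)"
  have Ug: "AE t in lborel. U ?g t = c * ?V ?g t"
    using s(1) by eventually_elim (use s(2) in \<open>simp add: c_def field_simps\<close>)
  have Vnz: "L2_inner (?V ?g) (?V ?g) \<noteq> 0"
    using L2_inner_partial_fourier2_matrix[OF E g(1) g(1)] nz by auto
  have c: "c * cnj c = \<delta>"
  proof -
    have "(\<lambda>x. c * ?V ?g x) \<in> L2"
      by (intro schwartz_L2 schwartz_cmult V g)
    then have "L2_inner (U ?g) (U ?g) = L2_inner (\<lambda>x. c * ?V ?g x) (\<lambda>x. c * ?V ?g x)"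
      by (intro L2_inner_cong_AE Ug UL g)
    also have "\<dots> = c * cnj c * L2_inner (?V ?g) (?V ?g)"
      unfolding L2_inner_def by (subst integral_mult_right_zero[symmetric]) (simp add: mult_ac)
    finally have "\<delta> * L2_inner (?V ?g) (?V ?g) = c * cnj c * L2_inner (?V ?g) (?V ?g)"
      using L2_inner_partial_fourier2_matrix[OF E g(1) g(1)] by (simp add: Uinner g \<delta>_def)
    then show ?thesis using Vnz by simp
  qed
  show thesis
  proof (rule that[of c])
    have "complex_of_real ((norm c)\<^sup>2) = complex_of_real \<bar>det E\<bar>"
      using c unfolding complex_norm_square \<delta>_def .
    then show "(norm c)\<^sup>2 = \<bar>det E\<bar>" by (simp only: of_real_eq_iff)
    fix F :: "real^('n + 'n) \<Rightarrow> complex" assume F: "F \<in> schwartz"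
    \<comment> \<open>The point is chosen anew so that \<open>U ?g s = c * ?V ?g s\<close> holds
      there too. Cancelling \<open>cnj c * cnj (?V ?g s)\<close>, with
      \<open>c * cnj c = \<delta>\<close>, gives the same scalar for every \<open>F\<close>.\<close>
    have "AE s in lborel. (AE t in lborel. U F t * cnj (U ?g s) = \<delta> * (?V F t * cnj (?V ?g s))) \<and> U ?g s = c * ?V ?g s"
      using tensor_eq[OF F g(1)] Ug by eventually_elim simp
    from ex_nonzero[OF this Vnz schwartz_L2[OF V[OF g(1)]]]
    obtain s where s: "AE t in lborel. U F t * cnj (U ?g s) = \<delta> * (?V F t * cnj (?V ?g s))"
        "U ?g s = c * ?V ?g s" "?V ?g s \<noteq> 0"
      by blast
    show "AE t in lborel. U F t = c * ?V F t"
      using s(1)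
    proof eventually_elim
      case (elim t)
      then have "(U F t * cnj c) * cnj (?V ?g s) = (c * ?V F t * cnj c) * cnj (?V ?g s)"
        unfolding s(2) c[symmetric] by (simp add: mult_ac)
      moreover have "cnj c \<noteq> 0" using c \<delta> by auto
      ultimately show ?case using s(3) by simp
    qed
  qed
qed

section \<open>The Schwartz kernel of the localization operator\<close>

text \<open>By continuity the set where the functions differ is open, and a nonempty open set is not
  negligible. This makes the choice in \<open>schwartz_rep\<close> unique.\<close>

lemma schwartz_eqI_AE:
  fixes f g :: "'a::euclidean_space \<Rightarrow> complex"
  assumes f: "f \<in> schwartz" and g: "g \<in> schwartz" and AE: "AE x in lborel. f x = g x"
  shows "f = g"
proof (rule ccontr)
  assume "f \<noteq> g"
  let ?S = "{x. f x \<noteq> g x}"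
  have [measurable]: "f \<in> borel_measurable borel" "g \<in> borel_measurable borel"
    using f g by (auto intro: schwartz_measurable)
  have "open ?S"
    by (intro open_Collect_neq schwartz_continuous_on f g)
  moreover have "?S \<noteq> {}" using \<open>f \<noteq> g\<close> by auto
  ultimately have "\<not> negligible ?S" by (rule open_not_negligible)
  moreover have "?S \<in> null_sets lborel"
    using AE by (subst (asm) AE_iff_null_sets[of ?S lborel, symmetric, simplified]) auto
  ultimately show False
    by (simp add: negligible_iff_null_sets null_sets_completionI)
qed

lemma schwartz_rep_eq:
  assumes "f \<in> schwartz" "AE x in lborel. F x = f x"
  shows "schwartz_rep F = f"
  unfolding schwartz_rep_def
proof (rule the_equality)
  show "f \<in> schwartz \<and> (AE x in lborel. f x = F x)"
    using assms by (auto elim: eventually_mono)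
  fix h assume h: "h \<in> schwartz \<and> (AE x in lborel. h x = F x)"
  then have "AE x in lborel. h x = F x" by blast
  with assms(2) have "AE x in lborel. h x = f x" by eventually_elim simp
  with h assms(1) show "h = f" by (blast intro: schwartz_eqI_AE)
qed

lemma correlation_cmult:
  "correlation (\<lambda>x. c * g x) (\<lambda>x. d * f x) = (\<lambda>x. d * cnj c * correlation g f x)"
proof
  fix x
  have "(d * f y) * cnj (c * g (y - x)) = d * cnj c * (f y * cnj (g (y - x)))" for y
    by (simp add: mult_ac)
  then show "correlation (\<lambda>x. c * g x) (\<lambda>x. d * f x) x = d * cnj c * correlation g f x"
    unfolding correlation_def by (simp only: integral_mult_right_zero)
qed

lemma correlation_add:
  assumes "f \<in> schwartz" "h \<in> schwartz" "g \<in> schwartz"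
  shows "correlation g (\<lambda>x. f x + h x) = (\<lambda>x. correlation g f x + correlation g h x)"
  by (intro ext) (simp add: correlation_shift assms schwartz_add ring_distribs correlation_integrable)

lemma dist_conv_eq: "dist_conv u g = (\<lambda>f. u (correlation g f))"
  by (simp add: dist_conv_def correlation_def)

lemma tempered_eqI_tensor:
  fixes u v :: "(real^('m::finite + 'n::finite) \<Rightarrow> complex) \<Rightarrow> complex"
  assumes u: "u \<in> tempered" and v: "v \<in> tempered"
    and eq: "\<And>f g. f \<in> schwartz \<Longrightarrow> g \<in> schwartz \<Longrightarrow> u (tensor g (\<lambda>y. cnj (f y))) = v (tensor g (\<lambda>y. cnj (f y)))"
    and f: "f \<in> schwartz"
  shows "u f = v f"
proof -
  obtain N C where NC: "0 \<le> C" "\<And>f. f \<in> schwartz \<Longrightarrow> norm (u f) \<le> C * schwartz_norm N f"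
    using tempered_bound[OF u] by metis
  obtain M D where MD: "0 \<le> D" "\<And>f. f \<in> schwartz \<Longrightarrow> norm (v f) \<le> D * schwartz_norm M f"
    using tempered_bound[OF v] by metis
  have "norm (u f - v f) \<le> (C + D) * schwartz_norm (max N M) f" if f: "f \<in> schwartz" for f
  proof -
    have "norm (u f - v f) \<le> C * schwartz_norm N f + D * schwartz_norm M f"
      by (rule order_trans[OF norm_triangle_ineq4 add_mono[OF NC(2)[OF f] MD(2)[OF f]]])
    also have "\<dots> \<le> C * schwartz_norm (max N M) f + D * schwartz_norm (max N M) f"
      by (intro add_mono mult_left_mono schwartz_norm_mono f NC(1) MD(1)) auto
    finally show ?thesis by (simp add: algebra_simps)
  qed
  then have "(\<lambda>f. u f - v f) \<in> tempered"
    unfolding tempered_def mem_Collect_eq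
    by (intro conjI) (simp add: tempered_add[OF u] tempered_add[OF v],
        simp add: tempered_cmult[OF u] tempered_cmult[OF v] right_diff_distrib, blast)
  from tempered_eq_0_if_tensor[OF this _ f] show ?thesis by (simp add: eq)
qed

text \<open>The conditions in \<open>tempered\<close> concern only values at Schwartz functions, and
  sums and multiples of these are Schwartz again.\<close>

lemma tempered_cong:
  assumes u: "u \<in> tempered" and eq: "dist_eq v u"
  shows "v \<in> tempered"
  using u eq unfolding tempered_def dist_eq_def by (auto simp: schwartz_add schwartz_cmult)

theorem proposition3p12:
  fixes \<A> :: "real ^ (('n::finite + 'n) + ('n + 'n)) ^ (('n + 'n) + ('n + 'n))"
    and E :: "real ^ ('n + 'n) ^ ('n + 'n)"
    and A B C D A' B' C' D' :: "real ^ 'n ^ 'n"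
    and U :: "(real ^ ('n + 'n) \<Rightarrow> complex) \<Rightarrow> real ^ ('n + 'n) \<Rightarrow> complex"
    and a :: "(real ^ ('n + 'n) \<Rightarrow> complex) \<Rightarrow> complex"
    and \<phi>1 \<phi>2 :: "real ^ 'n \<Rightarrow> complex"
    and k :: "(real ^ ('n + 'n) \<Rightarrow> complex) \<Rightarrow> complex"
  assumes "\<A> \<in> Sp"
    and "invertible E"
    and "\<A> = A_FT2 ** D_mat E"
    and "E = block A B C D"
    and "matrix_inv E = block A' B' C' D'"
    and "metaplectic U \<A>"
    and "a \<in> tempered"
    and "\<phi>1 \<in> schwartz"
    and "\<phi>2 \<in> schwartz"
  shows "is_schwartz_kernel k (loc_op U a \<phi>1 \<phi>2) \<longleftrightarrow>
    dist_eq k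
      (dist_comp (block A' B' C' D')
        (weak_integral (dist_inv_partial_fourier2 a)
          (\<lambda>t v. \<phi>2 (A *v t + B *v v) * cnj (\<phi>1 (C *v t + D *v v)))))"
proof -
  note E = \<open>invertible E\<close> and a = \<open>a \<in> tempered\<close>
  let ?V = "\<lambda>F. partial_fourier2 (\<lambda>z. F (E *v z))"
  let ?\<delta> = "complex_of_real \<bar>det E\<bar>"
  define \<Phi> where "\<Phi> = tensor \<phi>2 (\<lambda>y. cnj (\<phi>1 y))"
  have \<Phi>: "\<Phi> \<in> schwartz"
    unfolding \<Phi>_def by (intro tensor_schwartz schwartz_cnj assms)
  have VE: "schwartz_continuous (\<lambda>F z. F (E *v z))"
    by (rule schwartz_matrix[OF E])
  have V: "?V F \<in> schwartz" if "F \<in> schwartz" for F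
    by (intro partial_fourier2_schwartz schwartz_continuousD[OF VE] that)
  \<comment> \<open>Both sides of the claim evaluate \<open>a\<close> at \<open>T \<psi>\<close>,
    for the localization operator when \<open>\<psi>\<close> is a tensor product. The factor
    \<open>?\<delta>\<close> is the Jacobian in \<open>dist_comp\<close> on one side and the squared
    modulus of the metaplectic scalar on the other.\<close>
  define T where "T \<psi> = (\<lambda>x. ?\<delta> * correlation (?V \<Phi>) (?V \<psi>) x)" for \<psi>
  have T_cont: "schwartz_continuous T"
    unfolding T_def
    by (intro schwartz_continuous_cmult schwartz_continuous_compose[OF schwartz_continuous_correlation[OF V[OF \<Phi>]]]
        schwartz_continuous_compose[OF schwartz_continuous_partial_fourier2 VE])
  have aT: "(\<lambda>\<psi>. a (T \<psi>)) \<in> tempered"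
  proof (rule tempered_compose[OF a T_cont])
    fix f g :: "real^('n + 'n) \<Rightarrow> complex" and c :: complex assume f: "f \<in> schwartz"
    show "T (\<lambda>x. c * f x) = (\<lambda>x. c * T f x)"
      using correlation_cmult[of 1 "?V \<Phi>" c "?V f"] by (simp add: T_def partial_fourier2_cmult mult_ac)
    assume g: "g \<in> schwartz"
    show "T (\<lambda>x. f x + g x) = (\<lambda>x. T f x + T g x)"
      using schwartz_continuousD[OF VE f] schwartz_continuousD[OF VE g]
      by (simp add: T_def partial_fourier2_add correlation_add V f g \<Phi> ring_distribs)
  qed
  let ?R = "dist_comp (block A' B' C' D') (weak_integral (dist_inv_partial_fourier2 a)
          (\<lambda>t v. \<phi>2 (A *v t + B *v v) * cnj (\<phi>1 (C *v t + D *v v))))"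
  have R: "?R \<psi> = a (T \<psi>)" if \<psi>: "\<psi> \<in> schwartz" for \<psi>
  proof -
    let ?L = "matrix_inv E"
    have L: "?L ** E = mat 1" "E ** ?L = mat 1"
      using matrix_inv_cancel[OF E] by (simp_all add: matrix_eq matrix_vector_mul_assoc[symmetric])
    have "matrix_inv ?L *v (?L *v (E *v x)) = E *v x" for x
      by (rule matrix_inv_cancel) (use L in \<open>auto simp: invertible_def\<close>)
    then have inv: "matrix_inv ?L *v x = E *v x" for x
      by (simp add: matrix_inv_cancel[OF E])
    \<comment> \<open>\<open>dist_comp\<close> is taken with the inverse of \<open>E\<close>, so its
      reciprocal determinant becomes that of \<open>E\<close>.\<close>
    have "det ?L * det E = 1"
      using L(1) by (metis det_I det_mul)
    then have "\<bar>det ?L\<bar> * \<bar>det E\<bar> = 1"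
      by (simp flip: abs_mult)
    then have det: "1 / \<bar>det ?L\<bar> = \<bar>det E\<bar>"
      unfolding inverse_eq_divide[symmetric] by (rule inverse_unique)
    have \<Phi>E: "\<phi>2 (A *v t + B *v v) * cnj (\<phi>1 (C *v t + D *v v)) = \<Phi> (E *v vjoin t v)" for t v
      by (simp add: \<Phi>_def tensor_def \<open>E = block A B C D\<close> block_mult_vec)
    have "?R \<psi> = a (partial_fourier2 (\<lambda>z. LINT t|lborel. cnj (\<Phi> (E *v vjoin t (vsnd z)))
        * (?\<delta> * \<psi> (E *v vjoin (vfst z + t) (vsnd z)))))"
      unfolding \<open>matrix_inv E = _\<close>[symmetric] dist_comp_def weak_integral_def dist_inv_partial_fourier2_def \<Phi>E inv det ..
    also have "\<dots> = a (correlation (?V \<Phi>) (partial_fourier2 (\<lambda>z. ?\<delta> * \<psi> (E *v z))))"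
      using correlation_partial_fourier2[OF schwartz_cmult[OF schwartz_continuousD[OF VE \<psi>], of ?\<delta>] schwartz_continuousD[OF VE \<Phi>]]
      by simp
    also have "\<dots> = a (T \<psi>)"
      using correlation_cmult[of 1 "?V \<Phi>" ?\<delta> "?V \<psi>"] by (simp add: T_def partial_fourier2_cmult)
    finally show ?thesis .
  qed
  obtain c where c: "(norm c)\<^sup>2 = \<bar>det E\<bar>"
      "\<And>F. F \<in> schwartz \<Longrightarrow> AE x in lborel. U F x = c * ?V F x"
    using metaplectic_eq_partial_fourier2[OF assms(6)[unfolded assms(3)] E] by metis
  have W: "wigner U f g = (\<lambda>x. c * ?V (tensor f (\<lambda>y. cnj (g y))) x)" if "f \<in> schwartz" "g \<in> schwartz" for f g
    unfolding wigner_def using that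
    by (intro schwartz_rep_eq schwartz_cmult V c tensor_schwartz schwartz_cnj)
  have loc: "loc_op U a \<phi>1 \<phi>2 f g = a (T (tensor g (\<lambda>y. cnj (f y))))" if "f \<in> schwartz" "g \<in> schwartz" for f g
  proof -
    \<comment> \<open>One \<open>c\<close> comes from the test function and one \<open>cnj c\<close>
      from the window, in which the correlation is conjugate-linear.\<close>
    have "c * cnj c = ?\<delta>"
      using c(1) by (metis complex_norm_square)
    then show ?thesis
      unfolding loc_op_def Op_def dist_conv_eq W[OF that(2,1)] W[OF \<open>\<phi>2 \<in> schwartz\<close> \<open>\<phi>1 \<in> schwartz\<close>]
        \<Phi>_def[symmetric] correlation_cmult T_def by simp
  qed
  show ?thesis
  proof
    assume k: "is_schwartz_kernel k (loc_op U a \<phi>1 \<phi>2)"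
    have "k (tensor g (\<lambda>y. cnj (f y))) = a (T (tensor g (\<lambda>y. cnj (f y))))" if "f \<in> schwartz" "g \<in> schwartz" for f g
      using k loc[OF that] that unfolding is_schwartz_kernel_def by metis
    moreover have "k \<in> tempered"
      using k by (simp add: is_schwartz_kernel_def)
    ultimately have "k \<psi> = a (T \<psi>)" if "\<psi> \<in> schwartz" for \<psi>
      using tempered_eqI_tensor[OF _ aT _ that] by blast
    then show "dist_eq k ?R"
      by (simp add: dist_eq_def R)
  next
    assume "dist_eq k ?R"
    then have eq: "k \<psi> = a (T \<psi>)" if "\<psi> \<in> schwartz" for \<psi>
      using that by (simp add: dist_eq_def R)
    then have "k \<in> tempered"
      by (intro tempered_cong[OF aT]) (simp add: dist_eq_def)
    then show "is_schwartz_kernel k (loc_op U a \<phi>1 \<phi>2)"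
      unfolding is_schwartz_kernel_def by (auto simp: loc eq tensor_schwartz schwartz_cnj)
  qed
qed

end
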